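(* Let $n=n_0+n_1$ with integers $n_0\ge0$, $n_1\ge2$. Let $(G,G_1)$ be one of the pairs consisting of a finite reflection group $G$ of type $\mathrm{A}_{n-1}$, $\mathrm{B}_n$ or $\mathrm{D}_n$ acting on $\mathbb{R}^n$ and its parabolic subgroup $G_1$ of the same type $\mathrm{A}_{n_1-1}$, $\mathrm{B}_{n_1}$ or $\mathrm{D}_{n_1}$ respectively. Let $P(x)$ and $P_1(x)$ be the products of the normalized linear forms defining the reflecting hyperplanes of $G$ and $G_1$, and let $d_1,\dots,d_n$ and $d_1^{(1)},\dots,d_{n_1}^{(1)}$ be the degrees of $G$ and $G_1$, indexed as specified in the context. Then for $\gamma\in\mathbb{C}$ with $\operatorname{Re}\gamma\ge0$, $$\int_{\mathbb{R}^n}P_1(x)^2\,|P(x)|^{2\gamma}\,d\mu=\prod_{i=1}^{n_0}\frac{\Gamma(1+d_i\gamma)}{\Gamma(1+\gamma)}\prod_{j=1}^{n_1}\frac{j(1+\gamma)}{j+(n_0+j)\gamma}\,\frac{\Gamma\big(1+d^{(1)}_j+d_{n_0+j}\gamma\big)}{\Gamma(2+\gamma)}.$$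
   Context: $d\mu=(2\pi)^{-n/2}\prod_{i=1}^n e^{-x_i^2/2}dx_1\cdots dx_n$ is the standard Gaussian measure on $\mathbb{R}^n$. Each linear form $a_{1}x_1+\cdots+a_{n}x_n$ in $P$, $P_1$ (one per reflecting hyperplane) is normalized by $\sum_j a_{j}^2=2$. $G_1$ is the standard parabolic subgroup acting on the last $n_1$ coordinates $x_{n_0+1},\dots,x_n$. Explicitly: Type A: $P=\prod_{1\le i<j\le n}(x_i-x_j)$, $P_1=\prod_{n_0+1\le i<j\le n}(x_i-x_j)$, degrees $d_i=i$ ($1\le i\le n$), $d^{(1)}_j=j$ ($1\le j\le n_1$). Type B: $P=\prod_{i=1}^n\sqrt2\,x_i\prod_{1\le i<j\le n}(x_i-x_j)(x_i+x_j)$, $P_1=\prod_{i=n_0+1}^n\sqrt2\,x_i\prod_{n_0+1\le i<j\le n}(x_i-x_j)(x_i+x_j)$, degrees $d_i=2i$ ($1\le i\le n$), $d^{(1)}_j=2j$ ($1\le j\le n_1$). Type D: $P=\prod_{1\le i<j\le n}(x_i-x_j)(x_i+x_j)$, $P_1=\prod_{n_0+1\le i<j\le n}(x_i-x_j)(x_i+x_j)$, degrees $d_i=2i$ ($1\le i\le n-1$), $d_n=n$, and $d^{(1)}_j=2j$ ($1\le j\le n_1-1$), $d^{(1)}_{n_1}=n_1$. *)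

theory Defs
  imports "HOL-Analysis.Analysis"
begin

text \<open>
  Points of \<open>\<real>\<^sup>n\<close> are functions \<open>nat \<Rightarrow> real\<close> on the index set \<open>{1..n}\<close>, with the product
  Lebesgue measure \<open>\<Pi>\<^sub>M i\<in>{1..n}. lborel\<close>; the dimension is thus an ordinary variable.
\<close>

definition gaussian_measure :: "nat \<Rightarrow> (nat \<Rightarrow> real) measure" where
  "gaussian_measure n =
     density (\<Pi>\<^sub>M i\<in>{1..n}. lborel)
       (\<lambda>x. ennreal ((2 * pi) powr (- real n / 2) * (\<Prod>i=1..n. exp (- (x i)\<^sup>2 / 2))))"

text \<open>
  The classical families: \<open>TypeA\<close>, \<open>TypeB\<close>, \<open>TypeD\<close> in dimension \<open>n\<close> stand for
  \<open>A\<^bsub>n-1\<^esub>\<close>, \<open>B\<^sub>n\<close>, \<open>D\<^sub>n\<close> acting on \<open>\<real>\<^sup>n\<close>.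
\<close>

datatype refl_type = TypeA | TypeB | TypeD

definition index_pairs :: "nat \<Rightarrow> nat \<Rightarrow> (nat \<times> nat) set" where
  "index_pairs m n = {(i, j). m + 1 \<le> i \<and> i < j \<and> j \<le> n}"

text \<open>
  \<open>forms_prod T m n\<close> is the product of the linear forms, one per reflecting hyperplane and each
  with coefficient vector of squared length 2, of the group of type \<open>T\<close> acting on the
  coordinates \<open>x\<^bsub>m+1\<^esub>, \<dots>, x\<^sub>n\<close>. The whole group has \<open>m = 0\<close>; the parabolic subgroup on the last
  coordinates has \<open>m = n\<^sub>0\<close>.
\<close>

fun forms_prod :: "refl_type \<Rightarrow> nat \<Rightarrow> nat \<Rightarrow> (nat \<Rightarrow> real) \<Rightarrow> real" where
  "forms_prod TypeA m n x = (\<Prod>(i, j)\<in>index_pairs m n. x i - x j)"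
| "forms_prod TypeB m n x =
     (\<Prod>i=m+1..n. sqrt 2 * x i) * (\<Prod>(i, j)\<in>index_pairs m n. (x i - x j) * (x i + x j))"
| "forms_prod TypeD m n x = (\<Prod>(i, j)\<in>index_pairs m n. (x i - x j) * (x i + x j))"

text \<open>
  The \<open>i\<close>-th degree, \<open>1 \<le> i \<le> n\<close>, of the group of type \<open>T\<close> on \<open>\<real>\<^sup>n\<close>. The order matters:
  in type D the degree \<open>n\<close> comes last, so the list is not sorted by size. In type A the group
  acts on all of \<open>\<real>\<^sup>n\<close>, whence the additional degree 1.
\<close>

fun refl_degree :: "refl_type \<Rightarrow> nat \<Rightarrow> nat \<Rightarrow> nat" where
  "refl_degree TypeA n i = i"
| "refl_degree TypeB n i = 2 * i"
| "refl_degree TypeD n i = (if i = n then n else 2 * i)"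

text \<open>
  The power \<open>\<bar>t\<bar>\<^sup>2\<^sup>\<gamma>\<close> is written \<open>complex_of_real \<bar>t\<bar> powr (2 * \<gamma>)\<close>. HOL sets \<open>0 powr z = 0\<close> also for
  \<open>z = 0\<close>; as the zero set of \<open>forms_prod\<close> is a null set, this does not affect the integral.
\<close>

end

theory Submission
  imports
    Defs
    "HOL-Computational_Algebra.Computational_Algebra"
    "HOL-Probability.Probability"
    "HOL-Real_Asymp.Real_Asymp"
    "HOL-Complex_Analysis.Complex_Analysis"
begin

text \<open>
  Write \<open>I\<^sub>m(\<gamma>)\<close> for the integral with \<open>n\<^sub>0 = m\<close>, \<open>P\<^sub>m\<close> for the corresponding \<open>P\<^sub>1\<close>, \<open>x\<close> for the coordinate
  \<open>m + 1\<close> and \<open>T\<close> for the Dunkl operator of \<open>G\<close> in direction \<open>x\<close>. For real \<open>\<gamma> = g > 1\<close>, integration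
  by parts makes \<open>p\<^sub>x - T\<close> the adjoint of \<open>T\<close> in the space weighted by \<open>|P|\<close> to the power \<open>2 g\<close>, and
  antisymmetry makes \<open>P\<^sub>m\<close> orthogonal to all polynomials of smaller degree. Expanding one factor
  of \<open>P\<^sub>m\<^sup>2\<close> along \<open>x\<close> as an alternating sum of terms \<open>p\<^sub>x\<^sup>K P\<^bsub>m+1\<^esub>\<close>, the integral of \<open>P\<^sub>m\<^sup>2\<close> becomes
  \<open>n - m\<close> times that of \<open>(T\<^sup>K P\<^sub>m) P\<^bsub>m+1\<^esub>\<close>, and \<open>T\<^sup>K P\<^sub>m\<close> is an explicit multiple of \<open>P\<^bsub>m+1\<^esub>\<close>. This
  gives \<open>I\<^sub>m / I\<^bsub>m+1\<^esub>\<close>, and so \<open>I\<^sub>m / I\<^sub>n\<close>.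

  Since \<open>I\<^sub>0(g) = I\<^sub>n(g + 1)\<close>, the case \<open>m = 0\<close> is a functional equation for the log-convex function
  \<open>I\<^sub>n\<close>. As in the Bohr-Mollerup theorem, the quotient of \<open>I\<^sub>n\<close> by the product of Gamma functions is
  then constant. Both sides are holomorphic for \<open>Re \<gamma> > 0\<close> and continuous up to \<open>Re \<gamma> = 0\<close>, so the
  constant is the same for all \<open>\<gamma>\<close>; at \<open>\<gamma> = 0\<close> it is 1.
\<close>

section \<open>Lagrange interpolation and Vandermonde products\<close>

text \<open>Antisymmetry and degree alone show that \<open>T\<^sup>K P\<^sub>m\<close> is some
  multiple of the next product; the difficulty is the constant. \<open>P\<^sub>m\<close> is
  antisymmetric in \<open>x\<close> and the coordinates \<open>Y\<close> above it, but has no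
  symmetry between \<open>x\<close> and the coordinates \<open>Z\<close> below, so the differences
  against \<open>Z\<close> do not act on it in a simple way. The product of the forms through
  \<open>x\<close> is therefore split into pieces that \<open>T\<close> lowers step by step, and
  only one piece survives all \<open>K\<close> steps. The differences against \<open>Y\<close> can
  be summed because a swap multiplies the Vandermonde product of \<open>Y\<close> by a Lagrange
  basis polynomial: the sum is a derivative in \<open>x\<close>, at the price of a new parameter for
  the differences against \<open>Z\<close>. Types B and D are reduced to this by passing to the
  squares of the coordinates. The condition \<open>g > 1\<close> keeps the exponent
  \<open>2 * g - 2\<close>, which appears when the weight is differentiated, positive. Constancy of
  the final quotient on a unit segment of real parameters suffices, by the identity theorem for
  holomorphic functions.\<close>

definition lagrange_basis :: "(nat \<Rightarrow> real) \<Rightarrow> nat set \<Rightarrow> nat \<Rightarrow> real \<Rightarrow> real" where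
  "lagrange_basis q Y j t = (\<Prod>i\<in>Y - {j}. (t - q i) / (q j - q i))"

lemma lagrange_interpolation:
  fixes h :: "real poly"
  assumes fin: "finite Y" and inj: "inj_on q Y" and deg: "degree h < card Y"
  shows "(\<Sum>j\<in>Y. poly h (q j) * lagrange_basis q Y j t) = poly h t"
proof -
  define B where "B j = (\<Prod>i\<in>Y - {j}. smult (1 / (q j - q i)) [:- q i, 1:])" for j
  define L where "L = (\<Sum>j\<in>Y. smult (poly h (q j)) (B j))"
  have pB: "poly (B j) u = lagrange_basis q Y j u" for j u
    by (simp add: B_def lagrange_basis_def poly_prod algebra_simps diff_divide_distrib)
  have pL: "poly L u = (\<Sum>j\<in>Y. poly h (q j) * lagrange_basis q Y j u)" for u
    by (simp add: L_def poly_sum pB)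
  have "degree (B j) \<le> card Y - 1" if "j \<in> Y" for j
  proof -
    have "degree (B j) \<le> (\<Sum>i\<in>Y - {j}. degree (smult (1 / (q j - q i)) [:- q i, 1:]))"
      unfolding B_def by (rule degree_prod_sum_le[unfolded o_def]) (use fin in simp)
    also have "\<dots> \<le> (\<Sum>i\<in>Y - {j}. 1)" by (intro sum_mono) auto
    finally show ?thesis using that fin by simp
  qed
  hence "degree L \<le> card Y - 1"
    unfolding L_def by (intro degree_sum_le fin) (auto intro: order_trans[OF degree_smult_le])
  moreover have "card Y > 0" using deg by linarith
  ultimately have dL: "degree L < card Y" by linarith
  have eq: "poly L u = poly h u" if u: "u \<in> q ` Y" for u
  proof -
    from u obtain k where k: "k \<in> Y" "u = q k" by blast
    have "lagrange_basis q Y j (q k) = (if j = k then 1 else 0)" if "j \<in> Y" for j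
    proof (cases "j = k")
      case True
      have "(\<Prod>i\<in>Y - {k}. (q k - q i) / (q k - q i)) = 1"
        using inj k by (intro prod.neutral) (auto simp: inj_on_def)
      thus ?thesis using True by (simp add: lagrange_basis_def)
    next
      case False
      thus ?thesis using k fin by (auto simp: lagrange_basis_def)
    qed
    hence "poly L u = (\<Sum>j\<in>Y. poly h (q j) * (if j = k then 1 else 0))"
      unfolding pL k by (intro sum.cong) auto
    also have "\<dots> = poly h u" using k fin by (simp add: if_distrib cong: if_cong)
    finally show ?thesis .
  qed
  have "L = h"
    using eq dL deg card_image[OF inj] by (intro poly_eqI_degree[of "q ` Y"]) auto
  with pL[of t] show ?thesis by (simp only:)
qed

text \<open>Subtracting the top coefficient times the monic polynomial with roots at the nodes
  brings the degree below the number of nodes and changes no value at a node. Degree equal to the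
  number of nodes is the case that the expansion of a Vandermonde product needs.\<close>

lemma lagrange_interpolation_monic:
  fixes h :: "real poly"
  assumes fin: "finite Y" and inj: "inj_on q Y" and deg: "degree h \<le> card Y"
  shows "poly h t = coeff h (card Y) * (\<Prod>i\<in>Y. t - q i)
           + (\<Sum>j\<in>Y. poly h (q j) * lagrange_basis q Y j t)"
proof (cases "card Y = 0")
  case True
  then obtain c where "h = [:c:]" using deg degree_eq_zeroE by auto
  thus ?thesis using True fin by simp
next
  case False
  define G where "G = (\<Prod>i\<in>Y. [:- q i, 1:])"
  define h' where "h' = h - smult (coeff h (card Y)) G"
  have dG: "degree G = card Y" "coeff G (card Y) = 1"
  proof -
    show d: "degree G = card Y" unfolding G_def by (subst degree_prod_eq_sum_degree) auto
    have "lead_coeff G = 1" unfolding G_def by (subst lead_coeff_prod) auto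
    thus "coeff G (card Y) = 1" using d by simp
  qed
  have pG: "poly G u = (\<Prod>i\<in>Y. u - q i)" for u by (simp add: G_def poly_prod algebra_simps)
  have "degree h' \<le> card Y" unfolding h'_def using dG deg
    by (intro degree_diff_le) (auto intro: order_trans[OF degree_smult_le])
  moreover have "coeff h' (card Y) = 0" using dG by (simp add: h'_def)
  ultimately have "degree h' < card Y"
    using False by (metis coeff_0 degree_0 gr0I le_neq_implies_less leading_coeff_0_iff)
  from lagrange_interpolation[OF fin inj this, of t]
  have "(\<Sum>j\<in>Y. poly h' (q j) * lagrange_basis q Y j t) = poly h' t" .
  moreover have "poly h' (q j) = poly h (q j)" if "j \<in> Y" for j
    using that fin by (auto simp: h'_def pG)
  hence "(\<Sum>j\<in>Y. poly h' (q j) * lagrange_basis q Y j t) = (\<Sum>j\<in>Y. poly h (q j) * lagrange_basis q Y j t)"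
    by (intro sum.cong) auto
  ultimately show ?thesis by (simp add: h'_def pG)
qed

lemma has_real_derivative_prod_linear:
  assumes "finite S" and "\<And>i. i \<in> S \<Longrightarrow> t \<noteq> q i"
  shows "((\<lambda>u. \<Prod>i\<in>S. (u - q i) / c i) has_real_derivative
           (\<Prod>i\<in>S. (t - q i) / c i) * (\<Sum>i\<in>S. 1 / (t - q i))) (at t)"
  using assms
proof (induction S rule: finite_induct)
  case (insert i S)
  have *: "((\<lambda>u. (u - q i) / c i * (\<Prod>i\<in>S. (u - q i) / c i)) has_real_derivative
     (1 / c i) * (\<Prod>i\<in>S. (t - q i) / c i) +
     ((\<Prod>i\<in>S. (t - q i) / c i) * (\<Sum>i\<in>S. 1 / (t - q i))) * ((t - q i) / c i)) (at t)"
    using insert by (intro DERIV_mult DERIV_cdivide insert.IH) (auto intro!: derivative_eq_intros)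
  have alg: "u * P + P * S' * a = a * P * (b + S')" if "u = a * b" for u P S' a b :: real
    by (simp add: that algebra_simps)
  have "1 / c i = (t - q i) / c i * (1 / (t - q i))" using insert by simp
  from alg[OF this] have "(1 / c i) * (\<Prod>i\<in>S. (t - q i) / c i) +
     ((\<Prod>i\<in>S. (t - q i) / c i) * (\<Sum>i\<in>S. 1 / (t - q i))) * ((t - q i) / c i)
     = (\<Prod>i\<in>insert i S. (t - q i) / c i) * (\<Sum>i\<in>insert i S. 1 / (t - q i))"
    using insert by simp
  moreover have "(\<lambda>u. (u - q i) / c i * (\<Prod>i\<in>S. (u - q i) / c i)) = (\<lambda>u. \<Prod>i\<in>insert i S. (u - q i) / c i)"
    using insert by simp
  ultimately show ?case using * by (simp only:)
qed simp

text \<open>The interpolation formula is differentiated at \<open>q x\<close>. The logarithmic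
  derivative of a basis polynomial is the sum of 1 / (\<open>q x - q i\<close>) over all nodes minus
  its own term. The full sum multiplies the interpolation formula again, which gives back
  \<open>poly h (q x)\<close>; the own terms are the subtracted ones on the left. Thus a sum of
  twisted difference quotients is a genuine derivative.\<close>

lemma lagrange_derivative:
  fixes h :: "real poly"
  assumes fin: "finite Y" and inj: "inj_on q (insert x Y)" and x: "x \<notin> Y" and deg: "degree h \<le> card Y"
  shows "(\<Sum>j\<in>Y. (poly h (q x) - lagrange_basis q Y j (q x) * poly h (q j)) / (q x - q j))
           = poly (pderiv h) (q x)"
proof -
  have inj': "inj_on q Y" using inj by (auto simp: inj_on_def)
  have ne: "q x \<noteq> q j" if "j \<in> Y" for j using inj x that by (auto simp: inj_on_def)
  define c where "c = coeff h (card Y)"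
  define S where "S = (\<Sum>i\<in>Y. 1 / (q x - q i))"
  have eq: "poly h t = c * (\<Prod>i\<in>Y. (t - q i) / 1)
           + (\<Sum>j\<in>Y. poly h (q j) * (\<Prod>i\<in>Y - {j}. (t - q i) / (q j - q i)))" for t
    using lagrange_interpolation_monic[OF fin inj' deg, of t] by (simp add: c_def lagrange_basis_def)
  have d1: "((\<lambda>t. c * (\<Prod>i\<in>Y. (t - q i) / 1)
           + (\<Sum>j\<in>Y. poly h (q j) * (\<Prod>i\<in>Y - {j}. (t - q i) / (q j - q i)))) has_real_derivative
        c * ((\<Prod>i\<in>Y. (q x - q i) / 1) * S) + (\<Sum>j\<in>Y. poly h (q j) *
         ((\<Prod>i\<in>Y - {j}. (q x - q i) / (q j - q i)) * (\<Sum>i\<in>Y-{j}. 1 / (q x - q i))))) (at (q x))"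
    unfolding S_def
    by (intro DERIV_add DERIV_sum DERIV_cmult has_real_derivative_prod_linear) (use fin ne in auto)
  have "((\<lambda>t. poly h t) has_real_derivative poly (pderiv h) (q x)) (at (q x))"
    by (rule poly_DERIV)
  hence "poly (pderiv h) (q x) = c * ((\<Prod>i\<in>Y. (q x - q i) / 1) * S) + (\<Sum>j\<in>Y. poly h (q j) *
         ((\<Prod>i\<in>Y - {j}. (q x - q i) / (q j - q i)) * (\<Sum>i\<in>Y-{j}. 1 / (q x - q i))))"
    by (rule DERIV_unique) (use d1 in \<open>simp only: eq[symmetric]\<close>)
  also have "(\<Sum>j\<in>Y. poly h (q j) *
         ((\<Prod>i\<in>Y - {j}. (q x - q i) / (q j - q i)) * (\<Sum>i\<in>Y-{j}. 1 / (q x - q i))))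
      = (\<Sum>j\<in>Y. poly h (q j) * lagrange_basis q Y j (q x) * (S - 1 / (q x - q j)))"
    using fin by (intro sum.cong) (auto simp: lagrange_basis_def S_def sum_diff1)
  also have "c * ((\<Prod>i\<in>Y. (q x - q i) / 1) * S) + \<dots>
     = (c * (\<Prod>i\<in>Y. (q x - q i)) + (\<Sum>j\<in>Y. poly h (q j) * lagrange_basis q Y j (q x))) * S
        - (\<Sum>j\<in>Y. poly h (q j) * lagrange_basis q Y j (q x) / (q x - q j))"
    by (simp add: algebra_simps sum_subtractf sum_distrib_left sum_distrib_right)
  also have "c * (\<Prod>i\<in>Y. (q x - q i)) + (\<Sum>j\<in>Y. poly h (q j) * lagrange_basis q Y j (q x)) = poly h (q x)"
    using lagrange_interpolation_monic[OF fin inj' deg, of "q x"] by (simp add: c_def)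
  finally show ?thesis
    by (simp add: S_def diff_divide_distrib sum_subtractf sum_distrib_left algebra_simps)
qed

section \<open>Vandermonde products: swaps, substitution and expansion\<close>

definition vandermonde :: "nat set \<Rightarrow> (nat \<Rightarrow> real) \<Rightarrow> real" where
  "vandermonde B q = (\<Prod>(i, j)\<in>{(i, j). i \<in> B \<and> j \<in> B \<and> i < j}. q i - q j)"

lemma vandermonde_cong: "(\<And>i. i \<in> B \<Longrightarrow> q i = q' i) \<Longrightarrow> vandermonde B q = vandermonde B q'"
  unfolding vandermonde_def by (intro prod.cong) auto

text \<open>The sign counts the pairs in which \<open>a\<close> comes second, where the difference
  has to be turned round. Most uses only need that the sign does not depend on
  \<open>q\<close>.\<close>

lemma vandermonde_remove:
  assumes "finite B" "a \<in> B"
  shows "vandermonde B q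
           = (-1) ^ card {i\<in>B. i < a} * (\<Prod>i\<in>B - {a}. q a - q i) * vandermonde (B - {a}) q"
proof -
  define e :: real where "e = (-1) ^ card {i\<in>B. i < a}"
  let ?P = "\<lambda>B. {(i, j). i \<in> B \<and> j \<in> B \<and> i < j}"
  let ?L = "{i\<in>B. i < a}" and ?G = "{i\<in>B. a < i}"
  have fin: "finite ?L" "finite ?G" using assms by auto
  have f2: "finite (?P (B - {a}))"
    by (rule finite_subset[of _ "B \<times> B"]) (use assms in auto)
  have *: "?P B = ?P (B - {a}) \<union> ((\<lambda>i. (i, a)) ` ?L \<union> Pair a ` ?G)"
    using assms by (auto simp: image_iff)
  have "vandermonde B q = vandermonde (B - {a}) q * ((\<Prod>i\<in>?L. q i - q a) * (\<Prod>i\<in>?G. q a - q i))"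
    unfolding vandermonde_def *
    apply (subst prod.union_disjoint)
    subgoal by (rule f2)
    subgoal using fin by blast
    subgoal by auto
    apply (subst prod.union_disjoint)
    subgoal using fin by blast
    subgoal using fin by blast
    subgoal by auto
    by (simp add: prod.reindex inj_on_def)
  also have "(\<Prod>i\<in>?L. q i - q a) = (\<Prod>i\<in>?L. (-1) * (q a - q i))" by simp
  also have "\<dots> = e * (\<Prod>i\<in>?L. q a - q i)" unfolding prod.distrib by (simp add: e_def)
  also have "e * (\<Prod>i\<in>?L. q a - q i) * (\<Prod>i\<in>?G. q a - q i) = e * (\<Prod>i\<in>?L \<union> ?G. q a - q i)"
    using fin by (subst prod.union_disjoint) auto
  also have "?L \<union> ?G = B - {a}" by auto
  finally show ?thesis by (simp add: e_def)
qed

definition swap_coords :: "nat \<Rightarrow> nat \<Rightarrow> (nat \<Rightarrow> real) \<Rightarrow> nat \<Rightarrow> real" where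
  "swap_coords a b q = q(a := q b, b := q a)"

lemma swap_coords_apply:
  "swap_coords a b q i = (if i = b then q a else if i = a then q b else q i)"
  by (simp add: swap_coords_def)

text \<open>Splitting off \<open>a\<close> and then \<open>b\<close> isolates the factor
  \<open>q a - q b\<close>, which changes sign; all that remains is symmetric in the two
  coordinates.\<close>

lemma vandermonde_swap:
  assumes "finite B" "a \<in> B" "b \<in> B" "a \<noteq> b"
  shows "vandermonde B (swap_coords a b q) = - vandermonde B q"
proof -
  obtain e where e: "\<And>q. vandermonde B q = e * (\<Prod>i\<in>B - {a}. q a - q i) * vandermonde (B - {a}) q"
    using vandermonde_remove[of B a] assms by blast
  obtain e' where e': "\<And>q. vandermonde (B - {a}) q
      = e' * (\<Prod>i\<in>B - {a} - {b}. q b - q i) * vandermonde (B - {a} - {b}) q"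
    using vandermonde_remove[of "B - {a}" b] assms by blast
  have r: "(\<Prod>i\<in>B - {a}. q a - q i) = (q a - q b) * (\<Prod>i\<in>B - {a} - {b}. q a - q i)" for q :: "nat \<Rightarrow> real"
    using assms by (intro prod.remove) auto
  have f: "vandermonde B q = e * e' * (q a - q b) * ((\<Prod>i\<in>B - {a} - {b}. q a - q i)
       * (\<Prod>i\<in>B - {a} - {b}. q b - q i)) * vandermonde (B - {a} - {b}) q" for q
    unfolding e[of q] e'[of q] r by simp
  have v: "vandermonde (B - {a} - {b}) (swap_coords a b q) = vandermonde (B - {a} - {b}) q"
    by (intro vandermonde_cong) (auto simp: swap_coords_def)
  have p: "(\<Prod>i\<in>B - {a} - {b}. c - swap_coords a b q i) = (\<Prod>i\<in>B - {a} - {b}. c - q i)" for c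
    by (intro prod.cong) (auto simp: swap_coords_def)
  show ?thesis unfolding f[of q] f[of "swap_coords a b q"] v p using assms
    by (simp add: swap_coords_def algebra_simps)
qed

text \<open>In the coordinate \<open>j\<close> alone the product is a polynomial with roots at the
  other nodes; normalised at \<open>q j\<close> it is the Lagrange basis polynomial. This is how
  interpolation enters the difference terms of a Dunkl operator.\<close>

lemma vandermonde_replace:
  assumes "finite Y" "j \<in> Y" "inj_on q Y"
  shows "vandermonde Y (q(j := t)) = vandermonde Y q * lagrange_basis q Y j t"
proof -
  obtain e where e: "\<And>q. vandermonde Y q = e * (\<Prod>i\<in>Y - {j}. q j - q i) * vandermonde (Y - {j}) q"
    using vandermonde_remove[of Y j] assms by blast
  have v: "vandermonde (Y - {j}) (q(j := t)) = vandermonde (Y - {j}) q"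
    by (intro vandermonde_cong) auto
  have "(\<Prod>i\<in>Y - {j}. (q(j := t)) j - (q(j := t)) i) = (\<Prod>i\<in>Y - {j}. t - q i)"
    by (intro prod.cong) auto
  also have "\<dots> = (\<Prod>i\<in>Y - {j}. q j - q i) * lagrange_basis q Y j t"
    unfolding lagrange_basis_def prod.distrib[symmetric]
    using assms by (intro prod.cong) (auto simp: inj_on_def)
  finally show ?thesis unfolding e[of q] e[of "q(j := t)"] v by simp
qed

lemma vandermonde_insert_less:
  assumes "finite Y" "\<And>y. y \<in> Y \<Longrightarrow> x < y"
  shows "vandermonde (insert x Y) q = (\<Prod>y\<in>Y. q x - q y) * vandermonde Y q"
proof -
  have "insert x Y - {x} = Y" and e: "{i \<in> insert x Y. i < x} = {}" using assms(2) by force+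
  thus ?thesis using vandermonde_remove[of "insert x Y" x q] assms(1) unfolding e by simp
qed

lemma vandermonde_swap_outside:
  assumes "finite Y" "inj_on q Y" "x \<notin> Y" "j \<in> Y"
  shows "vandermonde Y (swap_coords x j q) = vandermonde Y q * lagrange_basis q Y j (q x)"
proof -
  have "vandermonde Y (swap_coords x j q) = vandermonde Y (q(j := q x))"
    using assms by (intro vandermonde_cong) (auto simp: swap_coords_apply)
  thus ?thesis using assms by (simp add: vandermonde_replace)
qed

text \<open>Laplace expansion of the Vandermonde determinant along its row of highest powers. The
  minors are written as one product at swapped points, so that each term is a reflection image of
  the first one. The proof is the monic interpolation of the power \<open>card Y\<close> at
  \<open>q x\<close>.\<close>

lemma vandermonde_laplace:
  assumes "finite Y" "inj_on q Y" "\<And>y. y \<in> Y \<Longrightarrow> x < y"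
  shows "vandermonde (insert x Y) q = q x ^ card Y * vandermonde Y q
           - (\<Sum>j\<in>Y. q j ^ card Y * vandermonde Y (swap_coords x j q))"
proof -
  have "x \<notin> Y" using assms(3) by force
  hence "(\<Sum>j\<in>Y. q j ^ card Y * vandermonde Y (swap_coords x j q))
      = vandermonde Y q * (\<Sum>j\<in>Y. q j ^ card Y * lagrange_basis q Y j (q x))"
    using assms by (simp add: vandermonde_swap_outside sum_distrib_left mult_ac)
  also have "(\<Sum>j\<in>Y. q j ^ card Y * lagrange_basis q Y j (q x)) = q x ^ card Y - (\<Prod>i\<in>Y. q x - q i)"
    using lagrange_interpolation_monic[OF assms(1,2), of "monom 1 (card Y)" "q x"]
    by (simp add: poly_monom degree_monom_eq)
  finally show ?thesis using vandermonde_insert_less[OF assms(1,3), of q] by (simp add: algebra_simps)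
qed

lemma vandermonde_nonzero: "inj_on q B \<Longrightarrow> vandermonde B q \<noteq> 0"
  by (cases "finite {(i, j). i \<in> B \<and> j \<in> B \<and> i < j}")
     (auto simp: vandermonde_def prod_zero_iff inj_on_def)

section \<open>Generating functions for Dunkl operators\<close>

text \<open>The binomial series \<open>(1 - v s)\<^sup>c\<close> in the formal variable \<open>s\<close>.\<close>

definition fps_bin :: "real \<Rightarrow> real \<Rightarrow> real fps" where
  "fps_bin c v = Abs_fps (\<lambda>i. (c gchoose i) * (- v) ^ i)"

lemma fps_bin_nth [simp]: "fps_nth (fps_bin c v) i = (c gchoose i) * (- v) ^ i"
  by (simp add: fps_bin_def)

lemma fps_bin_add: "fps_bin (c + d) v = fps_bin c v * fps_bin d v"
proof (rule fps_ext)
  fix n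
  have "fps_nth (fps_binomial (c + d)) n = fps_nth (fps_binomial c * fps_binomial d) n"
    by (simp only: fps_binomial_add_mult)
  hence "(c + d) gchoose n = (\<Sum>i=0..n. (c gchoose i) * (d gchoose (n - i)))"
    by (simp add: fps_mult_nth)
  moreover have "(- v) ^ n = (- v) ^ i * (- v) ^ (n - i)" if "i \<in> {0..n}" for i
    using that by (simp flip: power_add)
  ultimately have "((c + d) gchoose n) * (- v) ^ n
     = (\<Sum>i=0..n. ((c gchoose i) * (- v) ^ i) * ((d gchoose (n - i)) * (- v) ^ (n - i)))"
    by (simp only: sum_distrib_right) (auto intro!: sum.cong)
  thus "fps_nth (fps_bin (c + d) v) n = fps_nth (fps_bin c v * fps_bin d v) n"
    by (simp add: fps_mult_nth)
qed

lemma fps_bin_0 [simp]: "fps_bin 0 v = 1"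
  by (rule fps_ext) (auto simp: gbinomial_0 gbinomial_0_left)

lemma fps_bin_1: "fps_bin 1 v = 1 - fps_const v * fps_X"
proof (rule fps_ext)
  fix n show "fps_nth (fps_bin 1 v) n = fps_nth (1 - fps_const v * fps_X) n"
  proof (cases n)
    case (Suc k)
    thus ?thesis using binomial_gbinomial[of 1 n, where 'a = real]
      by (cases k) (auto simp: fps_X_def)
  qed auto
qed

lemma fps_bin_uminus_1: "fps_bin (-1) v * (1 - fps_const v * fps_X) = 1"
proof -
  have "fps_bin (-1) v * fps_bin 1 v = fps_bin (-1 + 1) v" by (rule fps_bin_add[symmetric])
  also have "(-1 + 1 :: real) = 0" by simp
  finally show ?thesis by (simp only: fps_bin_1 fps_bin_0)
qed

lemma gbinomial_absorb: "real (Suc k) * (c gchoose Suc k) = c * ((c - 1) gchoose k)"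
  using gbinomial_absorption[of k c] by simp

lemma fps_deriv_fps_bin: "fps_deriv (fps_bin c v) = fps_const (- c * v) * fps_bin (c - 1) v"
proof (rule fps_ext)
  fix n
  have "fps_nth (fps_deriv (fps_bin c v)) n = (real (Suc n) * (c gchoose Suc n)) * ((- v) ^ n * (- v))"
    by simp
  also have "\<dots> = fps_nth (fps_const (- c * v) * fps_bin (c - 1) v) n"
    unfolding gbinomial_absorb by simp
  finally show "fps_nth (fps_deriv (fps_bin c v)) n = fps_nth (fps_const (- c * v) * fps_bin (c - 1) v) n" .
qed

text \<open>Differentiation in the parameter \<open>u\<close>, one coefficient at a time;
  \<open>fps_deriv\<close> is the derivative in the formal variable instead.\<close>

definition has_fps_pderiv :: "(real \<Rightarrow> real fps) \<Rightarrow> real fps \<Rightarrow> real \<Rightarrow> bool" where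
  "has_fps_pderiv F D t \<longleftrightarrow>
     (\<forall>i. ((\<lambda>u. fps_nth (F u) i) has_real_derivative fps_nth D i) (at t))"

lemma has_fps_pderiv_const: "has_fps_pderiv (\<lambda>u. F) 0 t"
  by (simp add: has_fps_pderiv_def)

lemma has_fps_pderiv_mult:
  assumes "has_fps_pderiv F D t" "has_fps_pderiv G E t"
  shows "has_fps_pderiv (\<lambda>u. F u * G u) (D * G t + F t * E) t"
  unfolding has_fps_pderiv_def
proof
  fix i
  have "((\<lambda>u. \<Sum>a=0..i. fps_nth (F u) a * fps_nth (G u) (i - a)) has_real_derivative
      (\<Sum>a=0..i. fps_nth D a * fps_nth (G t) (i - a) + fps_nth E (i - a) * fps_nth (F t) a)) (at t)"
    using assms unfolding has_fps_pderiv_def by (intro DERIV_sum DERIV_mult) auto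
  thus "((\<lambda>u. fps_nth (F u * G u) i) has_real_derivative fps_nth (D * G t + F t * E) i) (at t)"
    by (simp add: fps_mult_nth sum.distrib mult.commute[of "fps_nth E _"])
qed

lemma has_fps_pderiv_bin:
  "has_fps_pderiv (fps_bin c) (fps_const (- c) * fps_X * fps_bin (c - 1) v) v"
  unfolding has_fps_pderiv_def
proof
  fix i
  show "((\<lambda>u. fps_nth (fps_bin c u) i) has_real_derivative
     fps_nth (fps_const (- c) * fps_X * fps_bin (c - 1) v) i) (at v)"
  proof (cases i)
    case (Suc k)
    have "((\<lambda>u. (c gchoose Suc k) * (- u) ^ Suc k) has_real_derivative
        (c gchoose Suc k) * (real (Suc k) * (- 1 * (- v) ^ k))) (at v)"
      by (rule DERIV_cmult, rule DERIV_cong[OF DERIV_power_Suc[OF DERIV_minus[OF DERIV_ident]]]) simp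
    also have "(c gchoose Suc k) * (real (Suc k) * (- 1 * (- v) ^ k))
       = - (real (Suc k) * (c gchoose Suc k)) * (- v) ^ k" by simp
    also have "\<dots> = fps_nth (fps_const (- c) * fps_X * fps_bin (c - 1) v) i"
      unfolding gbinomial_absorb Suc by (simp add: mult.assoc)
    finally show ?thesis using Suc by simp
  qed (simp add: mult.assoc)
qed

text \<open>
  The product of \<open>gen_lower\<close> and \<open>gen_const\<close> is \<open>\<Prod>y. (1 - y s)\<close> divided by \<open>1 - x s\<close>, whose coefficient
  at \<open>card Y\<close> is \<open>\<Prod>y. (x - y)\<close>. The coefficients of \<open>gen_const\<close> behave like constants under the Dunkl
  operator, while those of \<open>gen_lower\<close> are lowered by it as by a derivative.
\<close>

definition gen_lower :: "real \<Rightarrow> nat \<Rightarrow> nat set \<Rightarrow> (nat \<Rightarrow> real) \<Rightarrow> real fps" where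
  "gen_lower k x Z q = fps_bin (- k - 1) (q x) * (\<Prod>z\<in>Z. fps_bin (- k) (q z))"

definition gen_const :: "real \<Rightarrow> nat \<Rightarrow> nat set \<Rightarrow> nat set \<Rightarrow> (nat \<Rightarrow> real) \<Rightarrow> real fps" where
  "gen_const k x Y Z q = (\<Prod>y\<in>Y. fps_bin 1 (q y)) * (fps_bin k (q x) * (\<Prod>z\<in>Z. fps_bin k (q z)))"

text \<open>The rational Dunkl operator of type A with parameter \<open>k\<close> in the direction
  \<open>x\<close>, where only \<open>x\<close> and \<open>Z\<close> take part: the operator that is
  left once the directions of \<open>Y\<close> have been summed. \<open>gen_lower\<close> is the
  classical generating function of polynomials that such an operator lowers.\<close>

definition dunkl_part :: "real \<Rightarrow> nat \<Rightarrow> nat set \<Rightarrow> ((nat \<Rightarrow> real) \<Rightarrow> real) \<Rightarrow> (nat \<Rightarrow> real) \<Rightarrow> real" where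
  "dunkl_part k x Z f q = deriv (\<lambda>t. f (q(x := t))) (q x)
     + k * (\<Sum>z\<in>Z. (f q - f (swap_coords x z q)) / (q x - q z))"

section \<open>Action of derivatives and swaps on the two generating functions\<close>

lemma prod_fps_bin_upd:
  "x \<notin> S \<Longrightarrow> (\<Prod>z\<in>S. fps_bin k ((q(x := t)) z)) = (\<Prod>z\<in>S. fps_bin k (q z))"
  by (intro prod.cong) auto

lemma gen_lower_upd:
  assumes "x \<notin> Z"
  shows "gen_lower k x Z (q(x := t)) = fps_bin (- k - 1) t * (\<Prod>z\<in>Z. fps_bin (- k) (q z))"
  by (simp only: gen_lower_def prod_fps_bin_upd[OF assms, of "- k" q t] fun_upd_same)

text \<open>Apart from one extra factor 1 / (1 - \<open>q x\<close> s) the series is symmetric in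
  \<open>x\<close> and \<open>Z\<close>, so the swap merely moves this factor to \<open>z\<close>.
  Placing the two factors on opposite sides avoids dividing power series.\<close>

lemma gen_lower_swap:
  assumes "finite Z" "x \<notin> Z" "z \<in> Z"
  shows "gen_lower k x Z (swap_coords x z q) * fps_bin (-1) (q x) = gen_lower k x Z q * fps_bin (-1) (q z)"
proof -
  have "(\<Prod>v\<in>Z - {z}. fps_bin (- k) (swap_coords x z q v)) = (\<Prod>v\<in>Z - {z}. fps_bin (- k) (q v))"
    using assms by (intro prod.cong) (auto simp: swap_coords_apply)
  moreover have "fps_bin (- k - 1) v = fps_bin (- k) v * fps_bin (- 1) v" for v
    using fps_bin_add[of "-k" "-1" v] by simp
  ultimately show ?thesis
    unfolding gen_lower_def using assms
    by (simp add: prod.remove[of Z z] swap_coords_apply mult_ac)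
qed

text \<open>The resolvent identity for 1 / (1 - a s) and 1 / (1 - b s). It exhibits the factor
  \<open>a - b\<close> that cancels the denominator of a divided difference.\<close>

lemma fps_bin_uminus_1_diff:
  "fps_bin (-1) a - fps_bin (-1) b = fps_const (a - b) * fps_X * fps_bin (-1) a * fps_bin (-1) b"
proof -
  let ?A = "fps_bin (-1) a" and ?B = "fps_bin (-1) b"
  have "?A - ?B = ?A * (?B * (1 - fps_const b * fps_X)) - ?B * (?A * (1 - fps_const a * fps_X))"
    by (simp only: fps_bin_uminus_1 mult_1_right)
  also have "\<dots> = (fps_const a - fps_const b) * fps_X * ?A * ?B"
    by (simp add: algebra_simps del: fps_const_sub)
  finally show ?thesis by (simp only: fps_const_sub)
qed

lemma fps_X_bin_uminus_1: "fps_const v * (fps_X * fps_bin (-1) v) = fps_bin (-1) v - 1"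
proof -
  have "fps_bin (-1) v - fps_bin (-1) v * (fps_const v * fps_X) = 1"
    using fps_bin_uminus_1[of v] by (simp only: right_diff_distrib mult_1_right)
  hence "fps_bin (-1) v * (fps_const v * fps_X) = fps_bin (-1) v - 1" by algebra
  thus ?thesis by (simp only: mult_ac)
qed

text \<open>The Euler operator s d/ds multiplies the coefficient of index i by i. Expressed through
  1 / (1 - v s), it turns the sums of such series that a Dunkl operator produces into multiplication
  by a number in each degree.\<close>

lemma fps_X_fps_deriv_fps_bin:
  "fps_X * fps_deriv (fps_bin c v) = fps_const (- c) * (fps_bin (- 1) v - 1) * fps_bin c v"
proof -
  have "fps_bin (c - 1) v = fps_bin c v * fps_bin (-1) v" using fps_bin_add[of c "-1" v] by simp
  hence "fps_X * fps_deriv (fps_bin c v)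
     = fps_const (- c) * (fps_const v * (fps_X * fps_bin (-1) v)) * fps_bin c v"
    unfolding fps_deriv_fps_bin by (simp add: mult_ac flip: fps_const_mult)
  thus ?thesis by (simp only: fps_X_bin_uminus_1)
qed

lemma fps_X_fps_deriv_prod_bin:
  assumes "finite Z"
  shows "fps_X * fps_deriv (\<Prod>z\<in>Z. fps_bin c (q z))
     = fps_const (- c) * (\<Sum>z\<in>Z. fps_bin (- 1) (q z) - 1) * (\<Prod>z\<in>Z. fps_bin c (q z))"
  using assms
proof (induction Z rule: finite_induct)
  case (insert z Z)
  have "fps_X * fps_deriv (fps_bin c (q z) * (\<Prod>z\<in>Z. fps_bin c (q z)))
     = (fps_X * fps_deriv (fps_bin c (q z))) * (\<Prod>z\<in>Z. fps_bin c (q z))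
       + fps_bin c (q z) * (fps_X * fps_deriv (\<Prod>z\<in>Z. fps_bin c (q z)))"
    by (simp add: algebra_simps)
  thus ?case unfolding insert.IH fps_X_fps_deriv_fps_bin using insert.hyps
    by (simp add: algebra_simps)
qed simp

lemma fps_X_fps_deriv_gen_lower:
  assumes "finite Z"
  shows "fps_X * fps_deriv (gen_lower k x Z q) = gen_lower k x Z q *
    (fps_const (k + 1) * (fps_bin (-1) (q x) - 1) + fps_const k * (\<Sum>z\<in>Z. fps_bin (-1) (q z) - 1))"
proof -
  have "fps_X * fps_deriv (gen_lower k x Z q) =
     (fps_X * fps_deriv (fps_bin (- k - 1) (q x))) * (\<Prod>z\<in>Z. fps_bin (- k) (q z))
       + fps_bin (- k - 1) (q x) * (fps_X * fps_deriv (\<Prod>z\<in>Z. fps_bin (- k) (q z)))"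
    by (simp add: gen_lower_def algebra_simps)
  thus ?thesis
    unfolding fps_X_fps_deriv_fps_bin fps_X_fps_deriv_prod_bin[OF assms]
    by (simp add: gen_lower_def algebra_simps)
qed

lemma has_fps_pderiv_gen_lower:
  assumes "x \<notin> Z"
  shows "has_fps_pderiv (\<lambda>t. gen_lower k x Z (q(x := t)))
     (fps_const (k + 1) * fps_X * fps_bin (-1) (q x) * gen_lower k x Z q) (q x)"
proof -
  have "has_fps_pderiv (\<lambda>t. fps_bin (- k - 1) t * (\<Prod>z\<in>Z. fps_bin (- k) (q z)))
     (fps_const (- (- k - 1)) * fps_X * fps_bin (- k - 1 - 1) (q x) * (\<Prod>z\<in>Z. fps_bin (- k) (q z))
       + fps_bin (- k - 1) (q x) * 0) (q x)"
    by (intro has_fps_pderiv_mult has_fps_pderiv_bin has_fps_pderiv_const)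
  moreover have "fps_bin (- k - 1 - 1) (q x) = fps_bin (- k - 1) (q x) * fps_bin (-1) (q x)"
    using fps_bin_add[of "-k-1" "-1" "q x"] by simp
  ultimately show ?thesis
    unfolding gen_lower_upd[OF assms] by (simp add: gen_lower_def mult_ac add_ac)
qed

lemma fps_nth_DERIV_imp_deriv:
  "has_fps_pderiv F D t \<Longrightarrow> deriv (\<lambda>u. fps_nth (F u) i) t = fps_nth D i"
  unfolding has_fps_pderiv_def by (auto intro: DERIV_imp_deriv)

lemma gen_lower_swap':
  assumes "finite Z" "x \<notin> Z" "z \<in> Z"
  shows "gen_lower k x Z (swap_coords x z q)
      = gen_lower k x Z q * (fps_bin (-1) (q z) * (1 - fps_const (q x) * fps_X))"
proof -
  have "gen_lower k x Z (swap_coords x z q)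
     = (gen_lower k x Z (swap_coords x z q) * fps_bin (-1) (q x)) * (1 - fps_const (q x) * fps_X)"
    by (simp only: mult.assoc fps_bin_uminus_1 mult_1_right)
  also have "\<dots> = gen_lower k x Z q * (fps_bin (-1) (q z) * (1 - fps_const (q x) * fps_X))"
    by (subst gen_lower_swap[OF assms]) (rule mult.assoc)
  finally show ?thesis .
qed

lemma gen_lower_divided_difference:
  assumes "finite Z" "x \<notin> Z" "z \<in> Z" "q x \<noteq> q z"
  shows "(fps_nth (gen_lower k x Z q) i - fps_nth (gen_lower k x Z (swap_coords x z q)) i) / (q x - q z)
     = fps_nth (gen_lower k x Z q * (fps_X * fps_bin (-1) (q z))) i"
proof -
  have "gen_lower k x Z q - gen_lower k x Z (swap_coords x z q)
      = gen_lower k x Z q * ((fps_bin (-1) (q x) - fps_bin (-1) (q z)) * (1 - fps_const (q x) * fps_X))"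
  proof -
    define c where "c = 1 - fps_const (q x) * fps_X"
    have "fps_bin (-1) (q x) * c = 1" by (simp only: c_def fps_bin_uminus_1)
    thus ?thesis unfolding gen_lower_swap'[OF assms(1-3)] c_def[symmetric]
      by (simp only: left_diff_distrib right_diff_distrib mult_1_right)
  qed
  also have "\<dots> = gen_lower k x Z q * (fps_const (q x - q z) * fps_X * fps_bin (-1) (q z) *
        (fps_bin (-1) (q x) * (1 - fps_const (q x) * fps_X)))"
    by (simp only: fps_bin_uminus_1_diff mult_ac)
  also have "\<dots> = fps_const (q x - q z) * (gen_lower k x Z q * (fps_X * fps_bin (-1) (q z)))"
    by (simp only: fps_bin_uminus_1 mult_1_right) (simp only: mult_ac)
  finally have "fps_nth (gen_lower k x Z q - gen_lower k x Z (swap_coords x z q)) i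
     = (q x - q z) * fps_nth (gen_lower k x Z q * (fps_X * fps_bin (-1) (q z))) i"
    by (simp only: fps_mult_left_const_nth)
  thus ?thesis using assms(4) by (simp add: field_simps)
qed

text \<open>The derivative and the differences together give s times \<open>gen_lower\<close> times
  the sum of 1 / (1 - \<open>q x\<close> s) with weight \<open>k + 1\<close> and of 1 / (1 -
  \<open>q z\<close> s) with weight \<open>k\<close>. This sum acts as the Euler operator plus the
  sum of the weights, 1 + (\<open>card Z\<close> + 1) k. Because of the factor s in front, the Euler
  operator contributes i - 1, which completes the constant.\<close>

lemma dunkl_part_gen_lower:
  assumes "finite Z" "x \<notin> Z" "\<And>z. z \<in> Z \<Longrightarrow> q x \<noteq> q z"
  shows "dunkl_part k x Z (\<lambda>q. fps_nth (gen_lower k x Z q) i) q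
     = (if i = 0 then 0 else (real i + (real (card Z) + 1) * k) * fps_nth (gen_lower k x Z q) (i - 1))"
proof -
  let ?G = "gen_lower k x Z q"
  have "dunkl_part k x Z (\<lambda>q. fps_nth (gen_lower k x Z q) i) q
     = fps_nth (fps_const (k + 1) * fps_X * fps_bin (-1) (q x) * ?G
        + fps_const k * (\<Sum>z\<in>Z. ?G * (fps_X * fps_bin (-1) (q z)))) i"
    unfolding dunkl_part_def fps_nth_DERIV_imp_deriv[OF has_fps_pderiv_gen_lower[OF assms(2)]]
    using assms by (simp add: gen_lower_divided_difference fps_sum_nth)
  also have "fps_const (k + 1) * fps_X * fps_bin (-1) (q x) * ?G
        + fps_const k * (\<Sum>z\<in>Z. ?G * (fps_X * fps_bin (-1) (q z)))
      = fps_X * (?G * (fps_const (k + 1) * fps_bin (-1) (q x) + fps_const k * (\<Sum>z\<in>Z. fps_bin (-1) (q z))))"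
    by (simp add: sum_distrib_left algebra_simps)
  also have "?G * (fps_const (k + 1) * fps_bin (-1) (q x) + fps_const k * (\<Sum>z\<in>Z. fps_bin (-1) (q z)))
     = fps_X * fps_deriv ?G + fps_const (1 + (real (card Z) + 1) * k) * ?G"
  proof -
    have "(of_nat (card Z) :: real fps) = fps_const (real (card Z))" by (simp add: fps_of_nat)
    hence "fps_const (1 + (real (card Z) + 1) * k) = fps_const (k + 1) + fps_const k * of_nat (card Z)"
      by (simp add: algebra_simps)
    thus ?thesis
      unfolding fps_X_fps_deriv_gen_lower[OF assms(1)]
      by (simp only: sum_subtractf) (simp add: algebra_simps)
  qed
  finally show ?thesis by (cases i) (auto simp: algebra_simps)
qed

text \<open>Needed for types B and D, where every second application of the operator meets an
  additional odd factor. With the factor \<open>q x\<close> a divided difference yields 1 / (1 -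
  \<open>q z\<close> s) without the factor s, so the index stays and the constant changes.\<close>

lemma dunkl_part_times_gen_lower:
  assumes "finite Z" "x \<notin> Z" "\<And>z. z \<in> Z \<Longrightarrow> q x \<noteq> q z"
  shows "dunkl_part k x Z (\<lambda>q. q x * fps_nth (gen_lower k x Z q) i) q
     = (1 + real i + real (card Z) * k) * fps_nth (gen_lower k x Z q) i"
proof -
  let ?G = "gen_lower k x Z q"
  have d: "deriv (\<lambda>t. t * fps_nth (gen_lower k x Z (q(x := t))) i) (q x)
     = fps_nth ?G i + q x * fps_nth (fps_const (k + 1) * fps_X * fps_bin (-1) (q x) * ?G) i"
  proof -
    have "((\<lambda>t. fps_nth (gen_lower k x Z (q(x := t))) i) has_real_derivative
       fps_nth (fps_const (k + 1) * fps_X * fps_bin (-1) (q x) * ?G) i) (at (q x))"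
      using has_fps_pderiv_gen_lower[OF assms(2)] by (simp add: has_fps_pderiv_def)
    from DERIV_mult[OF DERIV_ident this] show ?thesis
      by (intro DERIV_imp_deriv) (simp add: mult_ac)
  qed
  have s: "(q x * fps_nth ?G i - q z * fps_nth (gen_lower k x Z (swap_coords x z q)) i) / (q x - q z)
     = fps_nth (?G * fps_bin (-1) (q z)) i" if "z \<in> Z" for z
  proof -
    have "(q x * fps_nth ?G i - q z * fps_nth (gen_lower k x Z (swap_coords x z q)) i) / (q x - q z)
      = fps_nth ?G i + q z * ((fps_nth ?G i - fps_nth (gen_lower k x Z (swap_coords x z q)) i) / (q x - q z))"
      using assms(3)[OF that] by (simp add: field_simps)
    also have "\<dots> = fps_nth (?G + ?G * (fps_const (q z) * (fps_X * fps_bin (-1) (q z)))) i"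
      unfolding gen_lower_divided_difference[OF assms(1,2) that assms(3)[OF that]]
      by (simp add: mult.left_commute[of ?G])
    also have "\<dots> = fps_nth (?G * fps_bin (-1) (q z)) i"
      unfolding fps_X_bin_uminus_1 by (simp add: algebra_simps)
    finally show ?thesis .
  qed
  have "dunkl_part k x Z (\<lambda>q. q x * fps_nth (gen_lower k x Z q) i) q
     = fps_nth ?G i + q x * fps_nth (fps_const (k + 1) * fps_X * fps_bin (-1) (q x) * ?G) i
      + k * (\<Sum>z\<in>Z. fps_nth (?G * fps_bin (-1) (q z)) i)"
  proof -
    have "(\<Sum>z\<in>Z. (q x * fps_nth ?G i - swap_coords x z q x * fps_nth (gen_lower k x Z (swap_coords x z q)) i)
        / (q x - q z)) = (\<Sum>z\<in>Z. fps_nth (?G * fps_bin (-1) (q z)) i)"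
    proof (intro sum.cong refl)
      fix z assume z: "z \<in> Z"
      hence "swap_coords x z q x = q z" using assms by (auto simp: swap_coords_apply)
      thus "(q x * fps_nth ?G i - swap_coords x z q x * fps_nth (gen_lower k x Z (swap_coords x z q)) i)
        / (q x - q z) = fps_nth (?G * fps_bin (-1) (q z)) i" using s[OF z] by (simp only:)
    qed
    moreover have "deriv (\<lambda>t. (q(x := t)) x * fps_nth (gen_lower k x Z (q(x := t))) i) (q x)
       = fps_nth ?G i + q x * fps_nth (fps_const (k + 1) * fps_X * fps_bin (-1) (q x) * ?G) i"
      using d by simp
    ultimately show ?thesis unfolding dunkl_part_def by (simp only:)
  qed
  also have "\<dots> = fps_nth (?G + fps_const (q x) * (fps_const (k + 1) * fps_X * fps_bin (-1) (q x) * ?G)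
      + fps_const k * (\<Sum>z\<in>Z. ?G * fps_bin (-1) (q z))) i"
    by (simp add: fps_sum_nth)
  also have "?G + fps_const (q x) * (fps_const (k + 1) * fps_X * fps_bin (-1) (q x) * ?G)
      + fps_const k * (\<Sum>z\<in>Z. ?G * fps_bin (-1) (q z))
     = ?G * (1 + fps_const (k + 1) * (fps_const (q x) * (fps_X * fps_bin (-1) (q x)))
         + fps_const k * (\<Sum>z\<in>Z. fps_bin (-1) (q z)))"
    by (simp add: algebra_simps sum_distrib_left)
  also have "\<dots> = fps_X * fps_deriv ?G + fps_const (1 + real (card Z) * k) * ?G"
  proof -
    have "(of_nat (card Z) :: real fps) = fps_const (real (card Z))" by (simp add: fps_of_nat)
    hence "fps_const (1 + real (card Z) * k) = 1 + fps_const k * of_nat (card Z)"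
      by (simp add: algebra_simps flip: fps_const_1_eq_1)
    thus ?thesis
      unfolding fps_X_fps_deriv_gen_lower[OF assms(1)] fps_X_bin_uminus_1
      by (simp only: sum_subtractf) (simp add: algebra_simps)
  qed
  also have "fps_nth (fps_X * fps_deriv ?G + fps_const (1 + real (card Z) * k) * ?G) i
     = (1 + real i + real (card Z) * k) * fps_nth ?G i"
    by (cases i) (auto simp: algebra_simps)
  finally show ?thesis .
qed

lemma gen_lower_times_gen_const:
  assumes "finite Y" "x \<notin> Y"
  shows "gen_lower k x Z q * gen_const k x Y Z q = fps_bin (-1) (q x) * (\<Prod>y\<in>Y. fps_bin 1 (q y))"
proof -
  have a: "fps_bin (- k - 1) v * fps_bin k v = fps_bin (-1) v" for v
    using fps_bin_add[of "-k-1" k v] by simp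
  have b: "fps_bin (- k) v * fps_bin k v = 1" for v
    using fps_bin_add[of "-k" k v] by simp
  have c: "(\<Prod>z\<in>Z. fps_bin (- k) (q z)) * (\<Prod>z\<in>Z. fps_bin k (q z)) = 1"
    unfolding prod.distrib[symmetric] b by simp
  have "gen_lower k x Z q * gen_const k x Y Z q = (fps_bin (- k - 1) (q x) * fps_bin k (q x)) *
     (\<Prod>y\<in>Y. fps_bin 1 (q y)) * ((\<Prod>z\<in>Z. fps_bin (- k) (q z)) * (\<Prod>z\<in>Z. fps_bin k (q z)))"
    by (simp only: gen_lower_def gen_const_def mult_ac)
  thus ?thesis by (simp only: a c mult_1_right)
qed

text \<open>Starting from the geometric series, a factor 1 - \<open>q y\<close> s combines two
  neighbouring coefficients into \<open>u ^ Suc n - q y * u ^ n\<close>. The induction therefore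
  runs over all coefficients from \<open>card Y\<close> on; the case \<open>n = 0\<close> is the
  product of differences.\<close>

lemma fps_nth_gen_product:
  assumes "finite Y"
  shows "fps_nth (fps_bin (-1) u * (\<Prod>y\<in>Y. fps_bin 1 (q y))) (card Y + n) = u ^ n * (\<Prod>y\<in>Y. u - q y)"
  using assms
proof (induction Y arbitrary: n rule: finite_induct)
  case empty
  have "(- 1 gchoose n) * (- u) ^ n = u ^ n" for n
  proof -
    have "(-1 gchoose n) = (-1 :: real) ^ n"
      using gbinomial_minus[of "1 :: real" n] binomial_gbinomial[of n n, where 'a = real] by simp
    thus ?thesis by (simp flip: power_mult_distrib)
  qed
  thus ?case by simp
next
  case (insert y Y)
  let ?E = "fps_bin (-1) u * (\<Prod>y\<in>Y. fps_bin 1 (q y))"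
  have "fps_bin (-1) u * (\<Prod>y\<in>insert y Y. fps_bin 1 (q y)) = ?E - fps_const (q y) * (fps_X * ?E)"
    using insert.hyps by (simp add: fps_bin_1 algebra_simps)
  hence "fps_nth (fps_bin (-1) u * (\<Prod>y\<in>insert y Y. fps_bin 1 (q y))) (card (insert y Y) + n)
     = fps_nth ?E (card Y + Suc n) - q y * fps_nth ?E (card Y + n)"
    using insert.hyps by simp
  thus ?case unfolding insert.IH using insert.hyps by (simp add: algebra_simps)
qed

lemma prod_diff_decomposition:
  assumes "finite Y" "x \<notin> Y"
  shows "(\<Prod>y\<in>Y. q x - q y)
    = (\<Sum>i=0..card Y. fps_nth (gen_lower k x Z q) i * fps_nth (gen_const k x Y Z q) (card Y - i))"
  using fps_nth_gen_product[OF assms(1), of "q x" q 0]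
  unfolding gen_lower_times_gen_const[OF assms, of k Z q, symmetric] fps_mult_nth by simp

text \<open>The exponents 1 at \<open>j\<close> and \<open>k\<close> at \<open>x\<close> trade
  places. The result is arranged so that only the last factor depends on \<open>j\<close>: all
  swapped series are values of one expression at the nodes \<open>q j\<close>.\<close>

lemma gen_const_swap:
  assumes "finite Y" "j \<in> Y" "x \<notin> Y" "x \<notin> Z" "j \<notin> Z"
  shows "gen_const k x Y Z (swap_coords x j q)
     = gen_const k x Y Z q * fps_bin (1 - k) (q x) * fps_bin (k - 1) (q j)"
proof -
  have 1: "(\<Prod>y\<in>Y - {j}. fps_bin 1 (swap_coords x j q y)) = (\<Prod>y\<in>Y - {j}. fps_bin 1 (q y))"
    using assms by (intro prod.cong) (auto simp: swap_coords_apply)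
  have 2: "(\<Prod>z\<in>Z. fps_bin k (swap_coords x j q z)) = (\<Prod>z\<in>Z. fps_bin k (q z))"
    using assms by (intro prod.cong) (auto simp: swap_coords_apply)
  have 3: "swap_coords x j q x = q j" "swap_coords x j q j = q x" by (auto simp: swap_coords_apply)
  have 4: "fps_bin 1 (q x) = fps_bin k (q x) * fps_bin (1 - k) (q x)"
    using fps_bin_add[of k "1 - k" "q x"] by simp
  have 5: "fps_bin k (q j) = fps_bin 1 (q j) * fps_bin (k - 1) (q j)"
    using fps_bin_add[of 1 "k - 1" "q j"] by simp
  show ?thesis
    unfolding gen_const_def prod.remove[OF assms(1,2)] 1 2 3 unfolding 4 5
    by (simp only: mult_ac)
qed

lemma gen_const_swap_Z:
  assumes "finite Z" "z \<in> Z" "x \<notin> Y" "x \<notin> Z" "z \<notin> Y"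
  shows "gen_const k x Y Z (swap_coords x z q) = gen_const k x Y Z q"
proof -
  have 1: "(\<Prod>v\<in>Z - {z}. fps_bin k (swap_coords x z q v)) = (\<Prod>v\<in>Z - {z}. fps_bin k (q v))"
    using assms by (intro prod.cong) (auto simp: swap_coords_apply)
  have 2: "(\<Prod>y\<in>Y. fps_bin 1 (swap_coords x z q y)) = (\<Prod>y\<in>Y. fps_bin 1 (q y))"
    using assms by (intro prod.cong) (auto simp: swap_coords_apply)
  have 3: "swap_coords x z q x = q z" "swap_coords x z q z = q x" by (auto simp: swap_coords_apply)
  show ?thesis
    unfolding gen_const_def prod.remove[OF assms(1,2)] 1 2 3
    by (simp only: mult_ac)
qed

lemma has_fps_pderiv_gen_const:
  assumes "x \<notin> Y" "x \<notin> Z"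
  shows "has_fps_pderiv (\<lambda>t. gen_const k x Y Z (q(x := t)))
     (fps_const (- k) * fps_X * fps_bin (-1) (q x) * gen_const k x Y Z q) (q x)"
proof -
  let ?C = "\<Prod>y\<in>Y. fps_bin 1 (q y)" and ?D = "\<Prod>z\<in>Z. fps_bin k (q z)"
  have eq: "gen_const k x Y Z (q(x := t)) = (?C * ?D) * fps_bin k t" for t
    unfolding gen_const_def prod_fps_bin_upd[OF assms(1), of 1 q t] prod_fps_bin_upd[OF assms(2), of k q t]
    by (simp add: mult_ac)
  have "has_fps_pderiv (\<lambda>t. (?C * ?D) * fps_bin k t)
    (0 * fps_bin k (q x) + (?C * ?D) * (fps_const (- k) * fps_X * fps_bin (k - 1) (q x))) (q x)"
    by (intro has_fps_pderiv_mult has_fps_pderiv_bin has_fps_pderiv_const)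
  moreover have "fps_bin (k - 1) (q x) = fps_bin k (q x) * fps_bin (-1) (q x)"
    using fps_bin_add[of k "-1" "q x"] by simp
  ultimately show ?thesis unfolding eq by (simp add: gen_const_def mult_ac)
qed

text \<open>By \<open>gen_const_swap\<close> the values at \<open>q\<close> and at its swaps with
  \<open>Y\<close> are values of a single polynomial in one variable, at \<open>q x\<close> and at
  the nodes \<open>q j\<close>. Hence \<open>lagrange_derivative\<close> applies. Its degree
  condition is the bound on \<open>l + degree p\<close>, which the pieces of total index
  \<open>card Y\<close> just meet.\<close>

lemma gen_const_lagrange:
  fixes k :: real
  assumes fin: "finite Y" and d: "x \<notin> Y" "x \<notin> Z" "Y \<inter> Z = {}"
    and inj: "inj_on q (insert x Y)" and deg: "l + degree p \<le> card Y"
  defines "G \<equiv> gen_const k x Y Z"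
  shows "(\<Sum>j\<in>Y. (fps_nth (G q) l * poly p (q x)
            - lagrange_basis q Y j (q x) * (fps_nth (G (swap_coords x j q)) l * poly p (q j))) / (q x - q j))
      = fps_nth (G q) l * poly (pderiv p) (q x)
        + (1 - k) * fps_nth (fps_X * fps_bin (-1) (q x) * G q) l * poly p (q x)"
proof -
  define Q where "Q = G q * fps_bin (1 - k) (q x)"
  define h where "h a = smult (((k - 1) gchoose a) * (-1) ^ a) (monom 1 a * p)" for a
  have ph: "poly (h a) u = fps_nth (fps_bin (k - 1) u) a * poly p u" for a u
  proof -
    have "(- u) ^ a = (-1) ^ a * u ^ a" by (rule power_minus)
    thus ?thesis by (simp only: h_def poly_smult poly_mult poly_monom fps_bin_nth mult_ac)
  qed
  have dh: "degree (h a) \<le> card Y" if "a \<le> l" for a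
  proof -
    have "degree (h a) \<le> degree (monom (1::real) a * p)" unfolding h_def by (rule degree_smult_le)
    also have "\<dots> \<le> degree (monom (1::real) a) + degree p" by (rule degree_mult_le)
    also have "\<dots> \<le> card Y" using that deg degree_monom_le[of "1::real" a] by linarith
    finally show ?thesis .
  qed
  have Gu: "fps_nth (Q * fps_bin (k - 1) u) l * poly p u = (\<Sum>a=0..l. fps_nth Q (l - a) * poly (h a) u)" for u
    unfolding mult.commute[of Q] fps_mult_nth ph by (simp add: sum_distrib_left sum_distrib_right mult_ac)
  have G1: "G q = Q * fps_bin (k - 1) (q x)"
    using fps_bin_add[of "1 - k" "k - 1" "q x"] by (simp add: Q_def mult.assoc)
  have G2: "G (swap_coords x j q) = Q * fps_bin (k - 1) (q j)" if "j \<in> Y" for j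
    using gen_const_swap[OF fin that d(1,2)] d(3) that by (auto simp: G_def Q_def)
  have "(\<Sum>j\<in>Y. (fps_nth (G q) l * poly p (q x)
            - lagrange_basis q Y j (q x) * (fps_nth (G (swap_coords x j q)) l * poly p (q j))) / (q x - q j))
     = (\<Sum>j\<in>Y. \<Sum>a=0..l. fps_nth Q (l - a) *
           ((poly (h a) (q x) - lagrange_basis q Y j (q x) * poly (h a) (q j)) / (q x - q j)))"
  proof (intro sum.cong refl)
    fix j assume j: "j \<in> Y"
    have "fps_nth (G q) l * poly p (q x) = (\<Sum>a=0..l. fps_nth Q (l - a) * poly (h a) (q x))"
      unfolding G1 by (rule Gu)
    moreover have "fps_nth (G (swap_coords x j q)) l * poly p (q j) = (\<Sum>a=0..l. fps_nth Q (l - a) * poly (h a) (q j))"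
      unfolding G2[OF j] by (rule Gu)
    ultimately show "(fps_nth (G q) l * poly p (q x)
            - lagrange_basis q Y j (q x) * (fps_nth (G (swap_coords x j q)) l * poly p (q j))) / (q x - q j)
      = (\<Sum>a=0..l. fps_nth Q (l - a) *
           ((poly (h a) (q x) - lagrange_basis q Y j (q x) * poly (h a) (q j)) / (q x - q j)))"
      by (simp only: sum_distrib_left sum_subtractf[symmetric] sum_divide_distrib)
         (intro sum.cong refl, simp add: algebra_simps)
  qed
  also have "\<dots> = (\<Sum>a=0..l. fps_nth Q (l - a) *
      (\<Sum>j\<in>Y. (poly (h a) (q x) - lagrange_basis q Y j (q x) * poly (h a) (q j)) / (q x - q j)))"
    by (subst sum.swap) (simp only: sum_distrib_left)
  also have "\<dots> = (\<Sum>a=0..l. fps_nth Q (l - a) *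
      (fps_nth (fps_bin (k - 1) (q x)) a * poly (pderiv p) (q x)
        + fps_nth (fps_const (1 - k) * fps_X * fps_bin (k - 2) (q x)) a * poly p (q x)))"
  proof (intro sum.cong refl arg_cong2[where f = "(*)"])
    fix a assume "a \<in> {0..l}"
    hence "(\<Sum>j\<in>Y. (poly (h a) (q x) - lagrange_basis q Y j (q x) * poly (h a) (q j)) / (q x - q j))
       = poly (pderiv (h a)) (q x)"
      using lagrange_derivative[OF fin inj d(1) dh] by simp
    moreover have "((\<lambda>u. fps_nth (fps_bin (k - 1) u) a * poly p u) has_real_derivative
        fps_nth (fps_const (- (k - 1)) * fps_X * fps_bin (k - 1 - 1) (q x)) a * poly p (q x)
          + poly (pderiv p) (q x) * fps_nth (fps_bin (k - 1) (q x)) a) (at (q x))"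
      using has_fps_pderiv_bin unfolding has_fps_pderiv_def by (intro DERIV_mult poly_DERIV) blast
    hence "(poly (h a) has_real_derivative
        fps_nth (fps_const (- (k - 1)) * fps_X * fps_bin (k - 1 - 1) (q x)) a * poly p (q x)
          + poly (pderiv p) (q x) * fps_nth (fps_bin (k - 1) (q x)) a) (at (q x))"
      unfolding ph[symmetric] .
    from DERIV_unique[OF poly_DERIV this] have "poly (pderiv (h a)) (q x)
      = fps_nth (fps_const (- (k - 1)) * fps_X * fps_bin (k - 1 - 1) (q x)) a * poly p (q x)
          + poly (pderiv p) (q x) * fps_nth (fps_bin (k - 1) (q x)) a" .
    moreover have "k - 1 - 1 = k - 2" "- (k - 1) = 1 - k" by simp_all
    ultimately show "(\<Sum>j\<in>Y. (poly (h a) (q x) - lagrange_basis q Y j (q x) * poly (h a) (q j)) / (q x - q j))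
       = fps_nth (fps_bin (k - 1) (q x)) a * poly (pderiv p) (q x)
        + fps_nth (fps_const (1 - k) * fps_X * fps_bin (k - 2) (q x)) a * poly p (q x)"
      by (simp only: mult_ac add_ac)
  qed
  also have "\<dots> = fps_nth (fps_bin (k - 1) (q x) * Q) l * poly (pderiv p) (q x)
     + fps_nth (fps_const (1 - k) * fps_X * fps_bin (k - 2) (q x) * Q) l * poly p (q x)"
    unfolding fps_mult_nth[of _ Q] sum_distrib_right sum.distrib[symmetric]
    by (intro sum.cong refl) (simp only: distrib_left mult_ac)
  also have "fps_bin (k - 1) (q x) * Q = G q" by (simp only: G1 mult.commute)
  also have "fps_const (1 - k) * fps_X * fps_bin (k - 2) (q x) * Q
      = fps_const (1 - k) * (fps_X * fps_bin (-1) (q x) * G q)"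
  proof -
    have "fps_bin (k - 2) (q x) = fps_bin (k - 1) (q x) * fps_bin (-1) (q x)"
      using fps_bin_add[of "k - 1" "-1" "q x"] by simp
    thus ?thesis by (simp only: G1 mult_ac)
  qed
  finally show ?thesis by (simp add: mult.assoc)
qed

lemma vandermonde_upd: "x \<notin> Y \<Longrightarrow> vandermonde Y (q(x := t)) = vandermonde Y q"
  by (intro vandermonde_cong) auto

text \<open>
  The divided differences in the directions of \<open>Y\<close> turn the Dunkl operator with parameter \<open>g\<close> on
  \<open>x, Y, Z\<close> into \<open>1 + g\<close> times the one with parameter \<open>k\<close> on \<open>x, Z\<close>; comparing the terms in \<open>Z\<close>
  forces \<open>k (1 + g) = g\<close>.
\<close>

locale dunkl_setup =
  fixes k g :: real and x :: nat and Y Z :: "nat set"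
  assumes g: "g > -1" and k: "k = g / (1 + g)"
    and fin: "finite Y" "finite Z"
    and xY: "x \<notin> Y" and xZ: "x \<notin> Z" and YZ: "Y \<inter> Z = {}"
begin

text \<open>The pieces into which the product of forms is split. The intended \<open>f\<close> does
  not depend on the coordinates in \<open>Y\<close>; these enter through the other two factors
  only.\<close>

definition elem :: "nat \<Rightarrow> ((nat \<Rightarrow> real) \<Rightarrow> real) \<Rightarrow> (nat \<Rightarrow> real) \<Rightarrow> real" where
  "elem l f q = vandermonde Y q * (fps_nth (gen_const k x Y Z q) l * f q)"

text \<open>With the other coordinates frozen at \<open>q\<close>, the function is a polynomial in
  the coordinate \<open>x\<close>, and a swap with \<open>Y\<close> just substitutes
  \<open>q j\<close>, as for functions independent of \<open>Y\<close>. This is the shape to which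
  \<open>gen_const_lagrange\<close> applies.\<close>

definition slice :: "((nat \<Rightarrow> real) \<Rightarrow> real) \<Rightarrow> (nat \<Rightarrow> real) \<Rightarrow> real poly \<Rightarrow> bool" where
  "slice f q p \<longleftrightarrow> (\<forall>t. f (q(x := t)) = poly p t) \<and> (\<forall>j\<in>Y. f (swap_coords x j q) = poly p (q j))"

lemma k_relation: "g * (1 - k) = k" "g = (1 + g) * k"
  using g by (simp_all add: k field_simps)

lemma k_mult: "(1 + g) * (c * k) = c * g"
  using k_relation(2) by (simp add: mult.left_commute)

lemma elem_DERIV:
  assumes "slice f q p"
  shows "((\<lambda>t. elem l f (q(x := t))) has_real_derivative
     vandermonde Y q * (fps_nth (gen_const k x Y Z q) l * poly (pderiv p) (q x)
       - k * fps_nth (fps_X * fps_bin (-1) (q x) * gen_const k x Y Z q) l * poly p (q x))) (at (q x))"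
proof -
  have f: "f (q(x := t)) = poly p t" for t using assms by (auto simp: slice_def)
  have "((\<lambda>t. fps_nth (gen_const k x Y Z (q(x := t))) l) has_real_derivative
       fps_nth (fps_const (- k) * fps_X * fps_bin (-1) (q x) * gen_const k x Y Z q) l) (at (q x))"
    using has_fps_pderiv_gen_const[OF xY xZ] by (simp add: has_fps_pderiv_def)
  from DERIV_cmult[OF DERIV_mult[OF this poly_DERIV], of "vandermonde Y q" p]
  show ?thesis
    unfolding elem_def f vandermonde_upd[OF xY]
    by (rule DERIV_cong) (simp add: algebra_simps)
qed

text \<open>Derivative and differences both produce a term with s / (1 - \<open>q x\<close> s) from
  \<open>gen_const\<close>, with weights - k and g (1 - k). These cancel by the choice of
  \<open>k\<close>. The derivative of \<open>p\<close> is left, once from each source, with weights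
  1 and g.\<close>

lemma elem_dunkl_Y:
  assumes "slice f q p" "inj_on q (insert x Y)" "l + degree p \<le> card Y"
  shows "deriv (\<lambda>t. elem l f (q(x := t))) (q x)
      + g * (\<Sum>j\<in>Y. (elem l f q - elem l f (swap_coords x j q)) / (q x - q j))
    = (1 + g) * (vandermonde Y q * fps_nth (gen_const k x Y Z q) l * poly (pderiv p) (q x))"
proof -
  let ?G = "gen_const k x Y Z" and ?V = "vandermonde Y q"
  have fq: "f q = poly p (q x)" using assms(1) by (metis fun_upd_triv slice_def)
  have "(\<Sum>j\<in>Y. (elem l f q - elem l f (swap_coords x j q)) / (q x - q j))
     = (\<Sum>j\<in>Y. ?V * ((fps_nth (?G q) l * poly p (q x)
         - lagrange_basis q Y j (q x) * (fps_nth (?G (swap_coords x j q)) l * poly p (q j))) / (q x - q j)))"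
  proof (intro sum.cong refl)
    fix j assume j: "j \<in> Y"
    have "inj_on q Y" using assms(2) by (auto simp: inj_on_def)
    hence V: "vandermonde Y (swap_coords x j q) = ?V * lagrange_basis q Y j (q x)"
      using vandermonde_swap_outside[OF fin(1) _ xY j] by blast
    have "f (swap_coords x j q) = poly p (q j)" using assms(1) j by (auto simp: slice_def)
    thus "(elem l f q - elem l f (swap_coords x j q)) / (q x - q j)
       = ?V * ((fps_nth (?G q) l * poly p (q x)
         - lagrange_basis q Y j (q x) * (fps_nth (?G (swap_coords x j q)) l * poly p (q j))) / (q x - q j))"
      by (simp only: elem_def V fq) (simp add: algebra_simps)
  qed
  also have "\<dots> = ?V * (fps_nth (?G q) l * poly (pderiv p) (q x)
        + (1 - k) * fps_nth (fps_X * fps_bin (-1) (q x) * ?G q) l * poly p (q x))"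
    unfolding sum_distrib_left[symmetric] gen_const_lagrange[OF fin(1) xY xZ YZ assms(2,3)] ..
  finally have s: "(\<Sum>j\<in>Y. (elem l f q - elem l f (swap_coords x j q)) / (q x - q j)) = \<dots>" .
  have "?V * (a * b - k * c * d) + g * (?V * (a * b + (1 - k) * c * d))
      = (1 + g) * (?V * a * b) + ?V * c * d * (g * (1 - k) - k)" for a b c d
    by (simp add: algebra_simps)
  thus ?thesis unfolding s DERIV_imp_deriv[OF elem_DERIV[OF assms(1)]] k_relation(1) by simp
qed

lemma elem_swap_Z:
  assumes "z \<in> Z"
  shows "elem l f (swap_coords x z q) = vandermonde Y q * (fps_nth (gen_const k x Y Z q) l * f (swap_coords x z q))"
proof -
  have "vandermonde Y (swap_coords x z q) = vandermonde Y q"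
    using assms xY YZ by (intro vandermonde_cong) (auto simp: swap_coords_apply)
  moreover have "z \<notin> Y" using assms YZ by blast
  ultimately show ?thesis
    using gen_const_swap_Z[OF fin(2) assms xY xZ, of k q] by (simp add: elem_def)
qed

lemma slice_deriv: "slice f q p \<Longrightarrow> deriv (\<lambda>t. f (q(x := t))) (q x) = poly (pderiv p) (q x)"
  unfolding slice_def by (auto intro!: DERIV_imp_deriv poly_DERIV)

lemma elem_dunkl:
  assumes "slice f q p" "inj_on q (insert x Y)" "l + degree p \<le> card Y"
  shows "deriv (\<lambda>t. elem l f (q(x := t))) (q x)
      + g * (\<Sum>v\<in>Y \<union> Z. (elem l f q - elem l f (swap_coords x v q)) / (q x - q v))
    = elem l (\<lambda>q. (1 + g) * dunkl_part k x Z f q) q"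
proof -
  let ?C = "vandermonde Y q * fps_nth (gen_const k x Y Z q) l"
  have "(\<Sum>v\<in>Z. (elem l f q - elem l f (swap_coords x v q)) / (q x - q v))
     = ?C * (\<Sum>z\<in>Z. (f q - f (swap_coords x z q)) / (q x - q z))"
    unfolding sum_distrib_left
    by (intro sum.cong refl) (simp add: elem_swap_Z, simp add: elem_def algebra_simps)
  hence "deriv (\<lambda>t. elem l f (q(x := t))) (q x)
      + g * (\<Sum>v\<in>Y \<union> Z. (elem l f q - elem l f (swap_coords x v q)) / (q x - q v))
    = (deriv (\<lambda>t. elem l f (q(x := t))) (q x)
      + g * (\<Sum>j\<in>Y. (elem l f q - elem l f (swap_coords x j q)) / (q x - q j)))
     + g * (?C * (\<Sum>z\<in>Z. (f q - f (swap_coords x z q)) / (q x - q z)))"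
    by (simp add: sum.union_disjoint[OF fin YZ] algebra_simps)
  also have "\<dots> = (1 + g) * (?C * poly (pderiv p) (q x))
      + ((1 + g) * k) * (?C * (\<Sum>z\<in>Z. (f q - f (swap_coords x z q)) / (q x - q z)))"
    unfolding elem_dunkl_Y[OF assms] k_relation(2)[symmetric] ..
  also have "\<dots> = elem l (\<lambda>q. (1 + g) * dunkl_part k x Z f q) q"
    by (simp add: elem_def dunkl_part_def slice_deriv[OF assms(1)] algebra_simps)
  finally show ?thesis .
qed

definition phi :: "nat \<Rightarrow> (nat \<Rightarrow> real) \<Rightarrow> real" where
  "phi i q = fps_nth (gen_lower k x Z q) i"

lemma slice_phi: "\<exists>p. degree p \<le> i \<and> slice (phi i) q p"
proof -
  define R where "R = (\<Prod>z\<in>Z. fps_bin (- k) (q z))"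
  define p where "p = (\<Sum>a=0..i. monom (((- k - 1) gchoose a) * (-1) ^ a * fps_nth R (i - a)) a)"
  have p: "fps_nth (fps_bin (- k - 1) t * R) i = poly p t" for t
  proof -
    have "(- t) ^ a = (-1) ^ a * t ^ a" for a by (rule power_minus)
    thus ?thesis unfolding fps_mult_nth p_def poly_sum poly_monom fps_bin_nth by (simp add: mult_ac)
  qed
  have 1: "phi i (q(x := t)) = poly p t" for t
    unfolding phi_def gen_lower_upd[OF xZ] R_def[symmetric] p ..
  have 2: "phi i (swap_coords x j q) = poly p (q j)" if "j \<in> Y" for j
  proof -
    have "(\<Prod>z\<in>Z. fps_bin (- k) (swap_coords x j q z)) = R"
      unfolding R_def using that YZ xZ by (intro prod.cong) (auto simp: swap_coords_apply)
    moreover have "swap_coords x j q x = q j" by (simp add: swap_coords_apply)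
    ultimately show ?thesis unfolding phi_def gen_lower_def by (simp only: p)
  qed
  have "degree p \<le> i" unfolding p_def
    by (intro degree_sum_le) (auto intro: order_trans[OF degree_monom_le])
  thus ?thesis using 1 2 by (auto simp: slice_def)
qed

lemma slice_times:
  assumes "slice f q p"
  shows "slice (\<lambda>q. q x * f q) q (pCons 0 p)"
  using assms by (auto simp: slice_def swap_coords_apply)

lemma elem_phi_dunkl:
  assumes "inj_on q (insert x (Y \<union> Z))" "l + i \<le> card Y"
  shows "deriv (\<lambda>t. elem l (phi i) (q(x := t))) (q x)
      + g * (\<Sum>v\<in>Y \<union> Z. (elem l (phi i) q - elem l (phi i) (swap_coords x v q)) / (q x - q v))
    = (if i = 0 then 0 else (real i + (real i + real (card Z) + 1) * g) * elem l (phi (i - 1)) q)"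
proof -
  obtain p where p: "degree p \<le> i" "slice (phi i) q p" using slice_phi by blast
  have inj: "inj_on q (insert x Y)" using assms(1) by (rule inj_on_subset) auto
  have ne: "q x \<noteq> q z" if "z \<in> Z" for z using assms(1) that xZ by (auto simp: inj_on_def)
  have "dunkl_part k x Z (phi i) q
     = (if i = 0 then 0 else (real i + (real (card Z) + 1) * k) * phi (i - 1) q)"
    unfolding phi_def using ne by (intro dunkl_part_gen_lower[OF fin(2) xZ])
  moreover have "(1 + g) * (real i + (real (card Z) + 1) * k)
     = real i + (real i + real (card Z) + 1) * g"
    unfolding distrib_left k_mult by (simp add: algebra_simps)
  ultimately show ?thesis
    using elem_dunkl[OF p(2) inj, of l] p(1) assms(2)
    by (auto simp: elem_def mult.assoc[symmetric])
qed

text \<open>The strict inequality makes room for the degree that the factor \<open>q x\<close>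
  adds.\<close>

lemma elem_times_phi_dunkl:
  assumes "inj_on q (insert x (Y \<union> Z))" "l + i < card Y"
  shows "deriv (\<lambda>t. elem l (\<lambda>q. q x * phi i q) (q(x := t))) (q x)
      + g * (\<Sum>v\<in>Y \<union> Z. (elem l (\<lambda>q. q x * phi i q) q
          - elem l (\<lambda>q. q x * phi i q) (swap_coords x v q)) / (q x - q v))
    = (1 + real i + (1 + real i + real (card Z)) * g) * elem l (phi i) q"
proof -
  obtain p where p: "degree p \<le> i" "slice (phi i) q p" using slice_phi by blast
  have inj: "inj_on q (insert x Y)" using assms(1) by (rule inj_on_subset) auto
  have ne: "q x \<noteq> q z" if "z \<in> Z" for z using assms(1) that xZ by (auto simp: inj_on_def)
  have "dunkl_part k x Z (\<lambda>q. q x * phi i q) q = (1 + real i + real (card Z) * k) * phi i q"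
    unfolding phi_def using ne by (intro dunkl_part_times_gen_lower[OF fin(2) xZ])
  moreover have "(1 + g) * (1 + real i + real (card Z) * k) = 1 + real i + (1 + real i + real (card Z)) * g"
    unfolding distrib_left k_mult by (simp add: algebra_simps)
  moreover have "degree (pCons 0 p) \<le> Suc i" using p(1) by (simp add: degree_pCons_eq_if)
  ultimately show ?thesis
    using elem_dunkl[OF slice_times[OF p(2)] inj, of l] assms(2)
    by (auto simp: elem_def mult.assoc[symmetric])
qed

text \<open>This operator arises in type B, with \<open>q\<close> the squared coordinates, from
  functions that carry the product of the unsquared coordinates in \<open>x\<close> and
  \<open>Y\<close>. That product is invariant under swaps with \<open>Y\<close>, which leaves
  \<open>q x\<close> as a common factor there, while a swap with \<open>Z\<close> replaces its
  factor for \<open>x\<close> by the one for \<open>z\<close>. As \<open>q x\<close> stays outside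
  the differences against \<open>Y\<close>, it adds no degree to the interpolation.\<close>

lemma elem_phi_odd:
  assumes "inj_on q (insert x (Y \<union> Z))" "l + i \<le> card Y"
  shows "q x * deriv (\<lambda>t. elem l (phi i) (q(x := t))) (q x)
      + g * (\<Sum>y\<in>Y. q x * (elem l (phi i) q - elem l (phi i) (swap_coords x y q)) / (q x - q y))
      + g * (\<Sum>z\<in>Z. (q x * elem l (phi i) q - q z * elem l (phi i) (swap_coords x z q)) / (q x - q z))
    = (real i + (real i + real (card Z)) * g) * elem l (phi i) q"
proof -
  obtain p where p: "degree p \<le> i" "slice (phi i) q p" using slice_phi by blast
  have inj: "inj_on q (insert x Y)" using assms(1) by (rule inj_on_subset) auto
  have ne: "q x \<noteq> q z" if "z \<in> Z" for z using assms(1) that xZ by (auto simp: inj_on_def)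
  let ?C = "vandermonde Y q * fps_nth (gen_const k x Y Z q) l"
  let ?S = "\<Sum>z\<in>Z. (q x * phi i q - q z * phi i (swap_coords x z q)) / (q x - q z)"
  have sw: "swap_coords x z q x = q z" for z by (simp add: swap_coords_apply)
  have part: "dunkl_part k x Z (\<lambda>q. q x * phi i q) q = (1 + real i + real (card Z) * k) * phi i q"
    unfolding phi_def using ne by (intro dunkl_part_times_gen_lower[OF fin(2) xZ])
  have "deriv (\<lambda>t. (q(x := t)) x * phi i (q(x := t))) (q x) = poly (pderiv (pCons 0 p)) (q x)"
    by (rule slice_deriv[OF slice_times[OF p(2)]])
  also have "\<dots> = phi i q + q x * poly (pderiv p) (q x)"
    using p(2) by (simp add: pderiv_pCons slice_def) (metis fun_upd_triv)
  finally have part': "q x * poly (pderiv p) (q x) + k * ?S = (real i + real (card Z) * k) * phi i q"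
    using part unfolding dunkl_part_def sw by (simp add: algebra_simps)
  have Zs: "(\<Sum>z\<in>Z. (q x * elem l (phi i) q - q z * elem l (phi i) (swap_coords x z q)) / (q x - q z)) = ?C * ?S"
    unfolding sum_distrib_left
    by (intro sum.cong refl) (simp add: elem_swap_Z, simp add: elem_def algebra_simps)
  have Ys: "(\<Sum>y\<in>Y. q x * (elem l (phi i) q - elem l (phi i) (swap_coords x y q)) / (q x - q y))
     = q x * (\<Sum>y\<in>Y. (elem l (phi i) q - elem l (phi i) (swap_coords x y q)) / (q x - q y))"
    by (simp add: sum_distrib_left)
  have deg: "l + degree p \<le> card Y" using p assms(2) by linarith
  have "q x * deriv (\<lambda>t. elem l (phi i) (q(x := t))) (q x)
      + g * (\<Sum>y\<in>Y. q x * (elem l (phi i) q - elem l (phi i) (swap_coords x y q)) / (q x - q y))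
      + g * (\<Sum>z\<in>Z. (q x * elem l (phi i) q - q z * elem l (phi i) (swap_coords x z q)) / (q x - q z))
     = q x * (deriv (\<lambda>t. elem l (phi i) (q(x := t))) (q x)
        + g * (\<Sum>y\<in>Y. (elem l (phi i) q - elem l (phi i) (swap_coords x y q)) / (q x - q y))) + g * (?C * ?S)"
    unfolding Zs Ys by (simp add: algebra_simps)
  also have "\<dots> = q x * ((1 + g) * (?C * poly (pderiv p) (q x))) + ((1 + g) * k) * (?C * ?S)"
    unfolding elem_dunkl_Y[OF p(2) inj deg] k_relation(2)[symmetric] ..
  also have "\<dots> = (1 + g) * ?C * (q x * poly (pderiv p) (q x) + k * ?S)"
    by (simp add: algebra_simps)
  also have "\<dots> = ((1 + g) * (real i + real (card Z) * k)) * elem l (phi i) q"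
    unfolding part' by (simp add: elem_def)
  also have "(1 + g) * (real i + real (card Z) * k) = real i + (real i + real (card Z)) * g"
    unfolding distrib_left k_mult by (simp add: algebra_simps)
  finally show ?thesis .
qed

lemma vandermonde_decomposition:
  assumes "\<And>y. y \<in> Y \<Longrightarrow> x < y"
  shows "vandermonde (insert x Y) q = (\<Sum>i=0..card Y. elem (card Y - i) (phi i) q)"
proof -
  have "vandermonde (insert x Y) q = (\<Prod>y\<in>Y. q x - q y) * vandermonde Y q"
    using assms by (intro vandermonde_insert_less[OF fin(1)])
  thus ?thesis unfolding prod_diff_decomposition[OF fin(1) xY, of q k Z]
    by (simp add: elem_def phi_def sum_distrib_left sum_distrib_right mult_ac)
qed

lemma elem_0_phi_0: "elem 0 (phi 0) q = vandermonde Y q"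
proof -
  have c: "fps_nth (\<Prod>a\<in>A. fps_bin c (q a)) 0 = 1" for A c
    by (induction A rule: infinite_finite_induct) auto
  show ?thesis by (simp add: elem_def phi_def gen_lower_def gen_const_def c)
qed

end

section \<open>Dunkl operators on polynomials\<close>

text \<open>Polynomials of degree less than \<open>d\<close>, so that only 0 qualifies for \<open>d = 0\<close>.\<close>

inductive poly_less :: "nat \<Rightarrow> nat \<Rightarrow> ((nat \<Rightarrow> real) \<Rightarrow> real) \<Rightarrow> bool" for n where
  zero: "poly_less n d (\<lambda>p. 0)"
| const: "poly_less n (Suc d) (\<lambda>p. c)"
| coord: "i \<in> {1..n} \<Longrightarrow> poly_less n d f \<Longrightarrow> poly_less n (Suc d) (\<lambda>p. p i * f p)"
| add: "poly_less n d f \<Longrightarrow> poly_less n d g \<Longrightarrow> poly_less n d (\<lambda>p. f p + g p)"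

lemma poly_less_Suc: "poly_less n d f \<Longrightarrow> poly_less n (Suc d) f"
  by (induction rule: poly_less.induct) (auto intro: poly_less.intros)

lemma poly_less_mono: "poly_less n d f \<Longrightarrow> d \<le> e \<Longrightarrow> poly_less n e f"
  by (induction e arbitrary: d) (auto simp: le_Suc_eq intro: poly_less_Suc)

lemma poly_less_0: "poly_less n d f \<Longrightarrow> d = 0 \<Longrightarrow> f p = 0"
  by (induction rule: poly_less.induct) auto

lemma poly_less_cmult: "poly_less n d f \<Longrightarrow> poly_less n d (\<lambda>p. c * f p)"
proof (induction rule: poly_less.induct)
  case (coord i d f)
  from poly_less.coord[OF this(1,3)] show ?case by (simp add: mult_ac)
qed (auto simp: distrib_left intro: poly_less.intros)

lemma poly_less_uminus: "poly_less n d f \<Longrightarrow> poly_less n d (\<lambda>p. - f p)"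
  using poly_less_cmult[of n d f "-1"] by simp

lemma poly_less_diff: "poly_less n d f \<Longrightarrow> poly_less n d g \<Longrightarrow> poly_less n d (\<lambda>p. f p - g p)"
  using poly_less.add[OF _ poly_less_uminus, of n d f g] by simp

lemma poly_less_sum:
  "(\<And>i. i \<in> I \<Longrightarrow> poly_less n d (f i)) \<Longrightarrow> poly_less n d (\<lambda>p. \<Sum>i\<in>I. f i p)"
  by (induction I rule: infinite_finite_induct) (auto intro: poly_less.intros)

text \<open>The bounds are strict, so one of them carries a \<open>Suc\<close> to keep the sum
  sharp; \<open>a = 0\<close>, the zero polynomial, is covered.\<close>

lemma poly_less_mult:
  "poly_less n a f \<Longrightarrow> poly_less n (Suc b) g \<Longrightarrow> poly_less n (a + b) (\<lambda>p. f p * g p)"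
proof (induction rule: poly_less.induct)
  case (const d c)
  thus ?case using poly_less_mono[OF poly_less_cmult[of n "Suc b" g c], of "Suc d + b"] by simp
next
  case (coord i d f)
  from poly_less.coord[OF coord(1) coord.IH[OF coord.prems]] show ?case by (simp add: mult.assoc)
qed (auto simp: distrib_right intro: poly_less.intros)

lemma poly_less_coord: "i \<in> {1..n} \<Longrightarrow> poly_less n (Suc (Suc d)) (\<lambda>p. p i)"
  using poly_less.coord[OF _ poly_less.const[of n d 1], of i] by simp

lemma poly_less_power:
  "poly_less n (Suc d) f \<Longrightarrow> poly_less n (Suc (k * d)) (\<lambda>p. f p ^ k)"
proof (induction k)
  case (Suc k)
  from poly_less_mult[OF Suc.prems Suc.IH[OF Suc.prems]] show ?case by simp
qed (auto intro: poly_less.intros)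

lemma poly_less_prod:
  assumes "finite I" "\<And>i. i \<in> I \<Longrightarrow> poly_less n (Suc d) (f i)"
  shows "poly_less n (Suc (card I * d)) (\<lambda>p. \<Prod>i\<in>I. f i p)"
  using assms
proof (induction I rule: finite_induct)
  case (insert i I)
  from poly_less_mult[OF insert.prems[of i] insert.IH] insert show ?case by auto
qed (auto intro: poly_less.intros)

lemma poly_less_vandermonde:
  assumes "finite B" "\<And>i. i \<in> B \<Longrightarrow> poly_less n (Suc d) (\<lambda>p. f p i)"
  shows "poly_less n (Suc (d * \<Sum>{..<card B})) (\<lambda>p. vandermonde B (f p))"
  using assms
proof (induction "card B" arbitrary: B)
  case 0
  thus ?case by (auto simp: vandermonde_def intro: poly_less.intros)
next
  case (Suc c)
  from Suc.hyps(2) obtain a where a: "a \<in> B" by fastforce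
  have c: "card (B - {a}) = c" using a Suc by simp
  have "poly_less n (Suc (d * \<Sum>{..<c})) (\<lambda>p. vandermonde (B - {a}) (f p))"
    using Suc.hyps(1)[of "B - {a}"] Suc.prems c by simp
  moreover have "poly_less n (Suc (card (B - {a}) * d)) (\<lambda>p. \<Prod>i\<in>B - {a}. f p a - f p i)"
    using Suc.prems a by (intro poly_less_prod poly_less_diff) auto
  ultimately have "poly_less n (Suc (c * d) + d * \<Sum>{..<c})
      (\<lambda>p. (-1) ^ card {i\<in>B. i < a} * (\<Prod>i\<in>B - {a}. f p a - f p i) * vandermonde (B - {a}) (f p))"
    unfolding mult.assoc c by (intro poly_less_cmult[of n _ "\<lambda>p. (\<Prod>i\<in>B - {a}. f p a - f p i) * vandermonde (B - {a}) (f p)"] poly_less_mult)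
  thus ?case
    unfolding vandermonde_remove[OF Suc.prems(1) a] Suc.hyps(2)[symmetric] by (simp add: algebra_simps)
qed

text \<open>For \<open>a = b\<close> the map multiplies the coordinate \<open>a\<close> by \<open>s\<close>.\<close>

definition reflect :: "real \<Rightarrow> nat \<Rightarrow> nat \<Rightarrow> (nat \<Rightarrow> real) \<Rightarrow> nat \<Rightarrow> real" where
  "reflect s a b p = p(a := s * p b, b := s * p a)"

lemma reflect_apply: "reflect s a b p i = (if i = b then s * p a else if i = a then s * p b else p i)"
  by (simp add: reflect_def)

lemma reflect_1: "reflect 1 a b = swap_coords a b"
  by (simp add: fun_eq_iff reflect_def swap_coords_def)

lemma reflect_reflect: "s * s = 1 \<Longrightarrow> reflect s a b (reflect s a b p) = p"
  by (auto simp: fun_eq_iff reflect_apply mult.assoc[symmetric])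

lemma poly_less_reflect: "poly_less n d f \<Longrightarrow> a \<in> {1..n} \<Longrightarrow> b \<in> {1..n} \<Longrightarrow> poly_less n d (\<lambda>p. f (reflect s a b p))"
proof (induction rule: poly_less.induct)
  case (coord i d f)
  have "poly_less n (Suc d) (\<lambda>p. s * (p b * f (reflect s a b p)))"
    "poly_less n (Suc d) (\<lambda>p. s * (p a * f (reflect s a b p)))"
    "poly_less n (Suc d) (\<lambda>p. (p i * f (reflect s a b p)))"
    using coord by (intro poly_less_cmult poly_less.coord; simp)+
  hence "poly_less n (Suc d) (\<lambda>p. reflect s a b p i * f (reflect s a b p))"
    by (cases "i = b"; cases "i = a") (simp_all add: reflect_apply mult.assoc)
  thus ?case .
qed (auto intro: poly_less.intros)

lemma poly_less_deriv:
  assumes "poly_less n d f"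
  shows "\<exists>f'. poly_less n (d - 1) f' \<and>
     (\<forall>p. ((\<lambda>t. f (p(x := t))) has_real_derivative f' p) (at (p x)))"
  using assms
proof (induction rule: poly_less.induct)
  case (coord i d f)
  then obtain f' where f': "poly_less n (d - 1) f'"
    "\<And>p. ((\<lambda>t. f (p(x := t))) has_real_derivative f' p) (at (p x))" by blast
  have c: "poly_less n d (\<lambda>p. p i * f' p)"
  proof (cases d)
    case 0
    hence "f' p = 0" for p using f' poly_less_0 by auto
    thus ?thesis using poly_less.zero by simp
  next
    case (Suc e)
    thus ?thesis using poly_less.coord[OF coord(1), of e f'] f' by simp
  qed
  show ?case
  proof (cases "i = x")
    case True
    have "((\<lambda>t. (p(x := t)) i * f (p(x := t))) has_real_derivative f p + p i * f' p) (at (p x))" for p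
      using DERIV_mult[OF DERIV_ident f'(2)[of p]] True by (simp add: mult.commute)
    thus ?thesis using poly_less.add[OF coord(2) c] by (simp only: diff_Suc_1) blast
  next
    case False
    have "((\<lambda>t. (p(x := t)) i * f (p(x := t))) has_real_derivative p i * f' p) (at (p x))" for p
      using DERIV_cmult[OF f'(2)[of p], of "p i"] False by simp
    thus ?thesis using c by (simp only: diff_Suc_1) blast
  qed
next
  case (add d f g)
  then obtain f' g' where f': "poly_less n (d - 1) f'"
    "\<And>p. ((\<lambda>t. f (p(x := t))) has_real_derivative f' p) (at (p x))"
    and g': "poly_less n (d - 1) g'"
    "\<And>p. ((\<lambda>t. g (p(x := t))) has_real_derivative g' p) (at (p x))" by blast
  have "((\<lambda>t. f (p(x := t)) + g (p(x := t))) has_real_derivative f' p + g' p) (at (p x))" for p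
    by (rule DERIV_add[OF f'(2) g'(2)])
  thus ?case using poly_less.add[OF f'(1) g'(1)] by blast
qed (auto intro!: exI[of _ "\<lambda>p. 0"] poly_less.intros)

text \<open>The difference vanishes on the mirror and is divisible by its linear form; the quotient
  is built along the construction of \<open>f\<close>, since a product obeys a twisted Leibniz rule.
  For \<open>v = x\<close> and \<open>s = -1\<close> the reflection is a sign change and the form is
  \<open>2 * p x\<close>.\<close>

lemma poly_less_divided_difference:
  assumes "poly_less n d f" and x: "x \<in> {1..n}" "v \<in> {1..n}" and s: "s = 1 \<or> s = -1"
  shows "\<exists>h. poly_less n (d - 1) h \<and>
     (\<forall>p. f p - f (reflect s x v p) = (p x - s * p v) * h p)"
  using assms(1)
proof (induction rule: poly_less.induct)
  case (coord i d f)
  then obtain h where h: "poly_less n (d - 1) h"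
    "\<And>p. f p - f (reflect s x v p) = (p x - s * p v) * h p" by blast
  have c: "poly_less n d (\<lambda>p. p i * h p)" if "i \<in> {1..n}" for i
  proof (cases d)
    case 0
    hence "h p = 0" for p using h poly_less_0 by auto
    thus ?thesis using poly_less.zero by simp
  next
    case (Suc e)
    thus ?thesis using poly_less.coord[OF that, of e h] h by simp
  qed
  have r: "poly_less n d (\<lambda>p. f (reflect s x v p))"
    by (rule poly_less_reflect[OF coord(2) x])
  have eq: "f p = f (reflect s x v p) + (p x - s * p v) * h p" for p using h(2)[of p] by simp
  consider "i = v" | "i = x" "i \<noteq> v" | "i \<noteq> x" "i \<noteq> v" by blast
  thus ?case
  proof cases
    case 1
    have "p i * f p - reflect s x v p i * f (reflect s x v p)
       = (p x - s * p v) * (p v * h p + (- s) * f (reflect s x v p))" for p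
      unfolding eq[of p] using s 1 by (auto simp: reflect_apply algebra_simps)
    moreover have "poly_less n d (\<lambda>p. p v * h p + (- s) * f (reflect s x v p))"
      by (intro poly_less.add c x poly_less_cmult r)
    ultimately show ?thesis by auto
  next
    case 2
    have "p i * f p - reflect s x v p i * f (reflect s x v p)
       = (p x - s * p v) * (p x * h p + f (reflect s x v p))" for p
      unfolding eq[of p] using 2 by (auto simp: reflect_apply algebra_simps)
    moreover have "poly_less n d (\<lambda>p. p x * h p + f (reflect s x v p))"
      by (intro poly_less.add c x r)
    ultimately show ?thesis by auto
  next
    case 3
    have "p i * f p - reflect s x v p i * f (reflect s x v p) = (p x - s * p v) * (p i * h p)" for p
      unfolding eq[of p] using 3 by (auto simp: reflect_apply algebra_simps)
    thus ?thesis using c[OF coord(1)] by auto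
  qed
next
  case (add d f g)
  then obtain h k where h: "poly_less n (d - 1) h"
    "\<And>p. f p - f (reflect s x v p) = (p x - s * p v) * h p"
    and k: "poly_less n (d - 1) k"
    "\<And>p. g p - g (reflect s x v p) = (p x - s * p v) * k p" by blast
  have "f p + g p - (f (reflect s x v p) + g (reflect s x v p)) = (p x - s * p v) * (h p + k p)" for p
    using h(2)[of p] k(2)[of p] by (simp add: algebra_simps)
  thus ?case using poly_less.add[OF h(1) k(1)] by auto
qed (auto intro!: exI[of _ "\<lambda>p. 0"] poly_less.intros)

text \<open>The complement of the mirrors of type B, which include those of types A and D: one set
  for all three types, stable under the reflections and of full measure. Elsewhere the difference
  quotients may have denominator 0 and hence an arbitrary default value.\<close>

definition generic_points :: "nat \<Rightarrow> (nat \<Rightarrow> real) set" where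
  "generic_points n = {p. inj_on (\<lambda>i. (p i)\<^sup>2) {1..n} \<and> (\<forall>i\<in>{1..n}. p i \<noteq> 0)}"

text \<open>The pair \<open>(s, v)\<close> stands for the reflection \<open>reflect s x v\<close>
  with form \<open>p x - s * p v\<close>. Only mirrors whose form contains the coordinate
  \<open>x\<close> are listed, as the others do not contribute in the direction \<open>x\<close>;
  \<open>(-1, x)\<close> is the sign change.\<close>

definition mirrors :: "refl_type \<Rightarrow> nat \<Rightarrow> nat \<Rightarrow> (real \<times> nat) set" where
  "mirrors T n x = (case T of TypeA \<Rightarrow> {1} \<times> ({1..n} - {x})
     | TypeB \<Rightarrow> insert (-1, x) ({1, -1} \<times> ({1..n} - {x}))
     | TypeD \<Rightarrow> {1, -1} \<times> ({1..n} - {x}))"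

lemma finite_mirrors [simp]: "finite (mirrors T n x)"
  by (cases T) (auto simp: mirrors_def)

lemma mirrorsD:
  assumes "(s, v) \<in> mirrors T n x" "x \<in> {1..n}"
  shows "s = 1 \<or> s = -1" "v \<in> {1..n}" "v = x \<Longrightarrow> s = -1 \<and> T = TypeB" "T = TypeA \<Longrightarrow> s = 1"
  using assms by (cases T; auto simp: mirrors_def)+

lemma generic_mirror_nonzero:
  assumes "p \<in> generic_points n" "x \<in> {1..n}" "(s, v) \<in> mirrors T n x"
  shows "p x - s * p v \<noteq> 0"
proof
  assume *: "p x - s * p v = 0"
  note m = mirrorsD[OF assms(3,2)]
  show False
  proof (cases "v = x")
    case True
    thus False using * m(3) assms by (auto simp: generic_points_def)
  next
    case False
    have "(p x)\<^sup>2 = (p v)\<^sup>2" using * m(1) by (auto simp: power2_eq_square algebra_simps)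
    moreover have "inj_on (\<lambda>i. (p i)\<^sup>2) {1..n}" using assms(1) by (simp add: generic_points_def)
    ultimately have "x = v" using inj_onD[of "\<lambda>i. (p i)\<^sup>2" "{1..n}" x v] assms(2) m(2) by blast
    thus False using False by simp
  qed
qed

text \<open>The factor 2 for \<open>v = x\<close>, where \<open>s = -1\<close>, compensates \<open>p x - s * p v = 2 * p x\<close>.\<close>

definition dunkl :: "refl_type \<Rightarrow> real \<Rightarrow> nat \<Rightarrow> nat \<Rightarrow> ((nat \<Rightarrow> real) \<Rightarrow> real) \<Rightarrow> (nat \<Rightarrow> real) \<Rightarrow> real" where
  "dunkl T g n x f p = deriv (\<lambda>t. f (p(x := t))) (p x)
     + g * (\<Sum>(s, v)\<in>mirrors T n x. (if v = x then 2 else 1) * (f p - f (reflect s x v p)) / (p x - s * p v))"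

text \<open>The derivative and each divided difference are polynomials of one degree less. The
  operator agrees with their sum where the denominators do not vanish, which is why equality is
  stated at generic points.\<close>

lemma dunkl_poly_less:
  assumes f: "poly_less n d f" and x: "x \<in> {1..n}"
  shows "\<exists>f'. poly_less n (d - 1) f' \<and> (\<forall>p\<in>generic_points n. dunkl T g n x f p = f' p)"
proof -
  obtain f' where f': "poly_less n (d - 1) f'"
    "\<And>p. ((\<lambda>t. f (p(x := t))) has_real_derivative f' p) (at (p x))"
    using poly_less_deriv[OF f] by blast
  have "\<forall>m\<in>mirrors T n x. \<exists>h. poly_less n (d - 1) h \<and>
     (\<forall>p. f p - f (reflect (fst m) x (snd m) p) = (p x - fst m * p (snd m)) * h p)"
  proof
    fix m assume m: "m \<in> mirrors T n x"
    then obtain s v where m': "m = (s, v)" by (cases m)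
    show "\<exists>h. poly_less n (d - 1) h \<and>
     (\<forall>p. f p - f (reflect (fst m) x (snd m) p) = (p x - fst m * p (snd m)) * h p)"
      using poly_less_divided_difference[OF f x, of v s] mirrorsD[of s v T n x] m m' x by auto
  qed
  then obtain h where h: "\<And>m. m \<in> mirrors T n x \<Longrightarrow> poly_less n (d - 1) (h m)"
    "\<And>m p. m \<in> mirrors T n x \<Longrightarrow> f p - f (reflect (fst m) x (snd m) p) = (p x - fst m * p (snd m)) * h m p"
    by metis
  define F where "F p = f' p + g * (\<Sum>m\<in>mirrors T n x. (if snd m = x then 2 else 1) * h m p)" for p
  have "poly_less n (d - 1) F" unfolding F_def
    by (intro poly_less.add f' poly_less_cmult poly_less_sum h)
  moreover have "dunkl T g n x f p = F p" if p: "p \<in> generic_points n" for p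
  proof -
    have "(\<Sum>(s, v)\<in>mirrors T n x. (if v = x then 2 else 1) * (f p - f (reflect s x v p)) / (p x - s * p v))
       = (\<Sum>m\<in>mirrors T n x. (if snd m = x then 2 else 1) * h m p)"
    proof (intro sum.cong refl)
      fix m assume m: "m \<in> mirrors T n x"
      have "p x - fst m * p (snd m) \<noteq> 0"
        using generic_mirror_nonzero[OF p x, of "fst m" "snd m" T] m by simp
      thus "(case m of (s, v) \<Rightarrow> (if v = x then 2 else 1) * (f p - f (reflect s x v p)) / (p x - s * p v))
          = (if snd m = x then 2 else 1) * h m p"
        using h(2)[OF m, of p] by (simp add: case_prod_beta)
    qed
    thus ?thesis unfolding dunkl_def F_def DERIV_imp_deriv[OF f'(2)] by simp
  qed
  ultimately show ?thesis by blast
qed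

lemma generic_upd_eventually:
  assumes p: "p \<in> generic_points n" and x: "x \<in> {1..n}"
  shows "\<forall>\<^sub>F t in nhds (p x). p(x := t) \<in> generic_points n"
proof -
  have "\<forall>\<^sub>F t in nhds (p x). \<forall>v\<in>{1..n} - {x}. t\<^sup>2 \<noteq> (p v)\<^sup>2"
  proof (intro eventually_ball_finite ballI)
    fix v assume v: "v \<in> {1..n} - {x}"
    have "((\<lambda>t. t\<^sup>2 - (p v)\<^sup>2) \<longlongrightarrow> (p x)\<^sup>2 - (p v)\<^sup>2) (nhds (p x))"
      by (intro tendsto_intros) (simp add: filterlim_ident)
    moreover have inj: "inj_on (\<lambda>i. (p i)\<^sup>2) {1..n}" using p by (simp add: generic_points_def)
    have "(p x)\<^sup>2 \<noteq> (p v)\<^sup>2" using inj_onD[OF inj, of x v] x v by auto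
    hence "(p x)\<^sup>2 - (p v)\<^sup>2 \<noteq> 0" by simp
    ultimately have "\<forall>\<^sub>F t in nhds (p x). t\<^sup>2 - (p v)\<^sup>2 \<noteq> 0" by (rule tendsto_imp_eventually_ne)
    thus "\<forall>\<^sub>F t in nhds (p x). t\<^sup>2 \<noteq> (p v)\<^sup>2" by eventually_elim auto
  qed auto
  moreover have "\<forall>\<^sub>F t in nhds (p x). t \<noteq> 0"
    using p x by (intro t1_space_nhds) (auto simp: generic_points_def)
  ultimately show ?thesis
  proof eventually_elim
    case (elim t)
    show ?case unfolding generic_points_def
    proof (intro CollectI conjI ballI inj_onI)
      fix i j assume "i \<in> {1..n}" "j \<in> {1..n}" "((p(x := t)) i)\<^sup>2 = ((p(x := t)) j)\<^sup>2"
      moreover have "inj_on (\<lambda>i. (p i)\<^sup>2) {1..n}" using p by (simp add: generic_points_def)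
      ultimately show "i = j" using elim(1) inj_onD[of "\<lambda>i. (p i)\<^sup>2" "{1..n}" i j]
        by (cases "i = x"; cases "j = x") (auto dest: bspec)
    next
      fix i assume "i \<in> {1..n}"
      thus "(p(x := t)) i \<noteq> 0" using elim(2) p by (simp add: generic_points_def)
    qed
  qed
qed

lemma generic_reflect:
  assumes p: "p \<in> generic_points n" and "a \<in> {1..n}" "b \<in> {1..n}" and s: "s = 1 \<or> s = -1"
  shows "reflect s a b p \<in> generic_points n"
proof -
  have sq: "(reflect s a b p i)\<^sup>2 = (p (if i = b then a else if i = a then b else i))\<^sup>2" for i
    using s by (auto simp: reflect_apply power_mult_distrib)
  show ?thesis unfolding generic_points_def
  proof (intro CollectI conjI ballI inj_onI)
    fix i j assume i: "i \<in> {1..n}" "j \<in> {1..n}" "(reflect s a b p i)\<^sup>2 = (reflect s a b p j)\<^sup>2"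
    have inj: "inj_on (\<lambda>i. (p i)\<^sup>2) {1..n}" using p by (simp add: generic_points_def)
    have "(if i = b then a else if i = a then b else i) = (if j = b then a else if j = a then b else j)"
      by (rule inj_onD[OF inj]) (use assms(2,3) i sq in auto)
    thus "i = j" by (auto split: if_splits)
  next
    fix i assume "i \<in> {1..n}"
    thus "reflect s a b p i \<noteq> 0" using p assms by (auto simp: generic_points_def reflect_apply)
  qed
qed

text \<open>The derivative needs agreement near \<open>p x\<close>, available because genericity is
  an open condition on that coordinate; the differences need agreement at reflected points, which
  are generic again.\<close>

lemma dunkl_cong:
  assumes "\<And>p. p \<in> generic_points n \<Longrightarrow> f p = f' p" and p: "p \<in> generic_points n" and x: "x \<in> {1..n}"
  shows "dunkl T g n x f p = dunkl T g n x f' p"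
proof -
  have "deriv (\<lambda>t. f (p(x := t))) (p x) = deriv (\<lambda>t. f' (p(x := t))) (p x)"
    by (rule deriv_cong_ev[OF _ refl]) (use generic_upd_eventually[OF p x] in \<open>eventually_elim, simp add: assms(1)\<close>)
  moreover have "f (reflect s x v p) = f' (reflect s x v p)" if "(s, v) \<in> mirrors T n x" for s v
    using generic_reflect[OF p x] mirrorsD[OF that x] assms(1) by blast
  ultimately show ?thesis unfolding dunkl_def using assms(1)[OF p]
    by (intro arg_cong2[where f = "(+)"] arg_cong2[where f = "(*)"] sum.cong) auto
qed

text \<open>A relation instead of an equation between functions: the image is prescribed at generic
  points only, and differentiability travels along because \<open>deriv\<close> is linear only on
  differentiable functions. Iterates are relational powers.\<close>

definition dunkl_maps where
  "dunkl_maps T g n x f f' \<longleftrightarrow> (\<forall>p\<in>generic_points n.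
     (\<lambda>t. f (p(x := t))) field_differentiable (at (p x)) \<and> dunkl T g n x f p = f' p)"

lemma dunkl_maps_0: "dunkl_maps T g n x (\<lambda>p. 0) (\<lambda>p. 0)"
  by (simp add: dunkl_maps_def dunkl_def)

lemma dunkl_maps_cmult:
  assumes "dunkl_maps T g n x f f'"
  shows "dunkl_maps T g n x (\<lambda>p. c * f p) (\<lambda>p. c * f' p)"
  unfolding dunkl_maps_def
proof (intro ballI conjI)
  fix p assume p: "p \<in> generic_points n"
  have d: "(\<lambda>t. f (p(x := t))) field_differentiable (at (p x))" and e: "dunkl T g n x f p = f' p"
    using assms p by (auto simp: dunkl_maps_def)
  show "(\<lambda>t. c * f (p(x := t))) field_differentiable (at (p x))"
    by (intro derivative_intros d)
  have "deriv (\<lambda>t. c * f (p(x := t))) (p x) = c * deriv (\<lambda>t. f (p(x := t))) (p x)"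
    using d by (rule deriv_cmult)
  thus "dunkl T g n x (\<lambda>p. c * f p) p = c * f' p"
    unfolding e[symmetric] dunkl_def
    by (simp add: distrib_left sum_distrib_left case_prod_beta right_diff_distrib mult_ac)
qed

lemma dunkl_maps_add:
  assumes "dunkl_maps T g n x f f'" "dunkl_maps T g n x h h'"
  shows "dunkl_maps T g n x (\<lambda>p. f p + h p) (\<lambda>p. f' p + h' p)"
  unfolding dunkl_maps_def
proof (intro ballI conjI)
  fix p assume p: "p \<in> generic_points n"
  have d: "(\<lambda>t. f (p(x := t))) field_differentiable (at (p x))" and e: "dunkl T g n x f p = f' p"
    using assms p by (auto simp: dunkl_maps_def)
  have d': "(\<lambda>t. h (p(x := t))) field_differentiable (at (p x))" and e': "dunkl T g n x h p = h' p"
    using assms p by (auto simp: dunkl_maps_def)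
  show "(\<lambda>t. f (p(x := t)) + h (p(x := t))) field_differentiable (at (p x))"
    by (intro derivative_intros d d')
  have dd: "deriv (\<lambda>t. f (p(x := t)) + h (p(x := t))) (p x)
     = deriv (\<lambda>t. f (p(x := t))) (p x) + deriv (\<lambda>t. h (p(x := t))) (p x)"
    using d d' by (rule deriv_add)
  have s: "(\<Sum>(s, v)\<in>mirrors T n x. (if v = x then 2 else 1) * (f p + h p - (f (reflect s x v p) + h (reflect s x v p))) / (p x - s * p v))
     = (\<Sum>(s, v)\<in>mirrors T n x. (if v = x then 2 else 1) * (f p - f (reflect s x v p)) / (p x - s * p v))
      + (\<Sum>(s, v)\<in>mirrors T n x. (if v = x then 2 else 1) * (h p - h (reflect s x v p)) / (p x - s * p v))"
    unfolding sum.distrib[symmetric]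
    by (intro sum.cong refl) (auto simp: case_prod_beta diff_divide_distrib add_divide_distrib distrib_left right_diff_distrib)
  show "dunkl T g n x (\<lambda>p. f p + h p) p = f' p + h' p"
    unfolding e[symmetric] e'[symmetric] dunkl_def dd s by (simp add: distrib_left)
qed

lemma dunkl_maps_power_cmult:
  "(dunkl_maps T g n x ^^ k) f f' \<Longrightarrow> (dunkl_maps T g n x ^^ k) (\<lambda>p. c * f p) (\<lambda>p. c * f' p)"
proof (induction k arbitrary: f')
  case (Suc k)
  then obtain h where h: "(dunkl_maps T g n x ^^ k) f h" "dunkl_maps T g n x h f'" by auto
  show ?case by (rule relpowp_Suc_I[where P = "dunkl_maps T g n x", OF Suc.IH[OF h(1)] dunkl_maps_cmult[OF h(2)]])
qed auto

lemma dunkl_maps_power_0: "(dunkl_maps T g n x ^^ k) (\<lambda>p. 0) (\<lambda>p. 0)"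
  by (induction k) (auto intro: dunkl_maps_0)

lemma dunkl_maps_power_add:
  "(dunkl_maps T g n x ^^ k) f f' \<Longrightarrow> (dunkl_maps T g n x ^^ k) h h'
    \<Longrightarrow> (dunkl_maps T g n x ^^ k) (\<lambda>p. f p + h p) (\<lambda>p. f' p + h' p)"
proof (induction k arbitrary: f' h')
  case (Suc k)
  from Suc.prems obtain a b where ab: "(dunkl_maps T g n x ^^ k) f a" "dunkl_maps T g n x a f'"
   "(dunkl_maps T g n x ^^ k) h b" "dunkl_maps T g n x b h'" by auto
  show ?case by (rule relpowp_Suc_I[where P = "dunkl_maps T g n x", OF Suc.IH[OF ab(1,3)] dunkl_maps_add[OF ab(2,4)]])
qed auto

lemma dunkl_maps_power_sum:
  assumes "finite I" "\<And>i. i \<in> I \<Longrightarrow> (dunkl_maps T g n x ^^ k) (f i) (f' i)"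
  shows "(dunkl_maps T g n x ^^ k) (\<lambda>p. \<Sum>i\<in>I. f i p) (\<lambda>p. \<Sum>i\<in>I. f' i p)"
  using assms by (induction I rule: finite_induct) (auto intro: dunkl_maps_power_0 dunkl_maps_power_add)

lemma relpowp_trans: "(R ^^ a) x y \<Longrightarrow> (R ^^ b) y z \<Longrightarrow> (R ^^ (a + b)) x z"
  for R :: "'a \<Rightarrow> 'a \<Rightarrow> bool"
  by (auto simp: relpowp_add)

text \<open>The functions \<open>F 0\<close> to \<open>F i\<close> form a chain of which
  \<open>s\<close> applications go down one link, with \<open>s = 1\<close> in type A and
  \<open>s = 2\<close> in types B and D. After \<open>s * r\<close> applications a shorter chain has
  run into 0; a chain of length exactly \<open>r\<close> has just reached
  \<open>F 0\<close>.\<close>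

lemma dunkl_maps_chain:
  assumes step: "\<And>j. j < i \<Longrightarrow> (dunkl_maps T g n x ^^ s) (F (Suc j)) (\<lambda>p. a (Suc j) * F j p)"
    and last: "(dunkl_maps T g n x ^^ s) (F 0) (\<lambda>p. 0)" and "i \<le> r"
  shows "(dunkl_maps T g n x ^^ (s * r)) (F i) (\<lambda>p. (if i = r then \<Prod>j=1..r. a j else 0) * F 0 p)"
proof -
  let ?R = "dunkl_maps T g n x"
  have 1: "(?R ^^ (s * j)) (F j) (\<lambda>p. (\<Prod>j=1..j. a j) * F 0 p)" if "j \<le> i" for j
    using that
  proof (induction j)
    case (Suc j)
    have "(?R ^^ (s + s * j)) (F (Suc j)) (\<lambda>p. a (Suc j) * ((\<Prod>j=1..j. a j) * F 0 p))"
      by (rule relpowp_trans[OF step dunkl_maps_power_cmult[OF Suc.IH]]) (use Suc.prems in auto)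
    thus ?case by (simp add: mult_ac)
  qed simp
  show ?thesis
  proof (cases "i = r")
    case True
    thus ?thesis using 1[of i] by simp
  next
    case False
    have "(?R ^^ (s * i + s)) (F i) (\<lambda>p. (\<Prod>j=1..i. a j) * 0)"
      by (rule relpowp_trans[OF 1 dunkl_maps_power_cmult[OF last]]) simp
    hence "(?R ^^ (s * i + s)) (F i) (\<lambda>p. 0)" by simp
    hence "(?R ^^ (s * i + s + s * (r - i - 1))) (F i) (\<lambda>p. 0)"
      by (rule relpowp_trans[OF _ dunkl_maps_power_0])
    also have "s * i + s + s * (r - i - 1) = s * r"
    proof -
      have "i + 1 + (r - i - 1) = r" using False assms(3) by simp
      hence "s * (i + 1 + (r - i - 1)) = s * r" by (rule arg_cong)
      thus ?thesis by (simp only: distrib_left mult_1_right)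
    qed
    finally show ?thesis using False by simp
  qed
qed

section \<open>Lowering the product of linear forms\<close>

definition sq :: "(nat \<Rightarrow> real) \<Rightarrow> nat \<Rightarrow> real" where "sq p i = (p i)\<^sup>2"

lemma sq_upd: "sq (p(x := t)) = (sq p)(x := t\<^sup>2)"
  by (auto simp: sq_def fun_eq_iff)

lemma sq_reflect: "s = 1 \<or> s = -1 \<Longrightarrow> sq (reflect s a b p) = swap_coords a b (sq p)"
  by (auto simp: sq_def fun_eq_iff reflect_apply swap_coords_apply power_mult_distrib)

locale parabolic_step =
  fixes g :: real and n m :: nat
  assumes m: "m < n" and g0: "g \<ge> 0"

text \<open>\<open>Suc m\<close> is the first coordinate on which the parabolic subgroup acts, the
  interval above it holds the other ones, and \<open>{1..m}\<close> the coordinates outside.\<close>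

sublocale parabolic_step \<subseteq> dunkl_setup "g / (1 + g)" g "Suc m" "{Suc (Suc m)..n}" "{1..m}"
  by unfold_locales (use g0 in auto)

context parabolic_step
begin

abbreviation "x \<equiv> Suc m"
abbreviation "Y \<equiv> {Suc (Suc m)..n}"
abbreviation "Z \<equiv> {1..m}"
abbreviation "r \<equiv> n - Suc m"

text \<open>The separate value at 0 records that the piece with \<open>phi 0\<close> is annihilated.
  With truncated subtraction \<open>phi (0 - 1)\<close> is \<open>phi 0\<close>, so the coefficient
  itself has to vanish.\<close>

definition lower_coeff :: "nat \<Rightarrow> real" where
  "lower_coeff i = (if i = 0 then 0 else real i + (real i + real m + 1) * g)"

lemma others: "{1..n} - {x} = Y \<union> Z" using m by auto

lemma x_in: "x \<in> {1..n}" using m by auto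

lemma cardY: "card Y = r" by simp

lemma insert_x: "insert x (Y \<union> Z) = {1..n}" using m by auto

lemma generic_inj:
  assumes "p \<in> generic_points n"
  shows "inj_on p (insert x (Y \<union> Z))" "inj_on (sq p) (insert x (Y \<union> Z))"
proof -
  show "inj_on (sq p) (insert x (Y \<union> Z))"
    using assms unfolding insert_x by (simp add: generic_points_def sq_def[abs_def])
  hence "inj_on ((\<lambda>t. t\<^sup>2) \<circ> p) (insert x (Y \<union> Z))" by (simp add: sq_def[abs_def] o_def)
  thus "inj_on p (insert x (Y \<union> Z))" by (rule inj_on_imageI2)
qed

lemma elem_phi_DERIV:
  "((\<lambda>t. elem l (phi i) (q(x := t))) has_real_derivative deriv (\<lambda>t. elem l (phi i) (q(x := t))) (q x)) (at (q x))"
proof -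
  obtain p where "slice (phi i) q p" using slice_phi by blast
  from elem_DERIV[OF this] show ?thesis
    by (metis DERIV_imp_deriv)
qed

lemma elem_phi_step:
  assumes "inj_on q (insert x (Y \<union> Z))" "l + i \<le> r"
  shows "deriv (\<lambda>t. elem l (phi i) (q(x := t))) (q x)
      + g * (\<Sum>v\<in>Y \<union> Z. (elem l (phi i) q - elem l (phi i) (swap_coords x v q)) / (q x - q v))
    = lower_coeff i * elem l (phi (i - 1)) q"
  using elem_phi_dunkl[OF assms(1), of l i] assms(2) by (simp add: lower_coeff_def)

lemma sum_mirrors_A:
  "(\<Sum>(s, v)\<in>mirrors TypeA n x. (if v = x then 2 else 1) * h s v / c s v) = (\<Sum>v\<in>Y \<union> Z. h 1 v / c 1 v)"
  for h c :: "real \<Rightarrow> nat \<Rightarrow> real"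
proof -
  have "mirrors TypeA n x = Pair 1 ` (Y \<union> Z)" unfolding mirrors_def others refl_type.case by blast
  thus ?thesis by (simp add: sum.reindex inj_on_def) (intro sum.cong, auto)
qed

lemma sum_mirrors_D:
  "(\<Sum>(s, v)\<in>mirrors TypeD n x. (if v = x then 2 else 1) * h s v / c s v)
     = (\<Sum>v\<in>Y \<union> Z. h 1 v / c 1 v + h (-1) v / c (-1) v)" for h c :: "real \<Rightarrow> nat \<Rightarrow> real"
proof -
  have m: "mirrors TypeD n x = {1, -1} \<times> (Y \<union> Z)" by (simp only: mirrors_def others refl_type.case)
  have "(\<Sum>(s, v)\<in>mirrors TypeD n x. (if v = x then 2 else 1) * h s v / c s v)
     = (\<Sum>(s, v)\<in>{1,-1} \<times> (Y \<union> Z). h s v / c s v)"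
    unfolding m by (intro sum.cong) auto
  also have "\<dots> = (\<Sum>s\<in>{1, -1}. \<Sum>v\<in>Y \<union> Z. h s v / c s v)"
    by (rule sum.cartesian_product[symmetric])
  also have "\<dots> = (\<Sum>v\<in>Y \<union> Z. h 1 v / c 1 v + h (-1) v / c (-1) v)"
    by (simp add: sum.distrib)
  finally show ?thesis .
qed

lemma sum_mirrors_B:
  "(\<Sum>(s, v)\<in>mirrors TypeB n x. (if v = x then 2 else 1) * h s v / c s v)
     = 2 * h (-1) x / c (-1) x + (\<Sum>v\<in>Y \<union> Z. h 1 v / c 1 v + h (-1) v / c (-1) v)"
  for h c :: "real \<Rightarrow> nat \<Rightarrow> real"
proof -
  have "mirrors TypeB n x = insert (-1, x) (mirrors TypeD n x)" by (simp add: mirrors_def)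
  moreover have "(-1, x) \<notin> mirrors TypeD n x" by (simp add: mirrors_def)
  ultimately show ?thesis using sum_mirrors_D[of h c] by simp
qed

lemma maps_A:
  assumes "l + i \<le> r"
  shows "dunkl_maps TypeA g n x (elem l (phi i)) (\<lambda>p. lower_coeff i * elem l (phi (i - 1)) p)"
  unfolding dunkl_maps_def dunkl_def sum_mirrors_A reflect_1 mult_1
proof (intro ballI conjI)
  fix p assume p: "p \<in> generic_points n"
  show "(\<lambda>t. elem l (phi i) (p(x := t))) field_differentiable at (p x)"
    using elem_phi_DERIV unfolding field_differentiable_def by blast
qed (use elem_phi_step[OF generic_inj(1) assms] in blast)

text \<open>The piece with \<open>phi i\<close> is annihilated after \<open>i + 1\<close>
  applications. Only \<open>i = r\<close> outlasts all \<open>r\<close> of them, and it ends with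
  index 0 in both series, which is the Vandermonde product of \<open>Y\<close>.\<close>

lemma vandermonde_power_A:
  "(dunkl_maps TypeA g n x ^^ r) (vandermonde (insert x Y))
     (\<lambda>p. (\<Prod>i=1..r. lower_coeff i) * vandermonde Y p)"
proof -
  have "(dunkl_maps TypeA g n x ^^ (1 * r)) (elem (r - i) (phi i))
     (\<lambda>p. (if i = r then \<Prod>j=1..r. lower_coeff j else 0) * elem (r - i) (phi 0) p)" if "i \<in> {0..r}" for i
  proof (rule dunkl_maps_chain[where F = "\<lambda>j. elem (r - i) (phi j)"])
    show "(dunkl_maps TypeA g n x ^^ 1) (elem (r - i) (phi (Suc j)))
        (\<lambda>p. lower_coeff (Suc j) * elem (r - i) (phi j) p)" if "j < i" for j
    proof -
      have "r - i + Suc j \<le> r" using that \<open>i \<in> {0..r}\<close> by auto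
      from maps_A[OF this] show ?thesis by (simp add: eq_OO)
    qed
    show "(dunkl_maps TypeA g n x ^^ 1) (elem (r - i) (phi 0)) (\<lambda>p. 0)"
      using maps_A[of "r - i" 0] by (simp add: lower_coeff_def eq_OO)
  qed (use that in auto)
  hence "(dunkl_maps TypeA g n x ^^ (1 * r)) (\<lambda>p. \<Sum>i=0..r. elem (r - i) (phi i) p)
     (\<lambda>p. \<Sum>i=0..r. (if i = r then \<Prod>j=1..r. lower_coeff j else 0) * elem (r - i) (phi 0) p)"
    by (intro dunkl_maps_power_sum) auto
  moreover have "(\<lambda>p. \<Sum>i=0..r. elem (r - i) (phi i) p) = vandermonde (insert x Y)"
    by (rule ext, subst vandermonde_decomposition) (auto simp: cardY)
  moreover have "(\<Sum>i=0..r. (if i = r then \<Prod>j=1..r. lower_coeff j else 0) * elem (r - i) (phi 0) p)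
     = (\<Prod>i=1..r. lower_coeff i) * vandermonde Y p" for p
  proof -
    have "(\<Sum>i=0..r. (if i = r then \<Prod>j=1..r. lower_coeff j else 0) * elem (r - i) (phi 0) p)
      = (\<Sum>i=0..r. if i = r then (\<Prod>j=1..r. lower_coeff j) * elem (r - i) (phi 0) p else 0)"
      by (intro sum.cong) auto
    also have "\<dots> = (\<Prod>j=1..r. lower_coeff j) * elem 0 (phi 0) p" by simp
    also have "elem 0 (phi 0) p = vandermonde Y p" by (rule elem_0_phi_0)
    finally show ?thesis .
  qed
  ultimately show ?thesis by simp
qed

section \<open>Types D and B by means of the squared coordinates\<close>

lemma DERIV_sq:
  "((\<lambda>t. elem l (phi i) (sq (p(x := t)))) has_real_derivative
     deriv (\<lambda>t. elem l (phi i) ((sq p)(x := t))) (sq p x) * (2 * p x)) (at (p x))"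
proof -
  have "((\<lambda>t. t\<^sup>2) has_real_derivative 2 * p x) (at (p x))"
    by (auto intro!: derivative_eq_intros)
  moreover have "((\<lambda>t. elem l (phi i) ((sq p)(x := t))) has_real_derivative
     deriv (\<lambda>t. elem l (phi i) ((sq p)(x := t))) (sq p x)) (at ((p x)\<^sup>2))"
    using elem_phi_DERIV[of l i "sq p"] by (simp add: sq_def)
  ultimately show ?thesis unfolding sq_upd by (rule DERIV_chain2[rotated])
qed

text \<open>The two mirrors on which the squares of two coordinates agree combine into one
  difference quotient in the squares. The first identity serves functions of the squares, the second
  one functions with an odd factor that moves with the reflection.\<close>

lemma mirror_sum:
  fixes a b :: real
  assumes "a\<^sup>2 \<noteq> b\<^sup>2"
  shows "c / (a - b) + c / (a + b) = 2 * a * (c / (a\<^sup>2 - b\<^sup>2))"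
    and "(a * c - b * d) / (a - b) + (a * c - - b * d) / (a + b) = 2 * ((a\<^sup>2 * c - b\<^sup>2 * d) / (a\<^sup>2 - b\<^sup>2))"
proof -
  have *: "a - b \<noteq> 0" "a + b \<noteq> 0" using assms by (auto simp: power2_eq_square square_eq_iff add_eq_0_iff)
  have f: "a\<^sup>2 - b\<^sup>2 = (a - b) * (a + b)" by (simp add: power2_eq_square algebra_simps)
  show "c / (a - b) + c / (a + b) = 2 * a * (c / (a\<^sup>2 - b\<^sup>2))"
    "(a * c - b * d) / (a - b) + (a * c - - b * d) / (a + b) = 2 * ((a\<^sup>2 * c - b\<^sup>2 * d) / (a\<^sup>2 - b\<^sup>2))"
    unfolding f using * by (simp_all add: field_simps power2_eq_square)
qed

lemma generic_sq_ne: "p \<in> generic_points n \<Longrightarrow> v \<in> Y \<union> Z \<Longrightarrow> (p x)\<^sup>2 \<noteq> (p v)\<^sup>2"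
  using inj_onD[OF generic_inj(2), of p x v] by (auto simp: sq_def)

text \<open>The chain rule and \<open>mirror_sum\<close> both bring out the factor
  \<open>2 * p x\<close>, and what remains is the type A operator in the squares. The image is odd
  in \<open>p x\<close>, so a second application is needed to return to functions of the
  squares.\<close>

lemma maps_D1:
  assumes "l + i \<le> r"
  shows "dunkl_maps TypeD g n x (\<lambda>p. elem l (phi i) (sq p))
     (\<lambda>p. (2 * lower_coeff i) * (p x * elem l (phi (i - 1)) (sq p)))"
  unfolding dunkl_maps_def
proof (intro ballI conjI)
  fix p assume p: "p \<in> generic_points n"
  let ?F = "elem l (phi i)"
  show "(\<lambda>t. ?F (sq (p(x := t)))) field_differentiable at (p x)"
    using DERIV_sq by (auto simp: field_differentiable_def)
  have "(\<Sum>(s, v)\<in>mirrors TypeD n x. (if v = x then 2 else 1) * (?F (sq p) - ?F (sq (reflect s x v p))) / (p x - s * p v))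
    = (\<Sum>v\<in>Y \<union> Z. (?F (sq p) - ?F (sq (reflect 1 x v p))) / (p x - 1 * p v)
        + (?F (sq p) - ?F (sq (reflect (-1) x v p))) / (p x - (-1) * p v))"
    by (rule sum_mirrors_D)
  also have "\<dots> = (\<Sum>v\<in>Y \<union> Z. 2 * p x * ((?F (sq p) - ?F (swap_coords x v (sq p))) / (sq p x - sq p v)))"
  proof (intro sum.cong refl)
    fix v assume v: "v \<in> Y \<union> Z"
    show "(?F (sq p) - ?F (sq (reflect 1 x v p))) / (p x - 1 * p v)
        + (?F (sq p) - ?F (sq (reflect (-1) x v p))) / (p x - (-1) * p v)
       = 2 * p x * ((?F (sq p) - ?F (swap_coords x v (sq p))) / (sq p x - sq p v))"
      using mirror_sum(1)[OF generic_sq_ne[OF p v]] by (simp add: sq_reflect) (simp add: sq_def)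
  qed
  finally have "dunkl TypeD g n x (\<lambda>p. ?F (sq p)) p = 2 * p x * (deriv (\<lambda>t. ?F ((sq p)(x := t))) (sq p x)
      + g * (\<Sum>v\<in>Y \<union> Z. (?F (sq p) - ?F (swap_coords x v (sq p))) / (sq p x - sq p v)))"
    unfolding dunkl_def DERIV_imp_deriv[OF DERIV_sq] by (simp add: algebra_simps sum_distrib_left)
  thus "dunkl TypeD g n x (\<lambda>p. ?F (sq p)) p = (2 * lower_coeff i) * (p x * elem l (phi (i - 1)) (sq p))"
    unfolding elem_phi_step[OF generic_inj(2)[OF p] assms] by simp
qed

lemma DERIV_times:
  assumes "((\<lambda>t. f (p(x := t))) has_real_derivative D) (at (p x))"
  shows "((\<lambda>t. (p(x := t)) x * f (p(x := t))) has_real_derivative f p + p x * D) (at (p x))"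
  using DERIV_mult[OF DERIV_ident assms] by (simp add: mult.commute)

lemma elem_times_step:
  assumes "inj_on q (insert x (Y \<union> Z))" "l + i < r"
  shows "q x * deriv (\<lambda>t. elem l (phi i) (q(x := t))) (q x)
      + g * (\<Sum>v\<in>Y \<union> Z. (q x * elem l (phi i) q - q v * elem l (phi i) (swap_coords x v q)) / (q x - q v))
    = (real i + (1 + real i + real m) * g) * elem l (phi i) q"
proof -
  have e: "elem l (\<lambda>q. q x * phi i q) q = q x * elem l (phi i) q" for q
    unfolding elem_def by simp
  have s: "swap_coords x v q x = q v" for v by (simp add: swap_coords_apply)
  have d: "deriv (\<lambda>t. (q(x := t)) x * elem l (phi i) (q(x := t))) (q x)
     = elem l (phi i) q + q x * deriv (\<lambda>t. elem l (phi i) (q(x := t))) (q x)"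
    by (rule DERIV_imp_deriv[OF DERIV_times[OF elem_phi_DERIV]])
  show ?thesis
    using elem_times_phi_dunkl[OF assms(1), of l i] assms(2) unfolding e s d cardY
    by (simp add: algebra_simps)
qed

text \<open>The product rule gives the function itself plus twice the expression of
  \<open>elem_times_step\<close>, hence the constant 1 + 2 (i + (1 + i + m) g).\<close>

lemma maps_D2:
  assumes "l + i < r"
  shows "dunkl_maps TypeD g n x (\<lambda>p. p x * elem l (phi i) (sq p))
     (\<lambda>p. (1 + 2 * real i + 2 * (1 + real i + real m) * g) * elem l (phi i) (sq p))"
  unfolding dunkl_maps_def
proof (intro ballI conjI)
  fix p assume p: "p \<in> generic_points n"
  let ?F = "elem l (phi i)"
  have D: "((\<lambda>t. (p(x := t)) x * ?F (sq (p(x := t)))) has_real_derivative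
      ?F (sq p) + p x * (deriv (\<lambda>t. ?F ((sq p)(x := t))) (sq p x) * (2 * p x))) (at (p x))"
    by (rule DERIV_times[OF DERIV_sq])
  show "(\<lambda>t. (p(x := t)) x * ?F (sq (p(x := t)))) field_differentiable at (p x)"
    using D by (auto simp: field_differentiable_def)
  let ?S = "\<Sum>v\<in>Y \<union> Z. (sq p x * ?F (sq p) - sq p v * ?F (swap_coords x v (sq p))) / (sq p x - sq p v)"
  have "(\<Sum>(s, v)\<in>mirrors TypeD n x. (if v = x then 2 else 1) *
        (p x * ?F (sq p) - reflect s x v p x * ?F (sq (reflect s x v p))) / (p x - s * p v))
    = (\<Sum>v\<in>Y \<union> Z. (p x * ?F (sq p) - reflect 1 x v p x * ?F (sq (reflect 1 x v p))) / (p x - 1 * p v)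
        + (p x * ?F (sq p) - reflect (-1) x v p x * ?F (sq (reflect (-1) x v p))) / (p x - (-1) * p v))"
    by (rule sum_mirrors_D)
  also have "\<dots> = (\<Sum>v\<in>Y \<union> Z. 2 * ((sq p x * ?F (sq p) - sq p v * ?F (swap_coords x v (sq p))) / (sq p x - sq p v)))"
  proof (intro sum.cong refl)
    fix v assume v: "v \<in> Y \<union> Z"
    have "reflect s x v p x = s * p v" for s using v by (auto simp: reflect_apply)
    thus "(p x * ?F (sq p) - reflect 1 x v p x * ?F (sq (reflect 1 x v p))) / (p x - 1 * p v)
        + (p x * ?F (sq p) - reflect (-1) x v p x * ?F (sq (reflect (-1) x v p))) / (p x - (-1) * p v)
       = 2 * ((sq p x * ?F (sq p) - sq p v * ?F (swap_coords x v (sq p))) / (sq p x - sq p v))"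
      using mirror_sum(2)[OF generic_sq_ne[OF p v], of "?F (sq p)" "?F (swap_coords x v (sq p))"]
      by (simp add: sq_reflect) (simp add: sq_def)
  qed
  also have "\<dots> = 2 * ?S" by (simp only: sum_distrib_left)
  finally have "dunkl TypeD g n x (\<lambda>p. p x * ?F (sq p)) p
     = ?F (sq p) + 2 * (sq p x * deriv (\<lambda>t. ?F ((sq p)(x := t))) (sq p x) + g * ?S)"
    unfolding dunkl_def DERIV_imp_deriv[OF D] by (simp add: sq_def power2_eq_square algebra_simps)
  thus "dunkl TypeD g n x (\<lambda>p. p x * ?F (sq p)) p
     = (1 + 2 * real i + 2 * (1 + real i + real m) * g) * ?F (sq p)"
    unfolding elem_times_step[OF generic_inj(2)[OF p] assms] by (simp add: algebra_simps)
qed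

text \<open>In type B the coordinates of the subgroup are themselves forms, up to
  \<open>sqrt 2\<close>. Their product is \<open>p x\<close> times \<open>odd_part\<close>, and the
  two factors behave differently under the operator in direction \<open>x\<close>.\<close>

definition odd_part :: "(nat \<Rightarrow> real) \<Rightarrow> real" where
  "odd_part p = (\<Prod>y\<in>Y. p y)"

lemma odd_part_upd: "odd_part (p(x := t)) = odd_part p"
  unfolding odd_part_def by (intro prod.cong) auto

lemma odd_part_reflect_Z: "v \<in> Z \<Longrightarrow> odd_part (reflect s x v p) = odd_part p"
  unfolding odd_part_def by (intro prod.cong) (auto simp: reflect_apply)

lemma odd_part_reflect_x: "odd_part (reflect s x x p) = odd_part p"
  unfolding odd_part_def by (intro prod.cong) (auto simp: reflect_apply)

lemma odd_part_reflect_Y: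
  assumes "v \<in> Y"
  shows "odd_part (reflect s x v p) * p v = odd_part p * (s * p x)"
proof -
  have "(\<Prod>y\<in>Y - {v}. reflect s x v p y) = (\<Prod>y\<in>Y - {v}. p y)"
    by (intro prod.cong) (auto simp: reflect_apply)
  moreover have "reflect s x v p v = s * p x" by (simp add: reflect_apply)
  ultimately show ?thesis
    unfolding odd_part_def using prod.remove[of Y v "reflect s x v p"] prod.remove[of Y v p] assms by simp
qed

text \<open>The function is even in \<open>p x\<close>, so the sign change contributes nothing. A
  reflection with \<open>Z\<close> fixes \<open>odd_part\<close>, while one with \<open>Y\<close>
  replaces its factor \<open>p v\<close> by \<open>s * p x\<close>; both kinds lead to the same
  quotient in the squares.\<close>

lemma maps_B1:
  assumes "l + i \<le> r"
  shows "dunkl_maps TypeB g n x (\<lambda>p. odd_part p * elem l (phi i) (sq p))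
     (\<lambda>p. (2 * lower_coeff i) * (p x * (odd_part p * elem l (phi (i - 1)) (sq p))))"
  unfolding dunkl_maps_def
proof (intro ballI conjI)
  fix p assume p: "p \<in> generic_points n"
  let ?F = "elem l (phi i)" and ?b = odd_part
  have D: "((\<lambda>t. ?b (p(x := t)) * ?F (sq (p(x := t)))) has_real_derivative
      ?b p * (deriv (\<lambda>t. ?F ((sq p)(x := t))) (sq p x) * (2 * p x))) (at (p x))"
    unfolding odd_part_upd by (rule DERIV_cmult[OF DERIV_sq])
  show "(\<lambda>t. ?b (p(x := t)) * ?F (sq (p(x := t)))) field_differentiable at (p x)"
    using D by (auto simp: field_differentiable_def)
  let ?S = "\<Sum>v\<in>Y \<union> Z. (?F (sq p) - ?F (swap_coords x v (sq p))) / (sq p x - sq p v)"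
  have "(\<Sum>(s, v)\<in>mirrors TypeB n x. (if v = x then 2 else 1) *
        (?b p * ?F (sq p) - ?b (reflect s x v p) * ?F (sq (reflect s x v p))) / (p x - s * p v))
    = 2 * (?b p * ?F (sq p) - ?b (reflect (-1) x x p) * ?F (sq (reflect (-1) x x p))) / (p x - (-1) * p x) +
     (\<Sum>v\<in>Y \<union> Z. (?b p * ?F (sq p) - ?b (reflect 1 x v p) * ?F (sq (reflect 1 x v p))) / (p x - 1 * p v)
        + (?b p * ?F (sq p) - ?b (reflect (-1) x v p) * ?F (sq (reflect (-1) x v p))) / (p x - (-1) * p v))"
    by (rule sum_mirrors_B)
  also have "sq (reflect (-1) x x p) = sq p" by (auto simp: sq_def fun_eq_iff reflect_apply)
  also have "2 * (?b p * ?F (sq p) - ?b (reflect (-1) x x p) * ?F (sq p)) / (p x - (-1) * p x) = 0"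
    by (simp add: odd_part_reflect_x)
  also have "(\<Sum>v\<in>Y \<union> Z. (?b p * ?F (sq p) - ?b (reflect 1 x v p) * ?F (sq (reflect 1 x v p))) / (p x - 1 * p v)
        + (?b p * ?F (sq p) - ?b (reflect (-1) x v p) * ?F (sq (reflect (-1) x v p))) / (p x - (-1) * p v))
     = (\<Sum>v\<in>Y \<union> Z. 2 * p x * ?b p * ((?F (sq p) - ?F (swap_coords x v (sq p))) / (sq p x - sq p v)))"
  proof (intro sum.cong refl)
    fix v assume v: "v \<in> Y \<union> Z"
    let ?F' = "?F (swap_coords x v (sq p))"
    have pv: "p v \<noteq> 0" using p v m by (auto simp: generic_points_def)
    have px: "p x \<noteq> 0" using p m by (auto simp: generic_points_def)
    show "(?b p * ?F (sq p) - ?b (reflect 1 x v p) * ?F (sq (reflect 1 x v p))) / (p x - 1 * p v)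
        + (?b p * ?F (sq p) - ?b (reflect (-1) x v p) * ?F (sq (reflect (-1) x v p))) / (p x - (-1) * p v)
      = 2 * p x * ?b p * ((?F (sq p) - ?F') / (sq p x - sq p v))"
    proof (cases "v \<in> Z")
      case True
      have "(?b p * ?F (sq p) - ?b p * ?F') / (p x - p v) + (?b p * ?F (sq p) - ?b p * ?F') / (p x + p v)
         = 2 * p x * ?b p * ((?F (sq p) - ?F') / (sq p x - sq p v))"
        unfolding mirror_sum(1)[OF generic_sq_ne[OF p v]]
        by (simp add: sq_def right_diff_distrib)
      thus ?thesis by (simp add: sq_reflect odd_part_reflect_Z[OF True])
    next
      case False
      hence vY: "v \<in> Y" using v by blast
      have b: "?b (reflect s x v p) = s * p x * (?b p / p v)" for s
        using odd_part_reflect_Y[OF vY, of s p] pv by (simp add: field_simps)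
      \<comment> \<open>The second identity of \<open>mirror_sum\<close> is used with c and d chosen
        such that \<open>p x\<close> times c and \<open>p v\<close> times d are the two values in
        question. Multiplied by the squares instead, both acquire the common factor
        \<open>p x * odd_part p\<close>.\<close>
      have "2 * ((p x)\<^sup>2 * ((?b p * ?F (sq p)) / p x) - (p v)\<^sup>2 * (p x * (?b p / p v) / p v * ?F')) / ((p x)\<^sup>2 - (p v)\<^sup>2)
         = 2 * p x * ?b p * ((?F (sq p) - ?F') / ((p x)\<^sup>2 - (p v)\<^sup>2))"
        using px pv by (simp add: power2_eq_square right_diff_distrib mult_ac)
      moreover have "(p x * ((?b p * ?F (sq p)) / p x) - p v * (p x * (?b p / p v) / p v * ?F')) / (p x - p v)
         + (p x * ((?b p * ?F (sq p)) / p x) - - p v * (p x * (?b p / p v) / p v * ?F')) / (p x + p v)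
         = (?b p * ?F (sq p) - 1 * p x * (?b p / p v) * ?F') / (p x - 1 * p v)
          + (?b p * ?F (sq p) - (-1) * p x * (?b p / p v) * ?F') / (p x - (-1) * p v)"
        using px pv by simp
      ultimately show ?thesis
        using mirror_sum(2)[OF generic_sq_ne[OF p v], of "(?b p * ?F (sq p)) / p x" "p x * (?b p / p v) / p v * ?F'"]
        unfolding b by (simp add: sq_reflect) (simp add: sq_def)
    qed
  qed
  also have "\<dots> = 2 * p x * ?b p * ?S" by (simp only: sum_distrib_left)
  finally have "dunkl TypeB g n x (\<lambda>p. ?b p * ?F (sq p)) p
     = 2 * p x * ?b p * (deriv (\<lambda>t. ?F ((sq p)(x := t))) (sq p x) + g * ?S)"
    unfolding dunkl_def DERIV_imp_deriv[OF D] by (simp add: algebra_simps)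
  thus "dunkl TypeB g n x (\<lambda>p. ?b p * ?F (sq p)) p
    = (2 * lower_coeff i) * (p x * (?b p * elem l (phi (i - 1)) (sq p)))"
    unfolding elem_phi_step[OF generic_inj(2)[OF p] assms] by simp
qed

text \<open>\<open>p x * odd_part p\<close> is invariant under the reflections with \<open>Y\<close>
  and odd in \<open>p x\<close>. The sign change therefore contributes 2 g, the product rule 1, and
  \<open>elem_phi_odd\<close> twice i + (i + m) g; these add up to the constant.\<close>

lemma maps_B2:
  assumes "l + i \<le> r"
  shows "dunkl_maps TypeB g n x (\<lambda>p. p x * (odd_part p * elem l (phi i) (sq p)))
     (\<lambda>p. (1 + 2 * real i + 2 * (1 + real i + real m) * g) * (odd_part p * elem l (phi i) (sq p)))"
  unfolding dunkl_maps_def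
proof (intro ballI conjI)
  fix p assume p: "p \<in> generic_points n"
  let ?F = "elem l (phi i)" and ?b = odd_part
  have D: "((\<lambda>t. (p(x := t)) x * (?b (p(x := t)) * ?F (sq (p(x := t))))) has_real_derivative
      ?b p * ?F (sq p) + p x * (?b p * (deriv (\<lambda>t. ?F ((sq p)(x := t))) (sq p x) * (2 * p x)))) (at (p x))"
    by (rule DERIV_times[where f = "\<lambda>p. ?b p * ?F (sq p)"], unfold odd_part_upd, rule DERIV_cmult[OF DERIV_sq])
  show "(\<lambda>t. (p(x := t)) x * (?b (p(x := t)) * ?F (sq (p(x := t))))) field_differentiable at (p x)"
    using D by (auto simp: field_differentiable_def)
  let ?u = "sq p"
  let ?SY = "\<Sum>y\<in>Y. ?u x * (?F ?u - ?F (swap_coords x y ?u)) / (?u x - ?u y)"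
  let ?SZ = "\<Sum>z\<in>Z. (?u x * ?F ?u - ?u z * ?F (swap_coords x z ?u)) / (?u x - ?u z)"
  have px: "p x \<noteq> 0" using p m by (auto simp: generic_points_def)
  define h where "h s v = p x * (?b p * ?F ?u) - reflect s x v p x * (?b (reflect s x v p) * ?F (sq (reflect s x v p)))" for s v
  have "(\<Sum>(s, v)\<in>mirrors TypeB n x. (if v = x then 2 else 1) * h s v / (p x - s * p v))
    = 2 * h (-1) x / (p x - (-1) * p x) + (\<Sum>v\<in>Y \<union> Z. h 1 v / (p x - 1 * p v) + h (-1) v / (p x - (-1) * p v))"
    by (rule sum_mirrors_B)
  also have "2 * h (-1) x / (p x - (-1) * p x) = 2 * (?b p * ?F ?u)"
  proof -
    have "sq (reflect (-1) x x p) = sq p" by (auto simp: sq_def fun_eq_iff reflect_apply)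
    moreover have "reflect (-1) x x p x = - p x" by (simp add: reflect_apply)
    ultimately show ?thesis using px by (simp add: h_def odd_part_reflect_x)
  qed
  also have "(\<Sum>v\<in>Y \<union> Z. h 1 v / (p x - 1 * p v) + h (-1) v / (p x - (-1) * p v))
     = (\<Sum>v\<in>Y. h 1 v / (p x - 1 * p v) + h (-1) v / (p x - (-1) * p v))
       + (\<Sum>v\<in>Z. h 1 v / (p x - 1 * p v) + h (-1) v / (p x - (-1) * p v))"
    by (rule sum.union_disjoint) auto
  also have "(\<Sum>v\<in>Y. h 1 v / (p x - 1 * p v) + h (-1) v / (p x - (-1) * p v)) = 2 * ?b p * ?SY"
    unfolding sum_distrib_left
  proof (intro sum.cong refl)
    fix v assume v: "v \<in> Y"
    have pv: "p v \<noteq> 0" using p v by (auto simp: generic_points_def)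
    have "?b (reflect s x v p) = s * p x * (?b p / p v)" for s
      using odd_part_reflect_Y[OF v, of s p] pv by (simp add: field_simps)
    moreover have "reflect s x v p x = s * p v" for s using v by (auto simp: reflect_apply)
    ultimately have hh: "h s v = p x * ?b p * (?F ?u - ?F (swap_coords x v ?u))" if "s = 1 \<or> s = -1" for s
      using pv that by (auto simp: h_def sq_reflect right_diff_distrib)
    show "h 1 v / (p x - 1 * p v) + h (-1) v / (p x - (-1) * p v)
       = 2 * ?b p * (?u x * (?F ?u - ?F (swap_coords x v ?u)) / (?u x - ?u v))"
      using mirror_sum(1)[OF generic_sq_ne[OF p], of v "p x * ?b p * (?F ?u - ?F (swap_coords x v ?u))"] v
      by (simp add: hh) (simp add: sq_def power2_eq_square)
  qed
  also have "(\<Sum>v\<in>Z. h 1 v / (p x - 1 * p v) + h (-1) v / (p x - (-1) * p v)) = 2 * ?b p * ?SZ"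
    unfolding sum_distrib_left
  proof (intro sum.cong refl)
    fix v assume v: "v \<in> Z"
    have "reflect s x v p x = s * p v" for s using v by (auto simp: reflect_apply)
    hence hh: "h s v = p x * (?b p * ?F ?u) - s * p v * (?b p * ?F (swap_coords x v ?u))" if "s = 1 \<or> s = -1" for s
      using that odd_part_reflect_Z[OF v] by (simp add: h_def sq_reflect)
    show "h 1 v / (p x - 1 * p v) + h (-1) v / (p x - (-1) * p v)
       = 2 * ?b p * ((?u x * ?F ?u - ?u v * ?F (swap_coords x v ?u)) / (?u x - ?u v))"
      using mirror_sum(2)[OF generic_sq_ne[OF p], of v "?b p * ?F ?u" "?b p * ?F (swap_coords x v ?u)"] v
      by (simp add: hh) (simp add: sq_def right_diff_distrib mult_ac)
  qed
  finally have hs: "(\<Sum>(s, v)\<in>mirrors TypeB n x. (if v = x then 2 else 1) * h s v / (p x - s * p v))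
     = 2 * (?b p * ?F ?u) + (2 * ?b p * ?SY + 2 * ?b p * ?SZ)" .
  have ux: "?u x = p x * p x" by (simp add: sq_def power2_eq_square)
  have "dunkl TypeB g n x (\<lambda>p. p x * (?b p * ?F (sq p))) p
     = ?b p * ?F ?u + p x * (?b p * (deriv (\<lambda>t. ?F ((sq p)(x := t))) (sq p x) * (2 * p x)))
       + g * (\<Sum>(s, v)\<in>mirrors TypeB n x. (if v = x then 2 else 1) * h s v / (p x - s * p v))"
    unfolding dunkl_def DERIV_imp_deriv[OF D] h_def ..
  also have "\<dots> = ?b p * ((1 + 2 * g) * ?F ?u + 2 * (?u x * deriv (\<lambda>t. ?F (?u(x := t))) (?u x) + g * ?SY + g * ?SZ))"
    unfolding hs using ux by algebra
  finally have "dunkl TypeB g n x (\<lambda>p. p x * (?b p * ?F (sq p))) p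
     = ?b p * ((1 + 2 * g) * ?F ?u + 2 * (?u x * deriv (\<lambda>t. ?F (?u(x := t))) (?u x) + g * ?SY + g * ?SZ))" .
  moreover have "?u x * deriv (\<lambda>t. ?F (?u(x := t))) (?u x) + g * ?SY + g * ?SZ
      = (real i + (real i + real m) * g) * ?F ?u"
    using elem_phi_odd[OF generic_inj(2)[OF p], of l i] assms by simp
  moreover have "b * ((1 + 2 * g) * f + 2 * ((real i + (real i + real m) * g) * f))
     = (1 + 2 * real i + 2 * (1 + real i + real m) * g) * (b * f)" for b f
    by (simp add: algebra_simps)
  ultimately show "dunkl TypeB g n x (\<lambda>p. p x * (?b p * ?F (sq p))) p
     = (1 + 2 * real i + 2 * (1 + real i + real m) * g) * (?b p * ?F (sq p))"
    by (simp only:)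
qed

text \<open>A link of the chain costs two applications: \<open>maps_D1\<close> makes an even piece
  odd, \<open>maps_D2\<close> makes it even again. The second one already meets
  \<open>phi (i - 1)\<close>, whence \<open>2 * real i - 1\<close> in its constant.\<close>

lemma vandermonde_power_D:
  "(dunkl_maps TypeD g n x ^^ (2 * r)) (\<lambda>p. vandermonde (insert x Y) (sq p))
     (\<lambda>p. (\<Prod>i=1..r. 2 * lower_coeff i * (2 * real i - 1 + 2 * (real i + real m) * g)) * vandermonde Y (sq p))"
proof -
  let ?R = "dunkl_maps TypeD g n x"
  define a where "a i = 2 * lower_coeff i * (2 * real i - 1 + 2 * (real i + real m) * g)" for i
  have "(?R ^^ (2 * r)) (\<lambda>p. elem (r - i) (phi i) (sq p))
     (\<lambda>p. (if i = r then \<Prod>j=1..r. a j else 0) * elem (r - i) (phi 0) (sq p))" if "i \<in> {0..r}" for i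
  proof (rule dunkl_maps_chain[where F = "\<lambda>j p. elem (r - i) (phi j) (sq p)"])
    show "(?R ^^ 2) (\<lambda>p. elem (r - i) (phi (Suc j)) (sq p))
        (\<lambda>p. a (Suc j) * elem (r - i) (phi j) (sq p))" if "j < i" for j
    proof -
      have h: "r - i + Suc j \<le> r" "r - i + j < r" using that \<open>i \<in> {0..r}\<close> by auto
      have "?R (\<lambda>p. elem (r - i) (phi (Suc j)) (sq p))
         (\<lambda>p. (2 * lower_coeff (Suc j)) * (p x * elem (r - i) (phi j) (sq p)))"
        using maps_D1[OF h(1)] by (simp only: diff_Suc_1)
      hence "(?R OO ?R) (\<lambda>p. elem (r - i) (phi (Suc j)) (sq p))
        (\<lambda>p. 2 * lower_coeff (Suc j) * ((1 + 2 * real j + 2 * (1 + real j + real m) * g) * elem (r - i) (phi j) (sq p)))"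
        by (rule relcomppI[where r = ?R and s = ?R, OF _ dunkl_maps_cmult[OF maps_D2[OF h(2)]]])
      moreover have "a (Suc j) = 2 * lower_coeff (Suc j) * (1 + 2 * real j + 2 * (1 + real j + real m) * g)"
        by (simp add: a_def)
      ultimately show ?thesis by (simp add: numeral_2_eq_2 eq_OO mult.assoc)
    qed
    show "(?R ^^ 2) (\<lambda>p. elem (r - i) (phi 0) (sq p)) (\<lambda>p. 0)"
    proof -
      have "?R (\<lambda>p. elem (r - i) (phi 0) (sq p)) (\<lambda>p. 0)"
        using maps_D1[of "r - i" 0] by (simp add: lower_coeff_def)
      hence "(?R OO ?R) (\<lambda>p. elem (r - i) (phi 0) (sq p)) (\<lambda>p. 0)"
        by (rule relcomppI[where r = ?R and s = ?R, OF _ dunkl_maps_0])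
      thus ?thesis by (simp add: numeral_2_eq_2 eq_OO)
    qed
  qed (use that in auto)
  hence "(?R ^^ (2 * r)) (\<lambda>p. \<Sum>i=0..r. elem (r - i) (phi i) (sq p))
     (\<lambda>p. \<Sum>i=0..r. (if i = r then \<Prod>j=1..r. a j else 0) * elem (r - i) (phi 0) (sq p))"
    by (intro dunkl_maps_power_sum) auto
  moreover have "(\<Sum>i=0..r. elem (r - i) (phi i) (sq p)) = vandermonde (insert x Y) (sq p)" for p
    by (subst vandermonde_decomposition) (auto simp: cardY)
  moreover have "(\<Sum>i=0..r. (if i = r then \<Prod>j=1..r. a j else 0) * elem (r - i) (phi 0) (sq p))
     = (\<Prod>j=1..r. a j) * vandermonde Y (sq p)" for p
  proof -
    have "(\<Sum>i=0..r. (if i = r then \<Prod>j=1..r. a j else 0) * elem (r - i) (phi 0) (sq p))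
      = (\<Sum>i=0..r. if i = r then (\<Prod>j=1..r. a j) * elem (r - i) (phi 0) (sq p) else 0)"
      by (intro sum.cong) auto
    also have "\<dots> = (\<Prod>j=1..r. a j) * elem 0 (phi 0) (sq p)" by simp
    also have "elem 0 (phi 0) (sq p) = vandermonde Y (sq p)" by (rule elem_0_phi_0)
    finally show ?thesis .
  qed
  ultimately show ?thesis by (simp add: a_def)
qed

text \<open>The chain starts with odd pieces, so \<open>maps_B2\<close> comes before
  \<open>maps_B1\<close> and still sees \<open>phi i\<close>. After \<open>2 * r\<close>
  applications the factor \<open>p x\<close> is present once more; one last application removes it
  and gives the separate constant.\<close>

lemma vandermonde_power_B:
  "(dunkl_maps TypeB g n x ^^ (2 * r + 1)) (\<lambda>p. p x * (odd_part p * vandermonde (insert x Y) (sq p)))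
     (\<lambda>p. ((\<Prod>i=1..r. 2 * lower_coeff i * (1 + 2 * real i + 2 * (1 + real i + real m) * g))
        * (1 + 2 * (1 + real m) * g)) * (odd_part p * vandermonde Y (sq p)))"
proof -
  let ?R = "dunkl_maps TypeB g n x"
  define a where "a i = 2 * lower_coeff i * (1 + 2 * real i + 2 * (1 + real i + real m) * g)" for i
  have "(?R ^^ (2 * r)) (\<lambda>p. p x * (odd_part p * elem (r - i) (phi i) (sq p)))
     (\<lambda>p. (if i = r then \<Prod>j=1..r. a j else 0) * (p x * (odd_part p * elem (r - i) (phi 0) (sq p))))"
    if "i \<in> {0..r}" for i
  proof (rule dunkl_maps_chain[where F = "\<lambda>j p. p x * (odd_part p * elem (r - i) (phi j) (sq p))"])
    show "(?R ^^ 2) (\<lambda>p. p x * (odd_part p * elem (r - i) (phi (Suc j)) (sq p)))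
        (\<lambda>p. a (Suc j) * (p x * (odd_part p * elem (r - i) (phi j) (sq p))))" if "j < i" for j
    proof -
      have h: "r - i + Suc j \<le> r" using that \<open>i \<in> {0..r}\<close> by auto
      let ?c = "1 + 2 * real (Suc j) + 2 * (1 + real (Suc j) + real m) * g"
      have "?R (\<lambda>p. ?c * (odd_part p * elem (r - i) (phi (Suc j)) (sq p)))
         (\<lambda>p. ?c * ((2 * lower_coeff (Suc j)) * (p x * (odd_part p * elem (r - i) (phi j) (sq p)))))"
        using dunkl_maps_cmult[OF maps_B1[OF h], of ?c] by (simp only: diff_Suc_1)
      from relcomppI[where r = ?R and s = ?R, OF maps_B2[OF h] this]
      have "(?R OO ?R) (\<lambda>p. p x * (odd_part p * elem (r - i) (phi (Suc j)) (sq p)))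
        (\<lambda>p. ?c * (2 * lower_coeff (Suc j) * (p x * (odd_part p * elem (r - i) (phi j) (sq p)))))" .
      moreover have c: "?c * (2 * lower_coeff (Suc j) * u) = a (Suc j) * u" for u
        by (simp add: a_def)
      ultimately show ?thesis unfolding c by (simp add: numeral_2_eq_2 eq_OO)
    qed
    show "(?R ^^ 2) (\<lambda>p. p x * (odd_part p * elem (r - i) (phi 0) (sq p))) (\<lambda>p. 0)"
    proof -
      have h: "r - i + 0 \<le> r" by simp
      from relcomppI[where r = ?R and s = ?R, OF maps_B2[OF h] dunkl_maps_cmult[OF maps_B1[OF h]]]
      show ?thesis by (simp add: numeral_2_eq_2 eq_OO lower_coeff_def)
    qed
  qed (use that in auto)
  hence "(?R ^^ (2 * r)) (\<lambda>p. \<Sum>i=0..r. p x * (odd_part p * elem (r - i) (phi i) (sq p)))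
     (\<lambda>p. \<Sum>i=0..r. (if i = r then \<Prod>j=1..r. a j else 0) * (p x * (odd_part p * elem (r - i) (phi 0) (sq p))))"
    by (intro dunkl_maps_power_sum) auto
  moreover have "(\<Sum>i=0..r. p x * (odd_part p * elem (r - i) (phi i) (sq p)))
      = p x * (odd_part p * vandermonde (insert x Y) (sq p))" for p
    by (subst vandermonde_decomposition) (auto simp: cardY sum_distrib_left)
  moreover have "(\<Sum>i=0..r. (if i = r then \<Prod>j=1..r. a j else 0) * (p x * (odd_part p * elem (r - i) (phi 0) (sq p))))
     = (\<Prod>j=1..r. a j) * (p x * (odd_part p * elem 0 (phi 0) (sq p)))" for p
  proof -
    have "(\<Sum>i=0..r. (if i = r then \<Prod>j=1..r. a j else 0) * (p x * (odd_part p * elem (r - i) (phi 0) (sq p))))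
      = (\<Sum>i=0..r. if i = r then (\<Prod>j=1..r. a j) * (p x * (odd_part p * elem (r - i) (phi 0) (sq p))) else 0)"
      by (intro sum.cong) auto
    thus ?thesis by simp
  qed
  ultimately have "(?R ^^ (2 * r)) (\<lambda>p. p x * (odd_part p * vandermonde (insert x Y) (sq p)))
     (\<lambda>p. (\<Prod>j=1..r. a j) * (p x * (odd_part p * elem 0 (phi 0) (sq p))))" by simp
  moreover have "?R (\<lambda>p. (\<Prod>j=1..r. a j) * (p x * (odd_part p * elem 0 (phi 0) (sq p))))
     (\<lambda>p. (\<Prod>j=1..r. a j) * ((1 + 2 * (1 + real m) * g) * (odd_part p * vandermonde Y (sq p))))"
    using dunkl_maps_cmult[OF maps_B2[of 0 0], of "\<Prod>j=1..r. a j"] unfolding elem_0_phi_0 by simp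
  ultimately show ?thesis
    using relpowp_Suc_I[where P = ?R] by (simp add: a_def mult.assoc)
qed

end

section \<open>Gaussian integrals of polynomials\<close>

abbreviation std_gauss :: "real measure" where
  "std_gauss \<equiv> density lborel (\<lambda>x. ennreal (std_normal_density x))"

interpretation std_gauss: prob_space std_gauss
  by (rule prob_space_normal_density) simp

interpretation gauss_product: product_sigma_finite "\<lambda>_::nat. std_gauss"
  by standard

text \<open>The density is a product of standard normal densities. In product form, Fubini and the
  invariance under reflections reduce to single coordinates.\<close>

lemma gaussian_measure_eq_PiM: "gaussian_measure n = (\<Pi>\<^sub>M i\<in>{1..n}. std_gauss)"
proof (rule gauss_product.PiM_eqI)
  interpret L: product_sigma_finite "\<lambda>_::nat. lborel :: real measure" by standard
  let ?L = "\<Pi>\<^sub>M i\<in>{1..n}. (lborel :: real measure)"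
  let ?d = "\<lambda>x. ennreal ((2 * pi) powr (- real n / 2) * (\<Prod>i=1..n. exp (- (x i)\<^sup>2 / 2)))"
  have dens: "?d x = (\<Prod>i=1..n. ennreal (std_normal_density (x i)))" for x
  proof -
    have "(1 / sqrt (2 * pi)) ^ n = (2 * pi) powr (- real n / 2)"
      by (simp add: powr_half_sqrt[symmetric] powr_minus_divide power_one_over powr_powr
          flip: powr_realpow)
    hence "(2 * pi) powr (- real n / 2) * (\<Prod>i=1..n. exp (- (x i)\<^sup>2 / 2))
        = (\<Prod>i=1..n. std_normal_density (x i))"
      unfolding std_normal_density_def prod.distrib by simp
    thus ?thesis by (simp add: prod_ennreal)
  qed
  show "sets (gaussian_measure n) = sets (\<Pi>\<^sub>M i\<in>{1..n}. std_gauss)"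
    unfolding gaussian_measure_def sets_density by (intro sets_PiM_cong) auto
  fix A :: "nat \<Rightarrow> real set" assume A: "\<And>i. i \<in> {1..n} \<Longrightarrow> A i \<in> sets std_gauss"
  have A': "A i \<in> sets borel" if "i \<in> {1..n}" for i using A[OF that] by simp
  have box: "Pi\<^sub>E {1..n} A \<in> sets ?L"
    using A' by (intro sets_PiM_I_finite) auto
  have "emeasure (gaussian_measure n) (Pi\<^sub>E {1..n} A) = (\<integral>\<^sup>+x. ?d x * indicator (Pi\<^sub>E {1..n} A) x \<partial>?L)"
    unfolding gaussian_measure_def by (intro emeasure_density box) measurable
  also have "\<dots> = (\<integral>\<^sup>+x. (\<Prod>i\<in>{1..n}. ennreal (std_normal_density (x i)) * indicator (A i) (x i)) \<partial>?L)"
  proof (rule nn_integral_cong)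
    fix x assume x: "x \<in> space ?L"
    have "indicator (Pi\<^sub>E {1..n} A) x = (\<Prod>i\<in>{1..n}. indicator (A i) (x i) :: ennreal)"
    proof (cases "x \<in> Pi\<^sub>E {1..n} A")
      case False
      then obtain i where "i \<in> {1..n}" "x i \<notin> A i" using x by (auto simp: space_PiM PiE_iff)
      hence "(\<Prod>i\<in>{1..n}. indicator (A i) (x i) :: ennreal) = 0" by (intro prod_zero bexI[of _ i]) auto
      thus ?thesis using False by simp
    next
      case True
      hence "(\<Prod>i\<in>{1..n}. indicator (A i) (x i) :: ennreal) = 1"
        by (intro prod.neutral) (auto simp: PiE_iff)
      thus ?thesis using True by simp
    qed
    thus "?d x * indicator (Pi\<^sub>E {1..n} A) x
       = (\<Prod>i\<in>{1..n}. ennreal (std_normal_density (x i)) * indicator (A i) (x i))"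
      unfolding dens prod.distrib by simp
  qed
  also have "\<dots> = (\<Prod>i\<in>{1..n}. \<integral>\<^sup>+t. ennreal (std_normal_density t) * indicator (A i) t \<partial>lborel)"
    using A' by (intro L.product_nn_integral_prod) auto
  also have "\<dots> = (\<Prod>i\<in>{1..n}. emeasure std_gauss (A i))"
    using A' by (intro prod.cong refl emeasure_density[symmetric]) auto
  finally show "emeasure (gaussian_measure n) (Pi\<^sub>E {1..n} A) = (\<Prod>i\<in>{1..n}. emeasure std_gauss (A i))" .
qed simp

interpretation gaussian: prob_space "gaussian_measure n" for n
  unfolding gaussian_measure_eq_PiM by (intro prob_space_PiM std_gauss.prob_space_axioms)

section \<open>Integrability of polynomials and negligible sets\<close>

lemma measurable_gaussian_component:
  "i \<in> {1..n} \<Longrightarrow> (\<lambda>p. p i) \<in> borel_measurable (gaussian_measure n)"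
  unfolding gaussian_measure_def by measurable

lemma integrable_std_gauss_power: "integrable std_gauss (\<lambda>t. t ^ k)"
  using integrable_std_normal_moment[of k]
  by (subst integrable_density) auto

lemma measurable_poly_less:
  "poly_less n d f \<Longrightarrow> f \<in> borel_measurable (gaussian_measure n)"
proof (induction rule: poly_less.induct)
  case (coord i d f)
  thus ?case by (intro borel_measurable_times measurable_gaussian_component)
qed auto

text \<open>The monomial in front strengthens the induction: a coordinate factor of the polynomial
  is absorbed into the exponents.\<close>

lemma integrable_poly_less_monomial:
  assumes "poly_less n d f"
  shows "integrable (gaussian_measure n) (\<lambda>p. (\<Prod>i=1..n. p i ^ \<alpha> i) * f p)"
  using assms
proof (induction arbitrary: \<alpha> rule: poly_less.induct)
  case (zero d)
  show ?case by simp
next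
  case (const d c \<alpha>)
  have "integrable (gaussian_measure n) (\<lambda>p. \<Prod>i=1..n. p i ^ \<alpha> i)" for \<alpha>
    unfolding gaussian_measure_eq_PiM
    by (intro gauss_product.product_integrable_prod integrable_std_gauss_power) auto
  thus ?case by simp
next
  case (coord i d f \<alpha>)
  have "(\<Prod>j=1..n. p j ^ (\<alpha>(i := Suc (\<alpha> i))) j) = (\<Prod>j=1..n. p j ^ \<alpha> j) * p i" for p :: "nat \<Rightarrow> real"
  proof -
    have "(\<Prod>j=1..n. p j ^ (\<alpha>(i := Suc (\<alpha> i))) j) = (\<Prod>j=1..n. p j ^ \<alpha> j * (if j = i then p j else 1))"
      by (intro prod.cong) auto
    thus ?thesis using coord(1) by (simp add: prod.distrib)
  qed
  thus ?case using coord.IH[of "\<alpha>(i := Suc (\<alpha> i))"] by (simp add: mult.assoc)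
next
  case (add d f h \<alpha>)
  thus ?case by (simp add: distrib_left)
qed

lemma integrable_poly_less: "poly_less n d f \<Longrightarrow> integrable (gaussian_measure n) f"
  using integrable_poly_less_monomial[of n d f "\<lambda>_. 0"] by simp

lemma abs_le_one_plus_square: "\<bar>u\<bar> \<le> 1 + u\<^sup>2" for u :: real
  using zero_le_power2[of "\<bar>u\<bar> - 1"] zero_le_power2[of u] by (simp add: power2_diff)

text \<open>A polynomial majorant for real powers: the base 1 + u^2 is at least 1, so its exponent
  may be rounded up to a natural number.\<close>

lemma abs_powr_le:
  fixes u a :: real
  assumes "a \<ge> 0"
  shows "\<bar>u\<bar> powr a \<le> (1 + u\<^sup>2) ^ nat \<lceil>a\<rceil>"
proof -
  have "\<bar>u\<bar> powr a \<le> (1 + u\<^sup>2) powr a"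
    using assms abs_le_one_plus_square[of u] by (intro powr_mono2) auto
  also have "\<dots> \<le> (1 + u\<^sup>2) powr real (nat \<lceil>a\<rceil>)"
    by (intro powr_mono real_nat_ceiling_ge) auto
  also have "\<dots> = (1 + u\<^sup>2) ^ nat \<lceil>a\<rceil>"
    by (intro powr_realpow) (auto intro: add_pos_nonneg)
  finally show ?thesis .
qed

lemma poly_less_one_plus_square:
  assumes "poly_less n d f" shows "poly_less n (Suc (2 * d)) (\<lambda>p. 1 + (f p)\<^sup>2)"
  using poly_less_power[OF poly_less_Suc[OF assms], of 2]
  by (intro poly_less.add poly_less.const) (auto simp: numeral_2_eq_2)

lemma integrable_poly_powr:
  assumes f: "poly_less n d f" and h: "poly_less n e h" and "a \<ge> 0"
  shows "integrable (gaussian_measure n) (\<lambda>p. f p * \<bar>h p\<bar> powr a)"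
proof (rule Bochner_Integration.integrable_bound)
  show "integrable (gaussian_measure n) (\<lambda>p. (1 + (f p)\<^sup>2) * (1 + (h p)\<^sup>2) ^ nat \<lceil>a\<rceil>)"
    by (rule integrable_poly_less[OF poly_less_mult[OF poly_less_one_plus_square[OF f]
        poly_less_power[OF poly_less_one_plus_square[OF h]]]])
  show "(\<lambda>p. f p * \<bar>h p\<bar> powr a) \<in> borel_measurable (gaussian_measure n)"
    using measurable_poly_less[OF f] measurable_poly_less[OF h] by measurable
  show "AE p in gaussian_measure n. norm (f p * \<bar>h p\<bar> powr a) \<le> norm ((1 + (f p)\<^sup>2) * (1 + (h p)\<^sup>2) ^ nat \<lceil>a\<rceil>)"
    using assms(3) by (auto simp: abs_mult intro!: mult_mono abs_le_one_plus_square abs_powr_le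
        order_trans[OF abs_le_one_plus_square abs_ge_self] order_trans[OF abs_powr_le abs_ge_self])
qed

text \<open>Fubini with the coordinate \<open>i\<close> innermost: each line meets the exceptional
  set in finitely many points, a null set for the normal distribution.\<close>

lemma AE_gaussian_coord:
  assumes i: "i \<in> {1..n}" and B: "Measurable.pred (gaussian_measure n) Q"
    and fin: "\<And>p. finite {t. \<not> Q (p(i := t))}"
  shows "AE p in gaussian_measure n. Q p"
proof -
  let ?I = "{1..n} - {i}"
  have ins: "insert i ?I = {1..n}" using i by auto
  have m: "(\<lambda>p. indicator {p. \<not> Q p} p :: ennreal) \<in> borel_measurable (gaussian_measure n)"
    using B by measurable
  have "(\<integral>\<^sup>+p. indicator {p. \<not> Q p} p \<partial>gaussian_measure n)
     = (\<integral>\<^sup>+p. (\<integral>\<^sup>+t. indicator {p. \<not> Q p} (p(i := t)) \<partial>std_gauss) \<partial>(\<Pi>\<^sub>M i\<in>?I. std_gauss))"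
    using gauss_product.product_nn_integral_insert[of ?I i "indicator {p. \<not> Q p}"] m
    unfolding gaussian_measure_eq_PiM ins by simp
  moreover have "(\<integral>\<^sup>+t. indicator {p. \<not> Q p} (p(i := t)) \<partial>std_gauss) = 0" for p
  proof -
    have "{t. \<not> Q (p(i := t))} \<in> null_sets lborel"
      using fin[of p] by (intro finite_imp_null_set_lborel)
    hence "emeasure std_gauss {t. \<not> Q (p(i := t))} = 0"
      by (auto simp: emeasure_density null_sets_def intro!: nn_integral_null_set)
    moreover have "{t. \<not> Q (p(i := t))} \<in> sets std_gauss"
      using fin[of p] by (simp add: finite_imp_closed)
    ultimately have "(\<integral>\<^sup>+t. indicator {t. \<not> Q (p(i := t))} t \<partial>std_gauss) = 0"
      by (simp only: nn_integral_indicator)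
    thus ?thesis by (simp add: indicator_def)
  qed
  ultimately have "(\<integral>\<^sup>+p. indicator {p. \<not> Q p} p \<partial>gaussian_measure n) = 0"
    by (simp only: nn_integral_const mult_zero_left)
  hence "AE p in gaussian_measure n. indicator {p. \<not> Q p} p = (0 :: ennreal)"
    using m by (subst (asm) nn_integral_0_iff_AE) auto
  thus ?thesis by (auto simp: indicator_def)
qed

lemma AE_generic_points: "AE p in gaussian_measure n. p \<in> generic_points n"
proof -
  have a: "AE p in gaussian_measure n. p i \<noteq> 0" if i: "i \<in> {1..n}" for i
  proof (rule AE_gaussian_coord[OF i])
    note [measurable] = measurable_gaussian_component[OF i]
    show "Measurable.pred (gaussian_measure n) (\<lambda>p. p i \<noteq> 0)"
      unfolding pred_def by (intro borel_measurable_neq) measurable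
  qed simp
  have b: "AE p in gaussian_measure n. (p i)\<^sup>2 \<noteq> (p j)\<^sup>2" if i: "i \<in> {1..n}" "j \<in> {1..n}" "i \<noteq> j" for i j
  proof (intro AE_gaussian_coord[OF i(1)])
    have [measurable]: "(\<lambda>p. p i) \<in> borel_measurable (gaussian_measure n)"
      "(\<lambda>p. p j) \<in> borel_measurable (gaussian_measure n)" using i by (auto intro: measurable_gaussian_component)
    show "Measurable.pred (gaussian_measure n) (\<lambda>p. (p i)\<^sup>2 \<noteq> (p j)\<^sup>2)"
      unfolding pred_def by (intro borel_measurable_neq) measurable
  next
    fix p :: "nat \<Rightarrow> real"
    have "{t. \<not> ((p(i := t)) i)\<^sup>2 \<noteq> ((p(i := t)) j)\<^sup>2} \<subseteq> {p j, - p j}"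
      using i by (auto simp: power2_eq_iff)
    thus "finite {t. \<not> ((p(i := t)) i)\<^sup>2 \<noteq> ((p(i := t)) j)\<^sup>2}" by (rule finite_subset) auto
  qed
  have "AE p in gaussian_measure n. \<forall>i\<in>{1..n}. p i \<noteq> 0"
    using a by (intro AE_finite_allI) auto
  moreover have "AE p in gaussian_measure n. \<forall>i\<in>{1..n}. \<forall>j\<in>{1..n}. i \<noteq> j \<longrightarrow> (p i)\<^sup>2 \<noteq> (p j)\<^sup>2"
    by (intro AE_finite_allI finite_atLeastAtMost AE_impI b)
  ultimately show ?thesis
    by eventually_elim (auto simp: generic_points_def inj_on_def)
qed

section \<open>Invariance of the Gaussian measure under reflections\<close>

lemma emeasure_std_gauss_scale:
  assumes "s = 1 \<or> s = -1" "A \<in> sets borel"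
  shows "emeasure std_gauss {t. s * t \<in> A} = emeasure std_gauss A"
proof -
  have "emeasure std_gauss {t. - t \<in> A} = emeasure std_gauss A"
  proof -
    have m: "{t. - t \<in> A} \<in> sets borel"
      using measurable_sets[of "\<lambda>t. - t" borel borel A] assms by (simp add: vimage_def)
    have "emeasure std_gauss A = (\<integral>\<^sup>+t. ennreal (std_normal_density t) * indicator A t \<partial>distr lborel borel uminus)"
      using assms by (simp add: emeasure_density lborel_distr_uminus)
    also have "\<dots> = (\<integral>\<^sup>+t. ennreal (std_normal_density (- t)) * indicator A (- t) \<partial>lborel)"
      using assms(2) by (subst nn_integral_distr) auto
    also have "\<dots> = (\<integral>\<^sup>+t. ennreal (std_normal_density t) * indicator {t. - t \<in> A} t \<partial>lborel)"
      by (intro nn_integral_cong) (simp add: std_normal_density_def indicator_def)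
    also have "\<dots> = emeasure std_gauss {t. - t \<in> A}"
      using m by (simp add: emeasure_density)
    finally show ?thesis ..
  qed
  thus ?thesis using assms by auto
qed

lemma measurable_reflect:
  assumes "a \<in> {1..n}" "b \<in> {1..n}"
  shows "reflect s a b \<in> measurable (gaussian_measure n) (gaussian_measure n)"
proof -
  have "(\<lambda>p. \<lambda>i\<in>{1..n}. reflect s a b p i) \<in> measurable (gaussian_measure n) (\<Pi>\<^sub>M i\<in>{1..n}. std_gauss)"
  proof (intro measurable_restrict)
    fix i assume i: "i \<in> {1..n}"
    note [measurable] = measurable_gaussian_component[OF i] measurable_gaussian_component[OF assms(1)]
      measurable_gaussian_component[OF assms(2)]
    show "(\<lambda>p. reflect s a b p i) \<in> measurable (gaussian_measure n) std_gauss"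
      by (cases "i = b"; cases "i = a") (simp_all add: reflect_apply)
  qed
  also have "(\<Pi>\<^sub>M i\<in>{1..n}. std_gauss) = gaussian_measure n" by (rule gaussian_measure_eq_PiM[symmetric])
  finally show ?thesis
    by (rule measurable_cong[THEN iffD1, rotated])
       (use assms in \<open>auto simp: fun_eq_iff gaussian_measure_eq_PiM space_PiM PiE_iff extensional_def reflect_apply\<close>)
qed

text \<open>The reflection permutes the coordinates by \<open>\<sigma>\<close> up to signs
  \<open>c\<close>, both compatible with applying it twice. The preimage of a box is again a box,
  and its sides have the measures of the permuted sides because the normal distribution is
  even.\<close>

lemma distr_reflect:
  assumes ab: "a \<in> {1..n}" "b \<in> {1..n}" and s: "s = 1 \<or> s = -1"
  shows "distr (gaussian_measure n) (gaussian_measure n) (reflect s a b) = gaussian_measure n"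
proof -
  define \<sigma> where "\<sigma> i = (if i = b then a else if i = a then b else i)" for i
  define c where "c i = (if i = a \<or> i = b then s else 1)" for i
  have cs: "c i = 1 \<or> c i = -1" for i using s by (auto simp: c_def)
  have r: "reflect s a b p i = c i * p (\<sigma> i)" for p i by (auto simp: reflect_apply c_def \<sigma>_def)
  have \<sigma>: "\<sigma> (\<sigma> i) = i" "i \<in> {1..n} \<Longrightarrow> \<sigma> i \<in> {1..n}" for i using ab by (auto simp: \<sigma>_def)
  have c\<sigma>: "c (\<sigma> i) = c i" for i by (auto simp: c_def \<sigma>_def)
  have "distr (gaussian_measure n) (gaussian_measure n) (reflect s a b) = (\<Pi>\<^sub>M i\<in>{1..n}. std_gauss)"
  proof (rule gauss_product.PiM_eqI)
    fix A :: "nat \<Rightarrow> real set" assume A: "\<And>i. i \<in> {1..n} \<Longrightarrow> A i \<in> sets std_gauss"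
    have A': "A i \<in> sets borel" if "i \<in> {1..n}" for i using A[OF that] by simp
    define A2 where "A2 i = {t. c i * t \<in> A (\<sigma> i)}" for i
    have A2: "A2 i \<in> sets borel" if "i \<in> {1..n}" for i
    proof -
      have "(\<lambda>t. c i * t) -` A (\<sigma> i) \<inter> space borel \<in> sets borel"
        using A'[OF \<sigma>(2)[OF that]] by (intro measurable_sets) auto
      thus ?thesis by (simp add: A2_def vimage_def)
    qed
    have box: "Pi\<^sub>E {1..n} A \<in> sets (gaussian_measure n)"
      unfolding gaussian_measure_eq_PiM using A by (intro sets_PiM_I_finite) auto
    have pre: "reflect s a b -` Pi\<^sub>E {1..n} A \<inter> space (gaussian_measure n) = Pi\<^sub>E {1..n} A2"
    proof (intro set_eqI iffI)
      fix p assume p: "p \<in> reflect s a b -` Pi\<^sub>E {1..n} A \<inter> space (gaussian_measure n)"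
      have "p i \<in> A2 i" if "i \<in> {1..n}" for i
      proof -
        have "reflect s a b p (\<sigma> i) \<in> A (\<sigma> i)" using p \<sigma>(2)[OF that] by auto
        thus ?thesis unfolding r by (simp add: A2_def \<sigma> c\<sigma>)
      qed
      thus "p \<in> Pi\<^sub>E {1..n} A2" using p by (auto simp: gaussian_measure_eq_PiM space_PiM PiE_iff)
    next
      fix p assume p: "p \<in> Pi\<^sub>E {1..n} A2"
      have "reflect s a b p i \<in> A i" if "i \<in> {1..n}" for i
      proof -
        have "p (\<sigma> i) \<in> A2 (\<sigma> i)" using p \<sigma>(2)[OF that] by auto
        thus ?thesis unfolding r by (simp add: A2_def \<sigma> c\<sigma>)
      qed
      moreover have "reflect s a b p i = undefined" if "i \<notin> {1..n}" for i
        using p that ab by (auto simp: reflect_apply PiE_def extensional_def)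
      ultimately show "p \<in> reflect s a b -` Pi\<^sub>E {1..n} A \<inter> space (gaussian_measure n)"
        using p by (auto simp: gaussian_measure_eq_PiM space_PiM PiE_iff extensional_def)
    qed
    have "emeasure (distr (gaussian_measure n) (gaussian_measure n) (reflect s a b)) (Pi\<^sub>E {1..n} A)
       = emeasure (gaussian_measure n) (Pi\<^sub>E {1..n} A2)"
      unfolding pre[symmetric] by (rule emeasure_distr[OF measurable_reflect[OF ab] box])
    also have "\<dots> = (\<Prod>i\<in>{1..n}. emeasure std_gauss (A2 i))"
      unfolding gaussian_measure_eq_PiM using A2 by (intro gauss_product.emeasure_PiM) auto
    also have "\<dots> = (\<Prod>i\<in>{1..n}. emeasure std_gauss (A (\<sigma> i)))"
      unfolding A2_def using A' \<sigma>(2) cs by (intro prod.cong refl emeasure_std_gauss_scale) auto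
    also have "\<dots> = (\<Prod>i\<in>{1..n}. emeasure std_gauss (A i))"
      by (rule prod.reindex_bij_witness[of _ \<sigma> \<sigma>]) (use \<sigma> in auto)
    finally show "emeasure (distr (gaussian_measure n) (gaussian_measure n) (reflect s a b)) (Pi\<^sub>E {1..n} A)
       = (\<Prod>i\<in>{1..n}. emeasure std_gauss (A i))" .
  qed (simp_all add: gaussian_measure_eq_PiM)
  thus ?thesis by (simp add: gaussian_measure_eq_PiM)
qed

lemma integral_reflect:
  fixes f :: "(nat \<Rightarrow> real) \<Rightarrow> real"
  assumes "a \<in> {1..n}" "b \<in> {1..n}" "s = 1 \<or> s = -1" "f \<in> borel_measurable (gaussian_measure n)"
  shows "(LINT p|gaussian_measure n. f (reflect s a b p)) = (LINT p|gaussian_measure n. f p)"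
  using integral_distr[OF measurable_reflect[OF assms(1,2)] assms(4), of s]
  by (simp add: distr_reflect[OF assms(1-3)])

section \<open>Integration by parts against the Gaussian measure\<close>

lemma integrable_poly_std_normal: "integrable lborel (\<lambda>t. std_normal_density t * poly R t)"
proof -
  have "std_normal_density t * poly R t = (\<Sum>i\<le>degree R. coeff R i * (std_normal_density t * t ^ i))" for t
    by (simp add: poly_altdef sum_distrib_left mult_ac)
  moreover have "integrable lborel (\<lambda>t. \<Sum>i\<le>degree R. coeff R i * (std_normal_density t * t ^ i))"
    using integrable_std_normal_moment by (intro Bochner_Integration.integrable_sum integrable_mult_right) auto
  ultimately show ?thesis by simp
qed

lemma tendsto_poly_std_normal: "((\<lambda>t. std_normal_density t * poly R t) \<longlongrightarrow> 0) at_top"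
proof -
  have "((\<lambda>t. std_normal_density t * t ^ k) \<longlongrightarrow> 0) at_top" for k
  proof (rule tendsto_0_le[where K = "exp (1/2)"])
    show "((\<lambda>t. t ^ k / exp t) \<longlongrightarrow> (0::real)) at_top" by (rule tendsto_power_div_exp_0)
    show "\<forall>\<^sub>F t in at_top. norm (std_normal_density t * t ^ k) \<le> norm (t ^ k / exp t) * exp (1 / 2)"
    proof (rule always_eventually, rule allI)
      fix t :: real
      \<comment> \<open>This is the inequality (t - 1)^2 >= 0, the source of the constant
        \<open>exp (1/2)\<close>.\<close>
      have "- t\<^sup>2 / 2 \<le> 1/2 - t" using zero_le_power2[of "t - 1"] by (simp add: power2_diff)
      hence "exp (- t\<^sup>2 / 2) \<le> exp (1/2) / exp t" by (simp flip: exp_diff)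
      moreover have "1 / sqrt (2 * pi) \<le> 1"
        using pi_gt3 by simp
      ultimately have "std_normal_density t \<le> 1 * (exp (1/2) / exp t)"
        unfolding std_normal_density_def by (intro mult_mono) auto
      hence "std_normal_density t * \<bar>t\<bar> ^ k \<le> exp (1/2) / exp t * \<bar>t\<bar> ^ k"
        by (intro mult_right_mono) auto
      thus "norm (std_normal_density t * t ^ k) \<le> norm (t ^ k / exp t) * exp (1 / 2)"
        by (simp add: abs_mult power_abs mult_ac)
    qed
  qed
  hence "((\<lambda>t. \<Sum>i\<le>degree R. coeff R i * (std_normal_density t * t ^ i)) \<longlongrightarrow> (\<Sum>i\<le>degree R. coeff R i * 0)) at_top"
    by (intro tendsto_intros)
  moreover have "std_normal_density t * poly R t = (\<Sum>i\<le>degree R. coeff R i * (std_normal_density t * t ^ i))" for t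
    by (simp add: poly_altdef sum_distrib_left mult_ac)
  ultimately show ?thesis by simp
qed

lemma tendsto_poly_std_normal_at_bot: "((\<lambda>t. std_normal_density t * poly R t) \<longlongrightarrow> 0) at_bot"
  unfolding filterlim_at_bot_mirror
  using tendsto_poly_std_normal[of "pcompose R [:0, -1:]"]
  by (simp add: poly_pcompose std_normal_density_def)

text \<open>Multiplied by the density, the integrand is the derivative of the density times
  \<open>h\<close>, which tends to 0 at both ends thanks to the polynomial bound.\<close>

lemma std_gauss_integral_by_parts:
  fixes h h' :: "real \<Rightarrow> real"
  assumes h: "\<And>t. (h has_real_derivative h' t) (at t)" and c: "continuous_on UNIV h'"
    and b: "\<And>t. \<bar>h t\<bar> \<le> poly R t" "\<And>t. \<bar>h' t\<bar> \<le> poly R' t"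
  shows "(LINT t|std_gauss. h' t - t * h t) = 0"
proof -
  have ch: "continuous_on UNIV h" using h by (intro continuous_at_imp_continuous_on ballI) (rule DERIV_isCont)
  have b': "\<bar>h' t - t * h t\<bar> \<le> poly (R' + (1 + [:0, 1:]\<^sup>2) * R) t" for t
  proof -
    have "\<bar>h' t - t * h t\<bar> \<le> \<bar>h' t\<bar> + \<bar>t\<bar> * \<bar>h t\<bar>" by (metis abs_mult abs_triangle_ineq4)
    also have "\<dots> \<le> poly R' t + (1 + t\<^sup>2) * poly R t"
      by (intro add_mono mult_mono b abs_le_one_plus_square) auto
    finally show ?thesis by simp
  qed
  define k where "k t = std_normal_density t * (h' t - t * h t)" for t
  have H: "((\<lambda>t. std_normal_density t * h t) has_vector_derivative k t) (at t)" for t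
  proof -
    have "((\<lambda>t. std_normal_density t) has_real_derivative std_normal_density t * (- t)) (at t)"
    proof -
      have "((\<lambda>t. exp (- t\<^sup>2 / 2)) has_real_derivative exp (- t\<^sup>2 / 2) * (- t)) (at t)"
        by (auto intro!: derivative_eq_intros)
      from DERIV_cmult[OF this, of "1 / sqrt (2 * pi)"] show ?thesis
        unfolding std_normal_density_def by (simp only: mult.assoc)
    qed
    from DERIV_mult[OF this h[of t]] show ?thesis
      unfolding has_real_derivative_iff_has_vector_derivative[symmetric] k_def
      by (rule DERIV_cong) (simp add: algebra_simps)
  qed
  have ck: "continuous_on UNIV k"
    unfolding k_def std_normal_density_def by (intro continuous_intros c ch) auto
  have ik: "integrable lborel k"
  proof (rule Bochner_Integration.integrable_bound)
    show "integrable lborel (\<lambda>t. std_normal_density t * poly (R' + (1 + [:0, 1:]\<^sup>2) * R) t)"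
      by (rule integrable_poly_std_normal)
    show "k \<in> borel_measurable lborel"
      using ck by (simp add: borel_measurable_continuous_onI)
    show "AE t in lborel. norm (k t) \<le> norm (std_normal_density t * poly (R' + (1 + [:0, 1:]\<^sup>2) * R) t)"
      using b' by (auto simp: k_def abs_mult intro!: mult_left_mono order_trans[OF _ abs_ge_self])
  qed
  have lim: "((\<lambda>t. std_normal_density t * h t) \<longlongrightarrow> 0) F"
    if "((\<lambda>t. std_normal_density t * poly R t) \<longlongrightarrow> 0) F" for F
    by (rule tendsto_0_le[OF that, of _ 1])
       (auto intro!: always_eventually simp: abs_mult intro!: mult_left_mono order_trans[OF b(1) abs_ge_self])
  have "(LBINT t=-\<infinity>..\<infinity>. k t) = 0 - 0"
  proof (rule interval_integral_FTC_integrable)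
    show "set_integrable lborel (einterval (-\<infinity>) \<infinity>) k"
      using ik by (simp add: set_integrable_def einterval_def)
    show "isCont k t" for t using ck by (simp add: continuous_on_eq_continuous_at)
    show "((\<lambda>t. std_normal_density t * h t) has_vector_derivative k t) (at t)" for t by (rule H)
    show "(((\<lambda>t. std_normal_density t * h t) \<circ> real_of_ereal) \<longlongrightarrow> 0) (at_right (-\<infinity>))"
      using lim[OF tendsto_poly_std_normal_at_bot] by (simp add: ereal_tendsto_simps)
    show "(((\<lambda>t. std_normal_density t * h t) \<circ> real_of_ereal) \<longlongrightarrow> 0) (at_left \<infinity>)"
      using lim[OF tendsto_poly_std_normal] by (simp add: ereal_tendsto_simps)
  qed simp
  hence "(LINT t|lborel. k t) = 0"
    by (simp add: interval_lebesgue_integral_def set_lebesgue_integral_def einterval_def)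
  moreover have "(LINT t|std_gauss. h' t - t * h t) = (LINT t|lborel. std_normal_density t *\<^sub>R (h' t - t * h t))"
  proof (intro integral_density)
    show "(\<lambda>t. h' t - t * h t) \<in> borel_measurable lborel"
      using c ch by (simp, intro borel_measurable_continuous_onI continuous_intros)
  qed auto
  ultimately show ?thesis by (simp add: k_def[abs_def])
qed

text \<open>Written as t times a power of its absolute value, the derivative needs no sign function
  and no case at 0. Since \<open>c > 2\<close>, the remaining exponent is positive; with
  \<open>c = 2 * g\<close> this is the condition \<open>g > 1\<close>.\<close>

lemma abs_powr_has_real_derivative:
  fixes c t :: real
  assumes "c > 2"
  shows "((\<lambda>t. \<bar>t\<bar> powr c) has_real_derivative c * (t * \<bar>t\<bar> powr (c - 2))) (at t)"
proof -
  consider "t > 0" | "t < 0" | "t = 0" by linarith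
  thus ?thesis
  proof cases
    case 1
    have "t powr (c - 1) = t * t powr (c - 2)" using 1 by (simp add: powr_diff field_simps power2_eq_square)
    hence "((\<lambda>t. t powr c) has_real_derivative c * (t * \<bar>t\<bar> powr (c - 2))) (at t)"
      using has_real_derivative_powr[OF 1, of c] 1 by simp
    moreover have "\<forall>\<^sub>F u in nhds t. u powr c = \<bar>u\<bar> powr c"
      using eventually_nhds_in_open[of "{0<..}" t] 1 by (auto elim: eventually_mono)
    ultimately show ?thesis by (subst DERIV_cong_ev[OF refl _ refl, symmetric])
  next
    case 2
    have "(- t) powr (c - 1) = (- t) * (- t) powr (c - 2)" using 2 by (simp add: powr_diff field_simps power2_eq_square)
    moreover have "((\<lambda>t. (- t) powr c) has_real_derivative c * (- t) powr (c - 1) * (- 1)) (at t)"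
      by (rule DERIV_chain2[OF has_real_derivative_powr]) (use 2 in \<open>auto intro!: derivative_eq_intros\<close>)
    ultimately have "((\<lambda>t. (- t) powr c) has_real_derivative c * (t * \<bar>t\<bar> powr (c - 2))) (at t)"
      using 2 by simp
    moreover have "\<forall>\<^sub>F u in nhds t. (- u) powr c = \<bar>u\<bar> powr c"
      using eventually_nhds_in_open[of "{..<0}" t] 2 by (auto elim: eventually_mono)
    ultimately show ?thesis by (subst DERIV_cong_ev[OF refl _ refl, symmetric])
  next
    case 3
    have "((\<lambda>h. \<bar>h\<bar> powr (c - 1)) \<longlongrightarrow> 0) (at (0::real))"
      using assms by (auto intro!: tendsto_eq_intros)
    hence "((\<lambda>h. \<bar>h\<bar> powr c / h) \<longlongrightarrow> 0) (at (0::real))"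
      by (rule tendsto_0_le[of _ _ _ 1])
         (auto simp: powr_diff eventually_at_filter)
    thus ?thesis using 3 by (simp add: DERIV_def)
  qed
qed

lemma poly_less_slice: "poly_less n d f \<Longrightarrow> \<exists>q. \<forall>t. f (p(x := t)) = poly q t"
proof (induction rule: poly_less.induct)
  case (coord i d f)
  then obtain q where q: "\<And>t. f (p(x := t)) = poly q t" by blast
  have "\<forall>t. (p(x := t)) i * f (p(x := t)) = poly ((if i = x then [:0, 1:] else [:p i:]) * q) t"
    unfolding q by auto
  thus ?case by blast
next
  case (add d f g)
  then obtain q r where "\<And>t. f (p(x := t)) = poly q t" "\<And>t. g (p(x := t)) = poly r t" by blast
  hence "\<forall>t. f (p(x := t)) + g (p(x := t)) = poly (q + r) t" by simp
  thus ?case by blast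
next
  case (zero d)
  show ?case by (rule exI[of _ 0]) simp
next
  case (const d c)
  show ?case by (rule exI[of _ "[:c:]"]) simp
qed

text \<open>On each line in direction \<open>x\<close> the functions are ordinary polynomials, which
  supply the growth bounds. The inner integral of the difference of both sides vanishes on every
  such line, and Fubini concludes.\<close>

lemma gaussian_integral_by_parts:
  assumes x: "x \<in> {1..n}" and c: "c > 2"
    and f: "poly_less n d f" "poly_less n d' f'"
      "\<And>p. ((\<lambda>t. f (p(x := t))) has_real_derivative f' p) (at (p x))"
    and P: "poly_less n e P" "poly_less n e' P'"
      "\<And>p. ((\<lambda>t. P (p(x := t))) has_real_derivative P' p) (at (p x))"
  shows "(LINT p|gaussian_measure n. p x * f p * \<bar>P p\<bar> powr c)
    = (LINT p|gaussian_measure n. f' p * \<bar>P p\<bar> powr c + c * (f p * P p * P' p * \<bar>P p\<bar> powr (c - 2)))"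
proof -
  define H where "H p = f' p * \<bar>P p\<bar> powr c + c * (f p * P p * P' p * \<bar>P p\<bar> powr (c - 2))
      - p x * f p * \<bar>P p\<bar> powr c" for p
  have Suc: "poly_less n (Suc d) f" "poly_less n (Suc e) P" "poly_less n (Suc e') P'"
    using f P by (auto intro: poly_less_Suc)
  have i1: "integrable (gaussian_measure n) (\<lambda>p. p x * f p * \<bar>P p\<bar> powr c)"
    using c by (intro integrable_poly_powr[OF poly_less.coord[OF x f(1)] P(1)]) auto
  have i2: "integrable (gaussian_measure n) (\<lambda>p. f' p * \<bar>P p\<bar> powr c + c * (f p * P p * P' p * \<bar>P p\<bar> powr (c - 2)))"
    using c by (intro Bochner_Integration.integrable_add integrable_mult_right integrable_poly_powr[OF f(2) P(1)]
        integrable_poly_powr[OF poly_less_mult[OF poly_less_mult[OF Suc(1) Suc(2)] Suc(3)] P(1)]) auto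
  have iH: "integrable (gaussian_measure n) H"
    unfolding H_def[abs_def] by (rule Bochner_Integration.integrable_diff[OF i2 i1])
  let ?I = "{1..n} - {x}"
  have ins: "insert x ?I = {1..n}" using x by auto
  have inner: "(LINT t|std_gauss. H (p(x := t))) = 0" for p
  proof -
    obtain q where q: "\<And>t. f (p(x := t)) = poly q t" using poly_less_slice[OF f(1)] by metis
    obtain Q where Q: "\<And>t. P (p(x := t)) = poly Q t" using poly_less_slice[OF P(1)] by metis
    have q': "f' (p(x := t)) = poly (pderiv q) t" for t
      using f(3)[of "p(x := t)"] by (simp add: q) (metis DERIV_unique poly_DERIV)
    have Q': "P' (p(x := t)) = poly (pderiv Q) t" for t
      using P(3)[of "p(x := t)"] by (simp add: Q) (metis DERIV_unique poly_DERIV)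
    define h where "h t = poly q t * \<bar>poly Q t\<bar> powr c" for t
    define h' where "h' t = poly (pderiv q) t * \<bar>poly Q t\<bar> powr c
       + c * (poly q t * poly Q t * poly (pderiv Q) t * \<bar>poly Q t\<bar> powr (c - 2))" for t
    have "(h has_real_derivative h' t) (at t)" for t
    proof -
      have "((\<lambda>t. \<bar>poly Q t\<bar> powr c) has_real_derivative
          c * (poly Q t * \<bar>poly Q t\<bar> powr (c - 2)) * poly (pderiv Q) t) (at t)"
        by (rule DERIV_chain2[OF abs_powr_has_real_derivative[OF c] poly_DERIV])
      from DERIV_mult[OF poly_DERIV this] show ?thesis unfolding h_def[abs_def] h'_def
        by (rule DERIV_cong) (simp add: mult_ac)
    qed
    moreover have "continuous_on UNIV h'"
      unfolding h'_def[abs_def] using c by (intro continuous_intros continuous_on_powr') auto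
    moreover have "\<bar>h t\<bar> \<le> poly ((1 + q\<^sup>2) * (1 + Q\<^sup>2) ^ nat \<lceil>c\<rceil>) t" for t
      using c by (auto simp: h_def abs_mult intro!: mult_mono abs_le_one_plus_square abs_powr_le)
    moreover have "\<bar>h' t\<bar> \<le> poly ((1 + (pderiv q)\<^sup>2) * (1 + Q\<^sup>2) ^ nat \<lceil>c\<rceil>
       + [:c:] * ((1 + q\<^sup>2) * (1 + Q\<^sup>2) * (1 + (pderiv Q)\<^sup>2) * (1 + Q\<^sup>2) ^ nat \<lceil>c - 2\<rceil>)) t" for t
    proof -
      have a: "\<bar>poly Q t\<bar> powr c \<le> (1 + (poly Q t)\<^sup>2) ^ nat \<lceil>c\<rceil>"
        "\<bar>poly Q t\<bar> powr (c - 2) \<le> (1 + (poly Q t)\<^sup>2) ^ nat \<lceil>c - 2\<rceil>"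
        using c by (auto intro!: abs_powr_le simp del: ceiling_diff_numeral)
      have "\<bar>h' t\<bar> \<le> \<bar>poly (pderiv q) t * \<bar>poly Q t\<bar> powr c\<bar>
        + \<bar>c * (poly q t * poly Q t * poly (pderiv Q) t * \<bar>poly Q t\<bar> powr (c - 2))\<bar>"
        unfolding h'_def by (rule abs_triangle_ineq)
      also have "\<dots> \<le> (1 + (poly (pderiv q) t)\<^sup>2) * (1 + (poly Q t)\<^sup>2) ^ nat \<lceil>c\<rceil>
       + c * ((1 + (poly q t)\<^sup>2) * (1 + (poly Q t)\<^sup>2) * (1 + (poly (pderiv Q) t)\<^sup>2) * (1 + (poly Q t)\<^sup>2) ^ nat \<lceil>c - 2\<rceil>)"
        using c unfolding abs_mult
        by (intro add_mono mult_mono abs_le_one_plus_square) (use a in auto)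
      finally show ?thesis by simp
    qed
    ultimately have "(LINT t|std_gauss. h' t - t * h t) = 0" by (rule std_gauss_integral_by_parts)
    thus ?thesis by (simp add: H_def q Q q' Q' h_def h'_def mult.assoc)
  qed
  have "(LINT p|gaussian_measure n. H p) = 0"
    using gauss_product.product_integral_insert[of ?I x H] iH
    unfolding gaussian_measure_eq_PiM ins by (simp add: inner)
  thus ?thesis unfolding H_def[abs_def] using i1 i2 by simp
qed

section \<open>The ratio of consecutive integrals\<close>

lemma index_pairs_alt:
  "index_pairs m n = {(i, j). i \<in> {Suc m..n} \<and> j \<in> {Suc m..n} \<and> i < j}"
  by (auto simp: index_pairs_def)

lemma forms_prod_A: "forms_prod TypeA m n p = vandermonde {Suc m..n} p"
  by (simp add: index_pairs_alt vandermonde_def)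

lemma forms_prod_D: "forms_prod TypeD m n p = vandermonde {Suc m..n} (sq p)"
  by (simp add: index_pairs_alt vandermonde_def sq_def power2_eq_square algebra_simps)

lemma forms_prod_B:
  "forms_prod TypeB m n p = sqrt 2 ^ (n - m) * (\<Prod>i=Suc m..n. p i) * vandermonde {Suc m..n} (sq p)"
  unfolding forms_prod_D[symmetric] by (simp add: prod.distrib)

text \<open>The number of mirrors that involve one coordinate when \<open>i\<close> further
  coordinates are present. For \<open>i = r\<close> it is the number of Dunkl operators needed to
  pass from one product of forms to the next.\<close>

fun step_degree :: "refl_type \<Rightarrow> nat \<Rightarrow> nat" where
  "step_degree TypeA i = i"
| "step_degree TypeB i = 2 * i + 1"
| "step_degree TypeD i = 2 * i"

definition forms_degree :: "refl_type \<Rightarrow> nat \<Rightarrow> nat" where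
  "forms_degree T c = (\<Sum>i<c. step_degree T i)"

lemma forms_degree_A: "forms_degree TypeA c = \<Sum>{..<c}"
  by (simp add: forms_degree_def)

lemma forms_degree_D: "forms_degree TypeD c = 2 * \<Sum>{..<c}"
  by (simp add: forms_degree_def sum_distrib_left)

lemma forms_degree_B: "forms_degree TypeB c = c + 2 * \<Sum>{..<c}"
  by (induction c) (simp_all add: forms_degree_def)

lemma poly_less_forms_prod: "poly_less n (Suc (forms_degree T (n - m))) (forms_prod T m n)"
proof -
  have c: "poly_less n (Suc 1) (\<lambda>p. p i)" if "i \<in> {Suc m..n}" for i
    using poly_less_coord[of i n 0] that by simp
  have s: "poly_less n (Suc 2) (\<lambda>p. sq p i)" if "i \<in> {Suc m..n}" for i
    using poly_less_power[OF c[OF that], of 2] by (simp add: sq_def[abs_def])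
  have v: "poly_less n (Suc (2 * \<Sum>{..<n - m})) (\<lambda>p. vandermonde {Suc m..n} (sq p))"
    using poly_less_vandermonde[of "{Suc m..n}" n 2 sq] s by simp
  show ?thesis
  proof (cases T)
    case TypeA
    have "poly_less n (Suc (1 * \<Sum>{..<card {Suc m..n}})) (\<lambda>p. vandermonde {Suc m..n} p)"
      by (rule poly_less_vandermonde[where f = "\<lambda>p. p"]) (use c in auto)
    moreover have "forms_prod TypeA m n = (\<lambda>p. vandermonde {Suc m..n} p)"
      by (rule ext) (rule forms_prod_A)
    ultimately show ?thesis unfolding TypeA forms_degree_A by simp
  next
    case TypeD
    have "forms_prod TypeD m n = (\<lambda>p. vandermonde {Suc m..n} (sq p))"
      by (rule ext) (rule forms_prod_D)
    thus ?thesis using v unfolding TypeD forms_degree_D by simp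
  next
    case TypeB
    have "poly_less n (Suc (card {Suc m..n} * 1)) (\<lambda>p. \<Prod>i=Suc m..n. p i)"
      using c by (intro poly_less_prod) auto
    from poly_less_cmult[OF poly_less_mult[OF this v], of "sqrt 2 ^ (n - m)"]
    have "poly_less n (Suc (n - m) + 2 * \<Sum>{..<n - m})
       (\<lambda>p. sqrt 2 ^ (n - m) * ((\<Prod>i=Suc m..n. p i) * vandermonde {Suc m..n} (sq p)))" by simp
    moreover have "forms_prod TypeB m n
        = (\<lambda>p. sqrt 2 ^ (n - m) * ((\<Prod>i=Suc m..n. p i) * vandermonde {Suc m..n} (sq p)))"
      by (rule ext) (simp only: forms_prod_B mult.assoc)
    ultimately show ?thesis unfolding TypeB forms_degree_B by simp
  qed
qed

lemma measurable_forms_prod: "forms_prod T m n \<in> borel_measurable (gaussian_measure n)"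
  by (rule measurable_poly_less[OF poly_less_forms_prod])

lemma prod_reflect:
  assumes "finite B" "a \<in> B" "b \<in> B" "a \<noteq> b" "s = 1 \<or> s = -1"
  shows "(\<Prod>i\<in>B. reflect s a b p i) = (\<Prod>i\<in>B. p i)"
proof -
  have "(\<Prod>i\<in>B - {a} - {b}. reflect s a b p i) = (\<Prod>i\<in>B - {a} - {b}. p i)"
    by (intro prod.cong) (auto simp: reflect_apply)
  moreover have "prod q B = q a * (q b * prod q (B - {a} - {b}))" for q :: "nat \<Rightarrow> real"
    using assms by (subst prod.remove[of B a]; (subst prod.remove[of "B - {a}" b])?) auto
  ultimately show ?thesis using assms(4,5) by (auto simp: reflect_apply)
qed

lemma prod_reflect_self:
  assumes "finite B" "a \<in> B"
  shows "(\<Prod>i\<in>B. reflect s a a p i) = s * (\<Prod>i\<in>B. p i)"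
proof -
  have "(\<Prod>i\<in>B - {a}. reflect s a a p i) = (\<Prod>i\<in>B - {a}. p i)"
    by (intro prod.cong) (auto simp: reflect_apply)
  thus ?thesis using assms by (simp add: prod.remove[of B a] reflect_apply)
qed

lemma sq_reflect_self: "s = 1 \<or> s = -1 \<Longrightarrow> sq (reflect s a a p) = sq p"
  by (auto simp: sq_def fun_eq_iff reflect_apply)

lemma forms_prod_reflect:
  assumes "(s, b) \<in> mirrors T n a" "a \<in> {Suc m..n}" "b \<in> {Suc m..n}"
  shows "forms_prod T m n (reflect s a b p) = - forms_prod T m n p"
proof (cases T)
  case TypeA
  hence "s = 1" "a \<noteq> b" using assms by (auto simp: mirrors_def)
  thus ?thesis using assms unfolding TypeA forms_prod_A by (simp add: reflect_1 vandermonde_swap)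
next
  case TypeD
  hence "s = 1 \<or> s = -1" "a \<noteq> b" using assms by (auto simp: mirrors_def)
  thus ?thesis using assms unfolding TypeD forms_prod_D by (simp add: sq_reflect vandermonde_swap)
next
  case TypeB
  show ?thesis
  proof (cases "a = b")
    case True
    hence "s = -1" using assms TypeB by (auto simp: mirrors_def)
    thus ?thesis using assms True unfolding TypeB forms_prod_B
      by (simp add: prod_reflect_self sq_reflect_self)
  next
    case False
    hence "s = 1 \<or> s = -1" using assms TypeB by (auto simp: mirrors_def)
    thus ?thesis using assms False unfolding TypeB forms_prod_B
      by (simp add: prod_reflect sq_reflect vandermonde_swap)
  qed
qed

lemma forms_prod_nonzero:
  assumes "p \<in> generic_points n"
  shows "forms_prod T m n p \<noteq> 0"
proof -
  have sq: "inj_on (sq p) {Suc m..n}"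
    using assms by (auto simp: generic_points_def sq_def[abs_def] intro: inj_on_subset)
  hence "inj_on ((\<lambda>t. t\<^sup>2) \<circ> p) {Suc m..n}" by (simp add: sq_def[abs_def] o_def)
  hence id: "inj_on p {Suc m..n}" by (rule inj_on_imageI2)
  have "(\<Prod>i=Suc m..n. p i) \<noteq> 0" using assms by (auto simp: generic_points_def prod_zero_iff)
  thus ?thesis using vandermonde_nonzero[OF sq] vandermonde_nonzero[OF id]
    by (cases T) (simp_all only: forms_prod_A forms_prod_B forms_prod_D, auto)
qed

text \<open>Distinct exponents add up to at least 0 + 1 + 2 and so on. A monomial of degree below
  that of the Vandermonde product must therefore repeat an exponent.\<close>

lemma sum_inj_on_ge:
  assumes "finite B" "inj_on \<alpha> B"
  shows "\<Sum>{..<card B} \<le> (\<Sum>i\<in>B. \<alpha> i :: nat)"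
  using assms
proof (induction "card B" arbitrary: B)
  case (Suc c)
  hence "B \<noteq> {}" by auto
  hence "Max (\<alpha> ` B) \<in> \<alpha> ` B" using Suc.prems(1) by (intro Max_in) auto
  then obtain a where a': "a \<in> B" "\<alpha> a = Max (\<alpha> ` B)" by auto
  have a: "a \<in> B" "\<And>b. b \<in> B \<Longrightarrow> \<alpha> b \<le> \<alpha> a"
    using a' Suc.prems(1) by auto
  have "card (\<alpha> ` B) \<le> card {..\<alpha> a}" using a by (intro card_mono) auto
  hence "c \<le> \<alpha> a" using Suc card_image[OF Suc.prems(2)] by simp
  moreover have "\<Sum>{..<card (B - {a})} \<le> (\<Sum>i\<in>B - {a}. \<alpha> i)"
    using Suc a by (intro Suc.hyps(1)) (auto intro: inj_on_diff)
  moreover have "(\<Sum>i\<in>B. \<alpha> i) = \<alpha> a + (\<Sum>i\<in>B - {a}. \<alpha> i)"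
    using Suc.prems a by (simp add: sum.remove)
  moreover have "card (B - {a}) = c" using Suc.prems(1) Suc.hyps(2) a(1) by simp
  moreover have "\<Sum>{..<card B} = \<Sum>{..<c} + c" unfolding Suc.hyps(2)[symmetric] by simp
  ultimately show ?case by simp
qed simp

lemma prod_power_reflect_1:
  assumes "a \<in> {1..n}" "b \<in> {1..n}" "\<alpha> a = \<alpha> b"
  shows "(\<Prod>i=1..n. reflect 1 a b p i ^ \<alpha> i) = (\<Prod>i=1..n. p i ^ \<alpha> i)"
  by (rule prod.reindex_bij_witness[of _ "\<lambda>i. if i = b then a else if i = a then b else i"
        "\<lambda>i. if i = b then a else if i = a then b else i"])
     (use assms in \<open>auto simp: reflect_apply\<close>)

lemma prod_power_reflect_self:
  assumes "a \<in> {1..n}"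
  shows "(\<Prod>i=1..n. reflect (-1) a a p i ^ \<alpha> i) = (-1) ^ \<alpha> a * (\<Prod>i=1..n. p i ^ \<alpha> i)"
proof -
  have "(\<Prod>i\<in>{1..n} - {a}. reflect (-1) a a p i ^ \<alpha> i) = (\<Prod>i\<in>{1..n} - {a}. p i ^ \<alpha> i)"
    by (intro prod.cong) (auto simp: reflect_apply)
  moreover have "reflect (-1) a a p a ^ \<alpha> a = (-1) ^ \<alpha> a * p a ^ \<alpha> a"
    using power_minus[of "p a" "\<alpha> a"] by (simp add: reflect_apply)
  ultimately show ?thesis
    unfolding prod.remove[OF finite_atLeastAtMost assms] by (simp only: mult.assoc)
qed

section \<open>The weighted functional and the adjoint of the Dunkl operator\<close>

locale weighted_step = parabolic_step +
  fixes T :: refl_type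
  assumes g1: "g > 1"
begin

definition weight :: "(nat \<Rightarrow> real) \<Rightarrow> real" where
  "weight p = \<bar>forms_prod T 0 n p\<bar> powr (2 * g)"

definition E :: "((nat \<Rightarrow> real) \<Rightarrow> real) \<Rightarrow> real" where
  "E f = (LINT p|gaussian_measure n. f p * weight p)"

abbreviation "generic \<equiv> generic_points n"

lemma integrable_weight: "poly_less n d f \<Longrightarrow> integrable (gaussian_measure n) (\<lambda>p. f p * weight p)"
  unfolding weight_def using g1 by (intro integrable_poly_powr[OF _ poly_less_forms_prod]) auto

lemma measurable_weight [measurable]: "weight \<in> borel_measurable (gaussian_measure n)"
proof -
  note [measurable] = measurable_forms_prod
  show ?thesis unfolding weight_def[abs_def] by measurable
qed

lemma E_add: "poly_less n d f \<Longrightarrow> poly_less n e h \<Longrightarrow> E (\<lambda>p. f p + h p) = E f + E h"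
  unfolding E_def using integrable_weight by (simp add: distrib_right)

lemma E_cmult: "E (\<lambda>p. c * f p) = c * E f"
  unfolding E_def by (simp add: mult.assoc)

lemma E_diff: "poly_less n d f \<Longrightarrow> poly_less n e h \<Longrightarrow> E (\<lambda>p. f p - h p) = E f - E h"
  unfolding E_def using integrable_weight by (simp add: left_diff_distrib)

lemma E_sum:
  "(\<And>i. i \<in> I \<Longrightarrow> poly_less n d (f i)) \<Longrightarrow> E (\<lambda>p. \<Sum>i\<in>I. f i p) = (\<Sum>i\<in>I. E (f i))"
  unfolding E_def sum_distrib_right using integrable_weight
  by (intro Bochner_Integration.integral_sum) auto

lemma E_cong:
  assumes "\<And>p. p \<in> generic \<Longrightarrow> f p = h p" "poly_less n d f" "poly_less n e h"
  shows "E f = E h"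
  unfolding E_def
proof (rule integral_cong_AE)
  show "(\<lambda>p. f p * weight p) \<in> borel_measurable (gaussian_measure n)"
    "(\<lambda>p. h p * weight p) \<in> borel_measurable (gaussian_measure n)"
    using measurable_poly_less[OF assms(2)] measurable_poly_less[OF assms(3)] by measurable
  show "AE p in gaussian_measure n. f p * weight p = h p * weight p"
    using AE_generic_points[of n] by eventually_elim (simp add: assms(1))
qed

text \<open>A single sign change does not belong to the group of type D, but the product of forms
  depends on the squares only. The extra case serves to dispose of monomials with an odd
  exponent.\<close>

lemma weight_reflect:
  assumes "(s, b) \<in> mirrors T n a \<or> (T = TypeD \<and> a = b \<and> s = -1)" "a \<in> {1..n}" "b \<in> {1..n}"
  shows "weight (reflect s a b p) = weight p"
proof (cases "T = TypeD \<and> a = b \<and> s = -1")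
  case True
  thus ?thesis unfolding weight_def by (simp add: forms_prod_D sq_reflect_self del: forms_prod.simps)
next
  case False
  hence mir: "(s, b) \<in> mirrors T n a" using assms(1) by blast
  have "forms_prod T 0 n (reflect s a b p) = - forms_prod T 0 n p"
    by (rule forms_prod_reflect[OF mir]) (use assms(2,3) in auto)
  thus ?thesis unfolding weight_def by simp
qed

lemma E_reflect:
  assumes "(s, b) \<in> mirrors T n a \<or> (T = TypeD \<and> a = b \<and> s = -1)" "a \<in> {1..n}" "b \<in> {1..n}"
    and f: "f \<in> borel_measurable (gaussian_measure n)"
  shows "E (\<lambda>p. f (reflect s a b p)) = E f"
proof -
  have s: "s = 1 \<or> s = -1" using assms(1) mirrorsD(1)[OF _ assms(2)] by blast
  have "E (\<lambda>p. f (reflect s a b p)) = (LINT p|gaussian_measure n. (\<lambda>p. f p * weight p) (reflect s a b p))"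
    unfolding E_def by (simp add: weight_reflect[OF assms(1-3)])
  also have "\<dots> = (LINT p|gaussian_measure n. f p * weight p)"
  proof (rule integral_reflect[OF assms(2,3) s])
    note [measurable] = f measurable_weight
    show "(\<lambda>p. f p * weight p) \<in> borel_measurable (gaussian_measure n)" by measurable
  qed
  finally show ?thesis by (simp add: E_def)
qed

lemma E_antisymmetric:
  assumes "(s, b) \<in> mirrors T n a \<or> (T = TypeD \<and> a = b \<and> s = -1)" "a \<in> {1..n}" "b \<in> {1..n}"
    and f: "f \<in> borel_measurable (gaussian_measure n)" "\<And>p. f (reflect s a b p) = - f p"
  shows "E f = 0"
  using E_reflect[OF assms(1-3) f(1)] E_cmult[of "-1" f] unfolding f(2) by simp

text \<open>The logarithmic derivative of a product of linear forms, with one summand per mirror. In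
  type B the form proportional to \<open>p x\<close> contributes 1 / \<open>p x\<close>, written as
  2 / (\<open>p x - (-1) * p x\<close>) to fit the indexing by \<open>mirrors\<close>.\<close>

lemma forms_prod_log_DERIV:
  assumes p: "p \<in> generic"
  shows "((\<lambda>t. forms_prod T 0 n (p(x := t))) has_real_derivative
      forms_prod T 0 n p * (\<Sum>(s, v)\<in>mirrors T n x. (if v = x then 2 else 1) / (p x - s * p v))) (at (p x))"
proof -
  let ?B = "{1..n}"
  have B: "{Suc 0..n} = {1..n}" by simp
  have xB: "x \<in> ?B" by (rule x_in)
  have ne: "p x \<noteq> p i" "sq p x \<noteq> sq p i" if "i \<in> ?B - {x}" for i
  proof -
    have i: "i \<in> {1..n}" "x \<noteq> i" using that by auto
    show "p x \<noteq> p i" "sq p x \<noteq> sq p i"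
      using inj_onD[OF generic_inj(1)[OF p], of x i] inj_onD[OF generic_inj(2)[OF p], of x i] i xB
      unfolding insert_x by blast+
  qed
  have V: "vandermonde ?B (q(x := t))
     = ((-1) ^ card {i\<in>?B. i < x} * vandermonde (?B - {x}) q) * (\<Prod>i\<in>?B - {x}. (t - q i) / 1)" for q t
  proof -
    have "vandermonde (?B - {x}) (q(x := t)) = vandermonde (?B - {x}) q"
      by (intro vandermonde_cong) auto
    moreover have "(\<Prod>i\<in>?B - {x}. (q(x := t)) x - (q(x := t)) i) = (\<Prod>i\<in>?B - {x}. (t - q i) / 1)"
      by (intro prod.cong) auto
    ultimately show ?thesis
      unfolding vandermonde_remove[OF finite_atLeastAtMost xB, of "q(x := t)"] by simp
  qed
  have VD: "((\<lambda>t. vandermonde ?B (q(x := t))) has_real_derivative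
      vandermonde ?B q * (\<Sum>i\<in>Y \<union> Z. 1 / (q x - q i))) (at (q x))"
    if "\<And>i. i \<in> ?B - {x} \<Longrightarrow> q x \<noteq> q i" for q
  proof -
    have "vandermonde ?B q = vandermonde ?B (q(x := q x))" by simp
    also note V
    finally have e: "vandermonde ?B q * S = ((-1) ^ card {i\<in>?B. i < x} * vandermonde (?B - {x}) q)
        * ((\<Prod>i\<in>?B - {x}. (q x - q i) / 1) * S)" for S by simp
    show ?thesis unfolding V e others[symmetric]
      by (rule DERIV_cmult[OF has_real_derivative_prod_linear]) (use that in auto)
  qed
  have VS: "((\<lambda>t. vandermonde ?B (sq (p(x := t)))) has_real_derivative
      vandermonde ?B (sq p) * (\<Sum>v\<in>Y \<union> Z. 1 / (p x - 1 * p v) + 1 / (p x - (-1) * p v))) (at (p x))"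
  proof -
    have "((\<lambda>t. vandermonde ?B ((sq p)(x := t))) has_real_derivative
      vandermonde ?B (sq p) * (\<Sum>i\<in>Y \<union> Z. 1 / (sq p x - sq p i))) (at ((p x)\<^sup>2))"
      using VD[of "sq p"] ne by (simp add: sq_def)
    moreover have "((\<lambda>t. t\<^sup>2) has_real_derivative 2 * p x) (at (p x))"
      by (auto intro!: derivative_eq_intros)
    ultimately have "((\<lambda>t. vandermonde ?B ((sq p)(x := t\<^sup>2))) has_real_derivative
      vandermonde ?B (sq p) * (\<Sum>i\<in>Y \<union> Z. 1 / (sq p x - sq p i)) * (2 * p x)) (at (p x))"
      by (rule DERIV_chain2)
    moreover have "(\<Sum>v\<in>Y \<union> Z. 1 / (p x - 1 * p v) + 1 / (p x - (-1) * p v))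
       = (\<Sum>i\<in>Y \<union> Z. 1 / (sq p x - sq p i)) * (2 * p x)"
      unfolding sum_distrib_right
    proof (intro sum.cong refl)
      fix v assume "v \<in> Y \<union> Z"
      from mirror_sum(1)[OF generic_sq_ne[OF p this], of 1]
      show "1 / (p x - 1 * p v) + 1 / (p x - (-1) * p v) = 1 / (sq p x - sq p v) * (2 * p x)"
        by (simp add: sq_def)
    qed
    ultimately show ?thesis unfolding sq_upd by (simp add: mult.assoc)
  qed
  show ?thesis
  proof (cases T)
    case TypeA
    show ?thesis
      unfolding TypeA forms_prod_A B
      using VD[of p] ne sum_mirrors_A[of "\<lambda>_ _. 1" "\<lambda>s v. p x - s * p v"] by simp
  next
    case TypeD
    show ?thesis
      unfolding TypeD forms_prod_D B
      using VS sum_mirrors_D[of "\<lambda>_ _. 1" "\<lambda>s v. p x - s * p v"] by simp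
  next
    case TypeB
    have px: "p x \<noteq> 0" using p xB by (auto simp: generic_points_def)
    define R where "R = (\<Prod>i\<in>?B - {x}. p i)"
    have pr: "(\<Prod>i\<in>?B. (p(x := t)) i) = t * R" for t
    proof -
      have "(\<Prod>i\<in>?B - {x}. (p(x := t)) i) = R" unfolding R_def by (intro prod.cong) auto
      thus ?thesis using prod.remove[OF finite_atLeastAtMost xB, of "p(x := t)"] by simp
    qed
    have pr': "(\<Prod>i\<in>?B. p i) = p x * R" using pr[of "p x"] by simp
    have D: "((\<lambda>t. sqrt 2 ^ (n - 0) * R * (t * vandermonde ?B (sq (p(x := t))))) has_real_derivative
       sqrt 2 ^ (n - 0) * R * (1 * vandermonde ?B (sq (p(x := p x))) + vandermonde ?B (sq p) *
           (\<Sum>v\<in>Y \<union> Z. 1 / (p x - 1 * p v) + 1 / (p x - (-1) * p v)) * p x)) (at (p x))"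
      by (intro DERIV_cmult DERIV_mult DERIV_ident VS)
    have eq: "sqrt 2 ^ (n - 0) * R * (1 * vandermonde ?B (sq (p(x := p x))) + vandermonde ?B (sq p) * S * p x)
      = sqrt 2 ^ (n - 0) * (p x * R) * vandermonde ?B (sq p) * (2 / (p x - (-1) * p x) + S)" for S
      using px by (simp add: field_simps)
    have fn: "(\<lambda>t. sqrt 2 ^ (n - 0) * (t * R) * vandermonde ?B (sq (p(x := t))))
        = (\<lambda>t. sqrt 2 ^ (n - 0) * R * (t * vandermonde ?B (sq (p(x := t)))))"
      by (simp only: mult_ac)
    have ms: "(\<Sum>(s, v)\<in>mirrors TypeB n x. (if v = x then 2 else 1) / (p x - s * p v))
      = 2 / (p x - (-1) * p x) + (\<Sum>v\<in>Y \<union> Z. 1 / (p x - 1 * p v) + 1 / (p x - (-1) * p v))"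
      using sum_mirrors_B[of "\<lambda>_ _. 1" "\<lambda>s v. p x - s * p v"] by (simp only: mult_1_right)
    show ?thesis
      unfolding TypeB forms_prod_B B pr pr' fn ms by (rule DERIV_cong[OF D eq])
  qed
qed

text \<open>Under the reflection the numerator and the weight are invariant and the linear form
  changes sign, so a convergent integral must be 0. It converges because the form divides the full
  product: one factor of its absolute value is taken from the weight to cancel the form, and the
  exponent \<open>2 * g - 1\<close> remains.\<close>

lemma mirror_term_integral:
  assumes sv: "(s, v) \<in> mirrors T n x" and f: "poly_less n d f" and h: "poly_less n e h"
  defines "K \<equiv> \<lambda>p. (f (reflect s x v p) * h p + f p * h (reflect s x v p)) / (p x - s * p v) * weight p"
  shows "integrable (gaussian_measure n) K" "(LINT p|gaussian_measure n. K p) = 0"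
proof -
  let ?P = "forms_prod T 0 n"
  note m = mirrorsD[OF sv x_in]
  have vx: "v \<in> {1..n}" "x \<in> {1..n}" using m x_in by auto
  have ss: "s * s = 1" using m(1) by auto
  have fr: "poly_less n d (\<lambda>p. f (reflect s x v p))" "poly_less n e (\<lambda>p. h (reflect s x v p))"
    using f h vx by (auto intro!: poly_less_reflect)
  have meas: "K \<in> borel_measurable (gaussian_measure n)"
  proof -
    have [measurable]: "(\<lambda>p. p x) \<in> borel_measurable (gaussian_measure n)"
      "(\<lambda>p. p v) \<in> borel_measurable (gaussian_measure n)" using vx by (auto intro: measurable_gaussian_component)
    note [measurable] = measurable_poly_less[OF f] measurable_poly_less[OF h]
      measurable_poly_less[OF fr(1)] measurable_poly_less[OF fr(2)]
    show ?thesis unfolding K_def by measurable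
  qed
  obtain H where H: "poly_less n (Suc (forms_degree T (n - 0)) - 1) H"
    "\<And>p. ?P p - ?P (reflect s x v p) = (p x - s * p v) * H p"
    using poly_less_divided_difference[OF poly_less_forms_prod x_in m(2,1)] by blast
  \<comment> \<open>By antisymmetry the difference is twice the product of forms, so its divided
    difference is twice the quotient by the linear form.\<close>
  have H2: "2 * ?P p = (p x - s * p v) * H p" for p
    using H(2)[of p] forms_prod_reflect[OF sv, of 0 p] vx by simp
  define F where "F p = (f (reflect s x v p) * h p + f p * h (reflect s x v p)) * H p" for p
  have "\<exists>d. poly_less n d F"
    unfolding F_def
    using poly_less_mult[OF poly_less.add[OF poly_less_mono[OF poly_less_mult[OF fr(1) poly_less_Suc[OF h]], of "d + e"]
        poly_less_mono[OF poly_less_mult[OF f poly_less_Suc[OF fr(2)]], of "d + e"]] poly_less_Suc[OF H(1)]]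
    by auto
  then obtain dF where F: "poly_less n dF F" by blast
  show "integrable (gaussian_measure n) K"
  proof (rule Bochner_Integration.integrable_bound)
    show "integrable (gaussian_measure n) (\<lambda>p. F p * \<bar>?P p\<bar> powr (2 * g - 1))"
      using g1 by (intro integrable_poly_powr[OF F poly_less_forms_prod]) auto
    show "AE p in gaussian_measure n. norm (K p) \<le> norm (F p * \<bar>?P p\<bar> powr (2 * g - 1))"
      using AE_generic_points[of n]
    proof eventually_elim
      case (elim p)
      have a: "p x - s * p v \<noteq> 0" by (rule generic_mirror_nonzero[OF elim x_in sv])
      have P0: "?P p \<noteq> 0" by (rule forms_prod_nonzero[OF elim])
      have "weight p = \<bar>?P p\<bar> powr (2 * g - 1) * \<bar>?P p\<bar>"
        using P0 by (simp add: weight_def powr_diff)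
      moreover have "\<bar>?P p\<bar> / \<bar>p x - s * p v\<bar> = \<bar>H p\<bar> / 2"
      proof -
        have "?P p = (p x - s * p v) * H p / 2" using H2[of p] by simp
        hence "\<bar>?P p\<bar> = \<bar>(p x - s * p v) * H p / 2\<bar>" by (rule arg_cong)
        also have "\<dots> = \<bar>p x - s * p v\<bar> * (\<bar>H p\<bar> / 2)" by (simp add: abs_mult)
        finally show ?thesis using a by (simp only: nonzero_mult_div_cancel_left abs_eq_0 not_False_eq_True)
      qed
      ultimately have "weight p / \<bar>p x - s * p v\<bar> = \<bar>?P p\<bar> powr (2 * g - 1) * \<bar>H p\<bar> / 2"
        by (simp only: times_divide_eq_right[symmetric])
      moreover have "norm (K p) = \<bar>f (reflect s x v p) * h p + f p * h (reflect s x v p)\<bar> * (weight p / \<bar>p x - s * p v\<bar>)"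
      proof -
        have alg: "norm (N / a * w) = \<bar>N\<bar> * (w / \<bar>a\<bar>)" if "w \<ge> 0" for N a w :: real
          using that by (simp add: abs_mult)
        have "weight p \<ge> 0" by (simp add: weight_def)
        thus ?thesis unfolding K_def by (rule alg)
      qed
      ultimately have "norm (K p) = \<bar>f (reflect s x v p) * h p + f p * h (reflect s x v p)\<bar>
          * (\<bar>?P p\<bar> powr (2 * g - 1) * \<bar>H p\<bar> / 2)" by (simp only:)
      also have "\<dots> = norm (F p * \<bar>?P p\<bar> powr (2 * g - 1)) / 2"
        by (simp add: F_def abs_mult)
      finally have "norm (K p) = norm (F p * \<bar>?P p\<bar> powr (2 * g - 1)) / 2" .
      thus ?case by simp
    qed
  qed (rule meas)
  have "K (reflect s x v p) = - K p" for p
  proof -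
    have r1: "reflect s x v p x = s * p v" using m(1,3) by (auto simp: reflect_apply)
    have r2: "s * reflect s x v p v = p x" using ss by (simp add: reflect_apply mult.assoc[symmetric])
    have w: "weight (reflect s x v p) = weight p" using sv vx by (intro weight_reflect) auto
    have "- (p x - s * p v) = s * p v - p x" by simp
    thus ?thesis unfolding K_def r1 r2 w reflect_reflect[OF ss]
      by (metis (no_types, opaque_lifting) add.commute divide_minus_right mult_minus_left)
  qed
  hence "(LINT p|gaussian_measure n. K p) = (LINT p|gaussian_measure n. - K p)"
    using integral_reflect[OF vx(2,1) m(1) meas] by simp
  thus "(LINT p|gaussian_measure n. K p) = 0" by simp
qed

text \<open>Integration by parts yields the derivative of \<open>f * h\<close> and
  \<open>2 * g * f * h\<close> times the logarithmic derivative of the product of forms. With a bar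
  for the reflected value, each mirror splits 2 f h as (f - f-bar) h + f (h - h-bar) + (f-bar h + f
  h-bar). The first two parts complete the derivatives to Dunkl images, and the third integrates to
  0 by \<open>mirror_term_integral\<close>.\<close>

lemma dunkl_adjoint:
  assumes f: "poly_less n d f" "poly_less n d1 f1" "\<And>p. p \<in> generic \<Longrightarrow> dunkl T g n x f p = f1 p"
    and h: "poly_less n e h" "poly_less n e1 h1" "\<And>p. p \<in> generic \<Longrightarrow> dunkl T g n x h p = h1 p"
  shows "E (\<lambda>p. p x * (f p * h p)) = E (\<lambda>p. f1 p * h p) + E (\<lambda>p. f p * h1 p)"
proof -
  let ?P = "forms_prod T 0 n"
  obtain f' where f': "poly_less n (d - 1) f'"
    "\<And>p. ((\<lambda>t. f (p(x := t))) has_real_derivative f' p) (at (p x))"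
    using poly_less_deriv[OF f(1)] by blast
  obtain h' where h': "poly_less n (e - 1) h'"
    "\<And>p. ((\<lambda>t. h (p(x := t))) has_real_derivative h' p) (at (p x))"
    using poly_less_deriv[OF h(1)] by blast
  obtain P' where P': "poly_less n (Suc (forms_degree T (n - 0)) - 1) P'"
    "\<And>p. ((\<lambda>t. ?P (p(x := t))) has_real_derivative P' p) (at (p x))"
    using poly_less_deriv[OF poly_less_forms_prod] by blast
  define F' where "F' p = f' p * h p + h' p * f p" for p
  have F: "poly_less n (d + e) (\<lambda>p. f p * h p)"
    by (rule poly_less_mult[OF f(1) poly_less_Suc[OF h(1)]])
  have F': "poly_less n (d + e) F'"
    unfolding F'_def
    by (intro poly_less.add poly_less_mono[OF poly_less_mult[OF f'(1) poly_less_Suc[OF h(1)]]]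
        poly_less_mono[OF poly_less_mult[OF h'(1) poly_less_Suc[OF f(1)]]]) auto
  have DF: "((\<lambda>t. f (p(x := t)) * h (p(x := t))) has_real_derivative F' p) (at (p x))" for p
    using DERIV_mult[OF f'(2)[of p] h'(2)[of p]] by (simp add: F'_def)
  define K where "K w p = (f (reflect (fst w) x (snd w) p) * h p + f p * h (reflect (fst w) x (snd w) p))
      / (p x - fst w * p (snd w)) * weight p" for w :: "real \<times> nat" and p
  have K: "integrable (gaussian_measure n) (K w)" "(LINT p|gaussian_measure n. K w p) = 0"
    if "w \<in> mirrors T n x" for w
    using mirror_term_integral[OF _ f(1) h(1), of "fst w" "snd w"] that by (auto simp: K_def[abs_def])
  have i1: "integrable (gaussian_measure n) (\<lambda>p. f1 p * h p * weight p)"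
    by (rule integrable_weight[OF poly_less_mult[OF f(2) poly_less_Suc[OF h(1)]]])
  have i2: "integrable (gaussian_measure n) (\<lambda>p. f p * h1 p * weight p)"
    by (rule integrable_weight[OF poly_less_mult[OF f(1) poly_less_Suc[OF h(2)]]])
  let ?c = "\<lambda>w. if snd w = x then 2 else (1::real)"
  let ?R = "\<lambda>p. f1 p * h p * weight p + f p * h1 p * weight p + g * (\<Sum>w\<in>mirrors T n x. ?c w * K w p)"
  have iR: "integrable (gaussian_measure n) ?R"
    using K(1) by (intro Bochner_Integration.integrable_add i1 i2 integrable_mult_right Bochner_Integration.integrable_sum) auto
  have "E (\<lambda>p. p x * (f p * h p)) = (LINT p|gaussian_measure n. F' p * \<bar>?P p\<bar> powr (2 * g)
      + 2 * g * (f p * h p * ?P p * P' p * \<bar>?P p\<bar> powr (2 * g - 2)))"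
    unfolding E_def weight_def
    using g1 by (intro gaussian_integral_by_parts[OF x_in _ F F' DF poly_less_forms_prod P']) auto
  also have "\<dots> = (LINT p|gaussian_measure n. ?R p)"
  proof (rule integral_cong_AE)
    note [measurable] = measurable_poly_less[OF f(1)] measurable_poly_less[OF h(1)] measurable_poly_less[OF F']
       measurable_poly_less[OF P'(1)] measurable_forms_prod
    show "(\<lambda>p. F' p * \<bar>?P p\<bar> powr (2 * g) + 2 * g * (f p * h p * ?P p * P' p * \<bar>?P p\<bar> powr (2 * g - 2)))
       \<in> borel_measurable (gaussian_measure n)" by measurable
    show "?R \<in> borel_measurable (gaussian_measure n)" using iR by blast
    show "AE p in gaussian_measure n. F' p * \<bar>?P p\<bar> powr (2 * g)
        + 2 * g * (f p * h p * ?P p * P' p * \<bar>?P p\<bar> powr (2 * g - 2)) = ?R p"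
      using AE_generic_points[of n]
    proof eventually_elim
      case (elim p)
      let ?a = "\<lambda>w. p x - fst w * p (snd w)"
      let ?S = "\<Sum>w\<in>mirrors T n x. ?c w / ?a w"
      have P0: "?P p \<noteq> 0" by (rule forms_prod_nonzero[OF elim])
      have PS: "P' p = ?P p * ?S"
        using DERIV_unique[OF P'(2) forms_prod_log_DERIV[OF elim]] by (simp add: case_prod_beta)
      have wt: "?P p * ?P p * \<bar>?P p\<bar> powr (2 * g - 2) = weight p"
        using P0 by (simp add: weight_def powr_diff power2_eq_square)
      have "f p * h p * ?P p * P' p * \<bar>?P p\<bar> powr (2 * g - 2)
         = f p * h p * ?S * (?P p * ?P p * \<bar>?P p\<bar> powr (2 * g - 2))"
        unfolding PS by (simp only: mult_ac)
      hence lhs: "F' p * \<bar>?P p\<bar> powr (2 * g) + 2 * g * (f p * h p * ?P p * P' p * \<bar>?P p\<bar> powr (2 * g - 2))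
         = (F' p + g * (2 * (f p * h p) * ?S)) * weight p"
        unfolding wt by (simp add: weight_def algebra_simps)
      have f1: "f1 p = f' p + g * (\<Sum>w\<in>mirrors T n x. ?c w * (f p - f (reflect (fst w) x (snd w) p)) / ?a w)"
        using f(3)[OF elim] unfolding dunkl_def DERIV_imp_deriv[OF f'(2)] by (simp add: case_prod_beta)
      have h1: "h1 p = h' p + g * (\<Sum>w\<in>mirrors T n x. ?c w * (h p - h (reflect (fst w) x (snd w) p)) / ?a w)"
        using h(3)[OF elim] unfolding dunkl_def DERIV_imp_deriv[OF h'(2)] by (simp add: case_prod_beta)
      have s: "(\<Sum>w\<in>mirrors T n x. ?c w * (f p - f (reflect (fst w) x (snd w) p)) / ?a w) * h p * weight p
         + f p * (\<Sum>w\<in>mirrors T n x. ?c w * (h p - h (reflect (fst w) x (snd w) p)) / ?a w) * weight p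
         + (\<Sum>w\<in>mirrors T n x. ?c w * K w p) = 2 * (f p * h p) * ?S * weight p"
        unfolding sum_distrib_left sum_distrib_right sum.distrib[symmetric]
      proof (intro sum.cong refl)
        fix w assume w: "w \<in> mirrors T n x"
        have alg: "c * (a - a') / d * b * u + a * (c * (b - b') / d) * u + c * ((a' * b + a * b') / d * u)
          = 2 * (a * b) * (c / d) * u" for a a' b b' c d u :: real
          by (simp add: divide_inverse algebra_simps)
        show "?c w * (f p - f (reflect (fst w) x (snd w) p)) / ?a w * h p * weight p
         + f p * (?c w * (h p - h (reflect (fst w) x (snd w) p)) / ?a w) * weight p
         + ?c w * K w p = 2 * (f p * h p) * (?c w / ?a w) * weight p"
          unfolding K_def by (rule alg)
      qed
      have "?R p = F' p * weight p + g * ((\<Sum>w\<in>mirrors T n x. ?c w * (f p - f (reflect (fst w) x (snd w) p)) / ?a w) * h p * weight p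
         + f p * (\<Sum>w\<in>mirrors T n x. ?c w * (h p - h (reflect (fst w) x (snd w) p)) / ?a w) * weight p
         + (\<Sum>w\<in>mirrors T n x. ?c w * K w p))"
        unfolding f1 h1 F'_def by algebra
      thus ?case unfolding lhs s by algebra
    qed
  qed
  also have "\<dots> = (LINT p|gaussian_measure n. f1 p * h p * weight p) + (LINT p|gaussian_measure n. f p * h1 p * weight p)
      + g * (\<Sum>w\<in>mirrors T n x. ?c w * (LINT p|gaussian_measure n. K w p))"
    using i1 i2 K(1) by (simp add: Bochner_Integration.integral_sum)
  also have "(\<Sum>w\<in>mirrors T n x. ?c w * (LINT p|gaussian_measure n. K w p)) = 0"
    using K(2) by (intro sum.neutral) auto
  finally show ?thesis by (simp add: E_def)
qed

text \<open>Equal exponents at two coordinates of the subgroup make the integrand antisymmetric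
  under their swap. A sign change removes every odd exponent in type D and every even one in type B,
  after which half exponents are compared. Without a repetition, \<open>sum_inj_on_ge\<close> would
  force too large a degree.\<close>

lemma E_forms_prod_monomial:
  assumes "(\<Sum>i=1..n. \<alpha> i) < forms_degree T (n - m)"
  shows "E (\<lambda>p. forms_prod T m n p * (\<Prod>i=1..n. p i ^ \<alpha> i)) = 0"
proof -
  let ?B = "{Suc m..n}"
  have Bn: "?B \<subseteq> {1..n}" by auto
  have meas: "(\<lambda>p. forms_prod T m n p * (\<Prod>i=1..n. p i ^ \<alpha> i)) \<in> borel_measurable (gaussian_measure n)"
  proof -
    note [measurable] = measurable_forms_prod
    have [measurable]: "(\<lambda>p. p i) \<in> borel_measurable (gaussian_measure n)" if "i \<in> {1..n}" for i
      using that by (rule measurable_gaussian_component)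
    have "(\<lambda>p. \<Prod>i=1..n. p i ^ \<alpha> i) \<in> borel_measurable (gaussian_measure n)"
      by (intro borel_measurable_prod borel_measurable_power measurable_gaussian_component)
    thus ?thesis by measurable
  qed
  have sumB: "(\<Sum>i\<in>?B. \<alpha> i) < forms_degree T (n - m)"
    using sum_mono2[OF _ Bn, of \<alpha>] assms by simp
  have swap: ?thesis if ab: "a \<in> ?B" "b \<in> ?B" "a \<noteq> b" "\<alpha> a = \<alpha> b" for a b
  proof -
    have mir: "(1, b) \<in> mirrors T n a" using ab by (cases T) (auto simp: mirrors_def)
    have n: "a \<in> {1..n}" "b \<in> {1..n}" using ab by auto
    show ?thesis
      by (rule E_antisymmetric[OF disjI1[OF mir] n meas])
         (simp only: forms_prod_reflect[OF mir ab(1,2)] prod_power_reflect_1[where \<alpha> = \<alpha>, OF n ab(4)] mult_minus_left)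
  qed
  consider "T = TypeA" | "T = TypeD" | "T = TypeB" by (cases T) auto
  thus ?thesis
  proof cases
    case 1
    have "\<not> inj_on \<alpha> ?B"
      using sum_inj_on_ge[of ?B \<alpha>] sumB by (auto simp: 1 forms_degree_A)
    thus ?thesis using swap by (auto simp: inj_on_def)
  next
    case 2
    show ?thesis
    proof (cases "\<exists>a\<in>?B. odd (\<alpha> a)")
      case True
      then obtain a where a: "a \<in> ?B" "odd (\<alpha> a)" by blast
      have n: "a \<in> {1..n}" using a by auto
      have "forms_prod T m n (reflect (-1) a a p) = forms_prod T m n p" for p
        unfolding 2 forms_prod_D by (simp add: sq_reflect_self)
      moreover have "(- 1 :: real) ^ \<alpha> a = - 1" using a(2) by simp
      ultimately have "forms_prod T m n (reflect (-1) a a p) * (\<Prod>i=1..n. reflect (-1) a a p i ^ \<alpha> i)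
          = - (forms_prod T m n p * (\<Prod>i=1..n. p i ^ \<alpha> i))" for p
        by (simp only: prod_power_reflect_self[OF n] mult_1_left mult_minus_left mult_minus_right)
      thus ?thesis using 2 by (intro E_antisymmetric[OF _ n n meas]) auto
    next
      case False
      define \<beta> where "\<beta> i = \<alpha> i div 2" for i
      have \<alpha>: "\<alpha> i = 2 * \<beta> i" if "i \<in> ?B" for i using that False by (auto simp: \<beta>_def)
      hence "(\<Sum>i\<in>?B. \<alpha> i) = 2 * (\<Sum>i\<in>?B. \<beta> i)" by (simp add: sum_distrib_left)
      hence "\<not> inj_on \<beta> ?B"
        using sum_inj_on_ge[of ?B \<beta>] sumB by (auto simp: 2 forms_degree_D)
      then obtain a b where "a \<in> ?B" "b \<in> ?B" "a \<noteq> b" "\<beta> a = \<beta> b" by (auto simp: inj_on_def)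
      thus ?thesis using swap[of a b] \<alpha> by auto
    qed
  next
    case 3
    show ?thesis
    proof (cases "\<exists>a\<in>?B. even (\<alpha> a)")
      case True
      then obtain a where a: "a \<in> ?B" "even (\<alpha> a)" by blast
      have n: "a \<in> {1..n}" using a by auto
      have mir: "(-1, a) \<in> mirrors T n a" by (simp add: 3 mirrors_def)
      have "(- 1 :: real) ^ \<alpha> a = 1" using a(2) by simp
      hence "forms_prod T m n (reflect (-1) a a p) * (\<Prod>i=1..n. reflect (-1) a a p i ^ \<alpha> i)
          = - (forms_prod T m n p * (\<Prod>i=1..n. p i ^ \<alpha> i))" for p
        by (simp only: prod_power_reflect_self[OF n] forms_prod_reflect[OF mir a(1) a(1)] mult_1_left mult_minus_left)
      thus ?thesis using mir by (intro E_antisymmetric[OF _ n n meas]) auto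
    next
      case False
      define \<beta> where "\<beta> i = \<alpha> i div 2" for i
      have \<alpha>: "\<alpha> i = 2 * \<beta> i + 1" if "i \<in> ?B" for i using that False by (auto simp: \<beta>_def)
      have "(\<Sum>i\<in>?B. \<alpha> i) = (\<Sum>i\<in>?B. 1 + 2 * \<beta> i)"
        by (intro sum.cong refl) (simp add: \<alpha>)
      hence "(\<Sum>i\<in>?B. \<alpha> i) = card ?B + 2 * (\<Sum>i\<in>?B. \<beta> i)"
        unfolding sum.distrib sum_distrib_left by simp
      hence "\<not> inj_on \<beta> ?B"
        using sum_inj_on_ge[of ?B \<beta>] sumB by (auto simp: 3 forms_degree_B)
      then obtain a b where "a \<in> ?B" "b \<in> ?B" "a \<noteq> b" "\<beta> a = \<beta> b" by (auto simp: inj_on_def)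
      thus ?thesis using swap[of a b] \<alpha> by auto
    qed
  qed
qed

text \<open>The monomial in front again absorbs the coordinate factors during the induction, with
  the total degree kept below that of the product of forms. As \<open>poly_less\<close> is a strict
  bound, \<open>d\<close> may equal \<open>forms_degree\<close>.\<close>

lemma E_forms_prod_orthogonal:
  assumes "poly_less n d h" "d \<le> forms_degree T (n - m)"
  shows "E (\<lambda>p. forms_prod T m n p * h p) = 0"
proof -
  let ?P = "forms_prod T m n"
  have mono: "poly_less n (Suc (sum \<alpha> {1..n})) (\<lambda>p. \<Prod>i=1..n. p i ^ \<alpha> i)" for \<alpha>
  proof -
    have "poly_less n (Suc (sum \<alpha> I)) (\<lambda>p. \<Prod>i\<in>I. p i ^ \<alpha> i)" if "finite I" "I \<subseteq> {1..n}" for I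
      using that
    proof (induction I rule: finite_induct)
      case (insert i I)
      have "poly_less n (Suc (\<alpha> i * 1)) (\<lambda>p. p i ^ \<alpha> i)"
        using insert.prems poly_less_coord[of i n 0] by (intro poly_less_power) auto
      from poly_less_mult[OF this insert.IH] insert show ?case by simp
    qed (auto intro: poly_less.intros)
    thus ?thesis by auto
  qed
  have "E (\<lambda>p. ?P p * ((\<Prod>i=1..n. p i ^ \<alpha> i) * h p)) = 0"
    if "poly_less n d h" "(\<Sum>i=1..n. \<alpha> i) + d \<le> forms_degree T (n - m)" for \<alpha> d h
    using that
  proof (induction arbitrary: \<alpha> rule: poly_less.induct)
    case (zero d \<alpha>)
    show ?case by (simp add: E_def)
  next
    case (const d c \<alpha>)
    have "E (\<lambda>p. ?P p * ((\<Prod>i=1..n. p i ^ \<alpha> i) * c)) = c * E (\<lambda>p. ?P p * (\<Prod>i=1..n. p i ^ \<alpha> i))"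
      unfolding E_cmult[symmetric] by (simp only: mult_ac)
    also have "E (\<lambda>p. ?P p * (\<Prod>i=1..n. p i ^ \<alpha> i)) = 0"
      using const.prems by (intro E_forms_prod_monomial) simp
    finally show ?case by simp
  next
    case (coord i d f \<alpha>)
    have "(\<Prod>j=1..n. p j ^ (\<alpha>(i := Suc (\<alpha> i))) j) = (\<Prod>j=1..n. p j ^ \<alpha> j) * p i" for p :: "nat \<Rightarrow> real"
    proof -
      have "(\<Prod>j=1..n. p j ^ (\<alpha>(i := Suc (\<alpha> i))) j) = (\<Prod>j=1..n. p j ^ \<alpha> j * (if j = i then p j else 1))"
        by (intro prod.cong) auto
      thus ?thesis using coord(1) by (simp add: prod.distrib)
    qed
    moreover have "(\<Sum>j=1..n. (\<alpha>(i := Suc (\<alpha> i))) j) = Suc (\<Sum>j=1..n. \<alpha> j)"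
    proof -
      have "(\<Sum>j=1..n. (\<alpha>(i := Suc (\<alpha> i))) j) = (\<Sum>j=1..n. \<alpha> j + (if j = i then 1 else 0))"
        by (intro sum.cong) auto
      thus ?thesis using coord(1) by (simp add: sum.distrib)
    qed
    ultimately show ?case using coord.IH[of "\<alpha>(i := Suc (\<alpha> i))"] coord.prems
      by (simp only: mult.assoc)
  next
    case (add d f h \<alpha>)
    have "poly_less n (Suc (forms_degree T (n - m)) + (Suc (sum \<alpha> {1..n}) + d)) (\<lambda>p. ?P p * ((\<Prod>i=1..n. p i ^ \<alpha> i) * f p))"
      if "poly_less n d f" for f
      by (rule poly_less_mult[OF poly_less_forms_prod poly_less_Suc[OF poly_less_mult[OF mono poly_less_Suc[OF that]]]])
    from E_add[OF this[OF add.hyps(1)] this[OF add.hyps(2)]]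
    show ?case using add by (simp add: distrib_left del: forms_prod.simps)
  qed
  from this[OF assms(1), of "\<lambda>_. 0"] assms(2) show ?thesis by simp
qed

text \<open>\<open>dunkl_adjoint\<close> trades one factor \<open>p x\<close> for one Dunkl operator
  on \<open>W\<close>: the other term vanishes since the Dunkl image of its second factor has too
  small a degree. The image of \<open>W\<close> is orthogonal to one degree less, so
  \<open>D\<close> falls together with the power of \<open>p x\<close>. \<open>W\<close> is a
  polynomial, as integration requires, whereas the functions related by \<open>dunkl_maps\<close>
  are controlled at generic points only.\<close>

lemma E_dunkl_pairing:
  assumes W: "poly_less n dW W" "\<And>p. p \<in> generic \<Longrightarrow> W p = f p" and Q: "poly_less n e Q"
    and orth: "\<And>d h. poly_less n d h \<Longrightarrow> d \<le> D \<Longrightarrow> E (\<lambda>p. W p * h p) = 0"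
    and maps: "(dunkl_maps T g n x ^^ k) f f'" and "e + k \<le> Suc D"
    and f': "poly_less n d' f'"
  shows "E (\<lambda>p. W p * (p x ^ k * Q p)) = E (\<lambda>p. f' p * Q p)"
  using W orth maps assms(6)
proof (induction k arbitrary: f W dW D)
  case 0
  hence "f = f'" by simp
  hence "W p * (p x ^ 0 * Q p) = f' p * Q p" if "p \<in> generic" for p using 0(2) that by simp
  thus ?case
    using 0(1) f' Q by (intro E_cong[where d = "dW + e" and e = "d' + e"])
       (auto intro!: poly_less_mult[OF _ poly_less_Suc])
next
  case (Suc k)
  obtain f1 where f1: "dunkl_maps T g n x f f1" "(dunkl_maps T g n x ^^ k) f1 f'"
    using relpowp_Suc_D2[OF Suc.prems(4)] by blast
  obtain W1 where W1: "poly_less n (dW - 1) W1" "\<And>p. p \<in> generic \<Longrightarrow> dunkl T g n x W p = W1 p"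
    using dunkl_poly_less[OF Suc.prems(1) x_in] by blast
  have W1f: "W1 p = f1 p" if "p \<in> generic" for p
  proof -
    have "dunkl T g n x W p = dunkl T g n x f p"
      by (rule dunkl_cong[OF Suc.prems(2) that x_in])
    thus ?thesis using W1(2)[OF that] f1(1) that by (auto simp: dunkl_maps_def)
  qed
  have *: "E (\<lambda>p. p x * (W p * h p)) = E (\<lambda>p. W1 p * h p)" if h: "poly_less n d h" "d \<le> Suc D" for h d
  proof -
    obtain h1 where h1: "poly_less n (d - 1) h1" "\<And>p. p \<in> generic \<Longrightarrow> dunkl T g n x h p = h1 p"
      using dunkl_poly_less[OF h(1) x_in] by blast
    have "E (\<lambda>p. W p * h1 p) = 0" by (rule Suc.prems(3)[OF h1(1)]) (use h(2) in simp)
    thus ?thesis using dunkl_adjoint[OF Suc.prems(1) W1 h(1) h1] by simp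
  qed
  have Dpos: "D > 0 \<or> e + k = 0" using Suc.prems(5) by linarith
  have xQ: "poly_less n (e + k) (\<lambda>p. p x ^ k * Q p)" for k
  proof (induction k)
    case (Suc k)
    from poly_less.coord[OF x_in Suc.IH] show ?case by (simp add: mult.assoc)
  qed (use Q in simp)
  have "E (\<lambda>p. W p * (p x ^ Suc k * Q p)) = E (\<lambda>p. p x * (W p * (p x ^ k * Q p)))"
    by (simp add: mult_ac)
  also have "\<dots> = E (\<lambda>p. W1 p * (p x ^ k * Q p))"
    using Suc.prems(5) by (intro *[OF xQ]) simp
  also have "\<dots> = E (\<lambda>p. f' p * Q p)"
  proof (cases "D = 0")
    \<comment> \<open>No orthogonality is left to be used up here. The bound forces
      \<open>e = 0\<close>, so \<open>Q\<close> is the zero polynomial and both sides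
      vanish.\<close>
    case True
    hence z: "e = 0" "k = 0" using Suc.prems(5) by auto
    hence "Q p = 0" for p using poly_less_0[OF Q] by simp
    thus ?thesis by simp
  next
    case False
    show ?thesis
    proof (rule Suc.IH[OF W1(1) W1f _ f1(2), of "D - 1"])
      show "e + k \<le> Suc (D - 1)" using Suc.prems(5) False by simp
      fix d h assume h: "poly_less n d h" "d \<le> D - 1"
      have "E (\<lambda>p. W1 p * h p) = E (\<lambda>p. p x * (W p * h p))"
        using h by (intro *[symmetric]) auto
      also have "\<dots> = E (\<lambda>p. W p * (p x * h p))" by (simp add: mult_ac)
      also have "\<dots> = 0"
        using h False by (intro Suc.prems(3)[OF poly_less.coord[OF x_in h(1)]]) auto
      finally show "E (\<lambda>p. W1 p * h p) = 0" .
    qed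
  qed
  finally show ?case .
qed

text \<open>The factor \<open>sqrt 2\<close> of the linear form \<open>sqrt 2 * p x\<close> in type B.\<close>

definition leading_const :: real where
  "leading_const = (if T = TypeB then sqrt 2 else 1)"

section \<open>Expansion along one coordinate and the recursion for the squared product\<close>

lemma inj_sq: "p \<in> generic \<Longrightarrow> inj_on (sq p) Y"
  by (rule inj_on_subset[OF generic_inj(2)]) auto

lemma xY_insert: "insert x Y = {Suc m..n}" using m by auto

text \<open>Laplace expansion in the coordinates for type A, in their squares for types B and D. In
  type B the power of \<open>p j\<close> is odd: the surplus factor turns the swapped
  \<open>odd_part\<close> back into \<open>p x * odd_part p\<close>, which is common to all
  terms.\<close>

lemma forms_prod_expansion:
  assumes p: "p \<in> generic"
  shows "forms_prod T m n p = leading_const * (p x ^ step_degree T r * forms_prod T x n p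
           - (\<Sum>j\<in>Y. p j ^ step_degree T r * forms_prod T x n (reflect 1 x j p)))"
proof -
  have less: "\<And>y. y \<in> Y \<Longrightarrow> x < y" by auto
  have inj: "inj_on p Y" by (rule inj_on_subset[OF generic_inj(1)[OF p]]) auto
  have V: "vandermonde {Suc m..n} (sq p) = (p x)\<^sup>2 ^ r * vandermonde Y (sq p)
       - (\<Sum>j\<in>Y. (p j)\<^sup>2 ^ r * vandermonde Y (sq (reflect 1 x j p)))"
    using vandermonde_laplace[OF fin(1) inj_sq[OF p] less] unfolding xY_insert cardY
    by (simp add: sq_reflect) (simp add: sq_def)
  show ?thesis
  proof (cases T)
    case TypeA
    show ?thesis
      using vandermonde_laplace[OF fin(1) inj less]
      unfolding xY_insert cardY leading_const_def unfolding TypeA forms_prod_A by (simp add: reflect_1)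
  next
    case TypeD
    show ?thesis
      using V unfolding leading_const_def unfolding TypeD forms_prod_D by (simp add: power_mult)
  next
    case TypeB
    have nm: "n - m = Suc r" using m by simp
    have pr: "(\<Prod>i=Suc m..n. p i) = p x * odd_part p"
      unfolding odd_part_def xY_insert[symmetric] by simp
    have op: "odd_part (reflect 1 x j p) * p j = odd_part p * p x" if "j \<in> Y" for j
      using odd_part_reflect_Y[OF that, of 1 p] by simp
    have "(\<Sum>j\<in>Y. p j ^ (2 * r + 1) * (sqrt 2 ^ r * odd_part (reflect 1 x j p) * vandermonde Y (sq (reflect 1 x j p))))
      = (\<Sum>j\<in>Y. (sqrt 2 ^ r * odd_part p * p x) * ((p j)\<^sup>2 ^ r * vandermonde Y (sq (reflect 1 x j p))))"
    proof (intro sum.cong refl)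
      fix j assume j: "j \<in> Y"
      have "p j ^ (2 * r + 1) * (sqrt 2 ^ r * odd_part (reflect 1 x j p) * V)
        = (sqrt 2 ^ r * (odd_part (reflect 1 x j p) * p j)) * ((p j)\<^sup>2 ^ r * V)" for V
        by (simp add: power_mult)
      thus "p j ^ (2 * r + 1) * (sqrt 2 ^ r * odd_part (reflect 1 x j p) * vandermonde Y (sq (reflect 1 x j p)))
        = (sqrt 2 ^ r * odd_part p * p x) * ((p j)\<^sup>2 ^ r * vandermonde Y (sq (reflect 1 x j p)))"
        unfolding op[OF j] by simp
    qed
    thus ?thesis
      unfolding leading_const_def unfolding TypeB forms_prod_B pr nm V odd_part_def[symmetric]
      by (simp add: power_mult right_diff_distrib sum_distrib_left mult_ac)
  qed
qed

text \<open>The constants of the three lowering lemmas. In type B there are \<open>r + 1\<close>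
  factors \<open>sqrt 2\<close> before and \<open>r\<close> after the lowering, which leaves one of
  them.\<close>

definition lowering_const :: real where
  "lowering_const = (case T of
       TypeA \<Rightarrow> (\<Prod>i=1..r. lower_coeff i)
     | TypeB \<Rightarrow> sqrt 2 * ((\<Prod>i=1..r. 2 * lower_coeff i * (1 + 2 * real i + 2 * (1 + real i + real m) * g))
        * (1 + 2 * (1 + real m) * g))
     | TypeD \<Rightarrow> (\<Prod>i=1..r. 2 * lower_coeff i * (2 * real i - 1 + 2 * (real i + real m) * g)))"

lemma forms_prod_lowering:
  "(dunkl_maps T g n x ^^ step_degree T r) (forms_prod T m n) (\<lambda>p. lowering_const * forms_prod T x n p)"
proof (cases T)
  case TypeA
  have e: "forms_prod TypeA m n = (\<lambda>p. vandermonde (insert x Y) p)"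
    unfolding xY_insert by (rule ext) (rule forms_prod_A)
  show ?thesis using vandermonde_power_A unfolding lowering_const_def
    by (simp add: TypeA forms_prod_A e del: forms_prod.simps)
next
  case TypeD
  have e: "forms_prod TypeD m n = (\<lambda>p. vandermonde (insert x Y) (sq p))"
    unfolding xY_insert by (rule ext) (rule forms_prod_D)
  show ?thesis using vandermonde_power_D unfolding lowering_const_def
    by (simp add: TypeD forms_prod_D e del: forms_prod.simps)
next
  case TypeB
  have nm: "n - m = Suc r" using m by simp
  have e: "forms_prod TypeB m n = (\<lambda>p. sqrt 2 ^ Suc r * (p x * (odd_part p * vandermonde (insert x Y) (sq p))))"
  proof (rule ext)
    fix p
    have "(\<Prod>i=Suc m..n. p i) = p x * odd_part p"
      unfolding odd_part_def xY_insert[symmetric] by simp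
    thus "forms_prod TypeB m n p = sqrt 2 ^ Suc r * (p x * (odd_part p * vandermonde (insert x Y) (sq p)))"
      unfolding forms_prod_B nm xY_insert by (simp only: mult.assoc)
  qed
  have "(\<lambda>p. sqrt 2 ^ Suc r * (C * (odd_part p * vandermonde Y (sq p)))) = (\<lambda>p. sqrt 2 * C * forms_prod TypeB x n p)" for C
    by (rule ext) (simp add: forms_prod_B odd_part_def del: forms_prod.simps)
  thus ?thesis using dunkl_maps_power_cmult[OF vandermonde_power_B, of "sqrt 2 ^ Suc r"]
    unfolding lowering_const_def by (simp add: TypeB e del: forms_prod.simps)
qed

lemma forms_degree_step: "forms_degree T (n - m) = forms_degree T r + step_degree T r"
proof -
  have "n - m = Suc r" using m by simp
  thus ?thesis by (simp add: forms_degree_def)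
qed

text \<open>Only one of the two equal factors is expanded. The swap of \<open>x\<close> and
  \<open>j\<close> carries the term of \<open>j\<close> to the leading one, and the antisymmetry of
  the unexpanded factor cancels the minus sign of the expansion. Hence all \<open>n - m\<close>
  terms have the same integral.\<close>

lemma E_forms_prod_square_step:
  "E (\<lambda>p. (forms_prod T m n p)\<^sup>2)
     = leading_const * real (n - m) * lowering_const * E (\<lambda>p. (forms_prod T x n p)\<^sup>2)"
proof -
  let ?P = "forms_prod T m n" and ?Q = "forms_prod T x n" and ?K = "step_degree T r"
  define A where "A j p = ?P p * (p j ^ ?K * ?Q (reflect 1 x j p))" for j p
  define A0 where "A0 p = ?P p * (p x ^ ?K * ?Q p)" for p
  note PP = poly_less_forms_prod[of n T m] and QQ = poly_less_forms_prod[of n T x]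
  have pw: "poly_less n (Suc (?K * 1)) (\<lambda>p. p j ^ ?K)" if "j \<in> {1..n}" for j
    using poly_less_coord[OF that, of 0] by (intro poly_less_power) simp
  have jn: "j \<in> {1..n}" if "j \<in> Y" for j using that by auto
  obtain dA where dA: "poly_less n dA (A j)" if "j \<in> Y" for j
  proof
    fix j assume "j \<in> Y"
    note j = jn[OF this]
    show "poly_less n (Suc (forms_degree T (n - m)) + (Suc (?K * 1) + forms_degree T (n - x))) (A j)"
      unfolding A_def
      by (rule poly_less_mult[OF PP poly_less_Suc[OF poly_less_mult[OF pw[OF j] poly_less_reflect[OF QQ x_in j]]]])
  qed
  have dA0: "poly_less n (Suc (forms_degree T (n - m)) + (Suc (?K * 1) + forms_degree T (n - x))) A0"
    unfolding A0_def by (rule poly_less_mult[OF PP poly_less_Suc[OF poly_less_mult[OF pw[OF x_in] QQ]]])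
  have sumA: "poly_less n dA (\<lambda>p. \<Sum>j\<in>Y. A j p)" by (rule poly_less_sum[OF dA])
  have Aj: "E (A j) = - E A0" if j: "j \<in> Y" for j
  proof -
    have mir: "(1, j) \<in> mirrors T n x" using j by (cases T) (auto simp: mirrors_def)
    have "?P (reflect 1 x j p) = - ?P p" for p
      using j m by (intro forms_prod_reflect[OF mir]) auto
    moreover have "reflect 1 x j p j = p x" for p by (simp add: reflect_apply)
    moreover have "reflect 1 x j (reflect 1 x j p) = p" for p by (rule reflect_reflect) simp
    ultimately have "A j (reflect 1 x j p) = (-1) * A0 p" for p
      by (simp add: A_def A0_def del: forms_prod.simps)
    hence "E (A j) = E (\<lambda>p. (-1) * A0 p)"
      using E_reflect[of 1 j x "A j"] mir measurable_poly_less[OF dA[OF j]] jn[OF j] x_in by simp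
    thus ?thesis using E_cmult[of "-1" A0] by simp
  qed
  have sq: "poly_less n (Suc (2 * forms_degree T (n - m))) (\<lambda>p. (?P p)\<^sup>2)"
    by (rule poly_less_power[OF PP])
  have "E (\<lambda>p. (?P p)\<^sup>2) = E (\<lambda>p. leading_const * (A0 p - (\<Sum>j\<in>Y. A j p)))"
  proof (rule E_cong[OF _ sq poly_less_cmult])
    show "(?P p)\<^sup>2 = leading_const * (A0 p - (\<Sum>j\<in>Y. A j p))" if "p \<in> generic" for p
    proof -
      have "(?P p)\<^sup>2 = ?P p * (leading_const * (p x ^ ?K * ?Q p - (\<Sum>j\<in>Y. p j ^ ?K * ?Q (reflect 1 x j p))))"
        unfolding power2_eq_square by (subst (2) forms_prod_expansion[OF that]) (rule refl)
      also have "\<dots> = leading_const * (A0 p - (\<Sum>j\<in>Y. A j p))"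
        unfolding A_def A0_def sum_distrib_left[symmetric] by (simp only: right_diff_distrib mult_ac)
      finally show ?thesis .
    qed
    show "poly_less n (max (Suc (forms_degree T (n - m)) + (Suc (?K * 1) + forms_degree T (n - x))) dA)
        (\<lambda>p. A0 p - (\<Sum>j\<in>Y. A j p))"
      by (intro poly_less_diff poly_less_mono[OF dA0] poly_less_mono[OF sumA]) auto
  qed
  also have "\<dots> = leading_const * (E A0 - (\<Sum>j\<in>Y. E (A j)))"
  proof -
    have "E (\<lambda>p. \<Sum>j\<in>Y. A j p) = (\<Sum>j\<in>Y. E (A j))" by (rule E_sum) (rule dA)
    thus ?thesis by (simp only: E_cmult E_diff[OF dA0 sumA])
  qed
  also have "(\<Sum>j\<in>Y. E (A j)) = - (real r * E A0)" using Aj by simp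
  also have "E A0 - - (real r * E A0) = real (n - m) * E A0"
    using m by (simp add: algebra_simps of_nat_diff)
  also have "E A0 = E (\<lambda>p. lowering_const * ?Q p * ?Q p)"
    unfolding A0_def
    by (rule E_dunkl_pairing[OF PP refl QQ _ forms_prod_lowering _ poly_less_cmult[OF QQ], of "forms_degree T (n - m)"])
       (auto intro: E_forms_prod_orthogonal simp: forms_degree_step simp del: forms_prod.simps)
  also have "\<dots> = lowering_const * E (\<lambda>p. (?Q p)\<^sup>2)"
    unfolding E_cmult[symmetric] by (simp only: power2_eq_square mult.assoc)
  finally show ?thesis by simp
qed

end

section \<open>The Bohr-Mollerup argument\<close>

lemma Gamma_log_convex:
  fixes x y t :: real
  assumes "x > 0" "y > 0" "0 \<le> t" "t \<le> 1"
  shows "Gamma ((1 - t) * x + t * y) \<le> Gamma x powr (1 - t) * Gamma y powr t"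
proof -
  have pos: "(1 - t) * x + t * y > 0"
    using assms by (cases "t = 0") (auto intro: add_nonneg_pos)
  have "(ln \<circ> Gamma) ((1 - t) *\<^sub>R x + t *\<^sub>R y) \<le> (1 - t) * (ln \<circ> Gamma) x + t * (ln \<circ> Gamma) y"
    using assms by (intro convex_onD[OF log_convex_Gamma_real]) auto
  hence "ln (Gamma ((1 - t) * x + t * y)) \<le> ln (Gamma x powr (1 - t) * Gamma y powr t)"
    using Gamma_real_pos[OF assms(1)] Gamma_real_pos[OF assms(2)] by (simp add: ln_mult ln_powr)
  thus ?thesis using Gamma_real_pos[OF pos] Gamma_real_pos[OF assms(1)] Gamma_real_pos[OF assms(2)]
    by (subst (asm) ln_le_cancel_iff) auto
qed

text \<open>Log-convexity between x and x + 1 bounds Gamma (x + a) from above; between x + a and x +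
  a + 1, where x + 1 lies, it bounds it from below.\<close>

lemma Gamma_ratio_tendsto_aux:
  fixes a :: real
  assumes "0 \<le> a" "a \<le> 1"
  shows "((\<lambda>x. Gamma (x + a) / (Gamma x * x powr a)) \<longlongrightarrow> 1) at_top"
proof (rule tendsto_sandwich)
  show "\<forall>\<^sub>F x in at_top. (x / (x + a)) powr (1 - a) \<le> Gamma (x + a) / (Gamma x * x powr a)"
    using eventually_gt_at_top[of 0]
  proof eventually_elim
    case (elim x)
    have pos: "Gamma x > 0" "Gamma (x + a) > 0" "Gamma (x + a + 1) > 0" using elim assms by (auto intro: Gamma_real_pos)
    have "Gamma (x + 1) = Gamma ((1 - (1 - a)) * (x + a) + (1 - a) * (x + a + 1))"
      by (rule arg_cong) (simp add: algebra_simps)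
    also have "\<dots> \<le> Gamma (x + a) powr (1 - (1 - a)) * Gamma (x + a + 1) powr (1 - a)"
      using elim assms by (intro Gamma_log_convex) auto
    also have "Gamma (x + a + 1) = (x + a) * Gamma (x + a)"
      using elim assms by (intro Gamma_plus1) (auto elim!: nonpos_Ints_cases)
    also have "Gamma (x + a) powr (1 - (1 - a)) * ((x + a) * Gamma (x + a)) powr (1 - a)
       = Gamma (x + a) * (x + a) powr (1 - a)"
      using elim assms pos by (simp add: powr_mult powr_add[symmetric] mult_ac flip: powr_add)
    also have "Gamma (x + 1) = x * Gamma x"
      using elim by (intro Gamma_plus1) (auto elim!: nonpos_Ints_cases)
    finally have "x * Gamma x \<le> Gamma (x + a) * (x + a) powr (1 - a)" .
    moreover have "x = x powr (1 - a) * x powr a" using elim by (simp flip: powr_add)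
    ultimately have "x powr (1 - a) * (Gamma x * x powr a) \<le> Gamma (x + a) * (x + a) powr (1 - a)"
      by (simp add: mult_ac)
    thus ?case using elim assms pos by (simp add: powr_divide field_simps)
  qed
  show "\<forall>\<^sub>F x in at_top. Gamma (x + a) / (Gamma x * x powr a) \<le> 1"
    using eventually_gt_at_top[of 0]
  proof eventually_elim
    case (elim x)
    have pos: "Gamma x > 0" using elim by (auto intro: Gamma_real_pos)
    have "Gamma (x + a) = Gamma ((1 - a) * x + a * (x + 1))"
      by (rule arg_cong) (simp add: algebra_simps)
    also have "\<dots> \<le> Gamma x powr (1 - a) * Gamma (x + 1) powr a"
      using elim assms by (intro Gamma_log_convex) auto
    also have "Gamma (x + 1) = x * Gamma x"
      using elim by (intro Gamma_plus1) (auto elim!: nonpos_Ints_cases)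
    also have "Gamma x powr (1 - a) * (x * Gamma x) powr a = Gamma x * x powr a"
      using elim pos by (simp add: powr_mult mult_ac flip: powr_add)
    finally show ?case using elim pos by simp
  qed
  have "((\<lambda>x. (x / (x + a)) powr (1 - a)) \<longlongrightarrow> 1 powr (1 - a)) at_top"
  proof (intro tendsto_powr tendsto_const)
    show "((\<lambda>x. x / (x + a)) \<longlongrightarrow> 1) at_top" by real_asymp
  qed auto
  thus "((\<lambda>x. (x / (x + a)) powr (1 - a)) \<longlongrightarrow> 1) at_top" by simp
qed auto

lemma Gamma_ratio_tendsto:
  fixes a :: real
  assumes "0 \<le> a"
  shows "((\<lambda>x. Gamma (x + a) / (Gamma x * x powr a)) \<longlongrightarrow> 1) at_top"
proof -
  have "((\<lambda>x. Gamma (x + (b + real k)) / (Gamma x * x powr (b + real k))) \<longlongrightarrow> 1) at_top"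
    if "0 \<le> b" "b \<le> 1" for b :: real and k
  proof (induction k)
    case 0
    thus ?case using Gamma_ratio_tendsto_aux[OF that] by simp
  next
    case (Suc k)
    let ?c = "b + real k"
    have "((\<lambda>x. Gamma (x + ?c) / (Gamma x * x powr ?c) * ((x + ?c) / x)) \<longlongrightarrow> 1 * 1) at_top"
    proof (intro tendsto_mult Suc.IH)
      show "((\<lambda>x. (x + ?c) / x) \<longlongrightarrow> 1) at_top" by real_asymp
    qed
    moreover have "\<forall>\<^sub>F x in at_top. Gamma (x + ?c) / (Gamma x * x powr ?c) * ((x + ?c) / x)
        = Gamma (x + (b + real (Suc k))) / (Gamma x * x powr (b + real (Suc k)))"
      using eventually_gt_at_top[of 0]
    proof eventually_elim
      case (elim x)
      have "Gamma (x + ?c + 1) = (x + ?c) * Gamma (x + ?c)"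
        using elim that by (intro Gamma_plus1) (auto elim!: nonpos_Ints_cases)
      moreover have e: "b + real (Suc k) = ?c + 1" by simp
      moreover have "x powr (?c + 1) = x powr ?c * x"
        using elim by (simp add: powr_add)
      ultimately show ?case unfolding e add.assoc[symmetric] by (simp add: mult_ac)
    qed
    ultimately show ?case by (simp add: tendsto_cong)
  qed
  from this[of "frac a" "nat \<lfloor>a\<rfloor>"] assms show ?thesis
    by (simp add: frac_def frac_ge_0 less_imp_le[OF frac_lt_1, unfolded frac_def])
qed

text \<open>\<open>L\<close> takes the place that the argument x has for Gamma itself: it measures
  the growth of \<open>G\<close> per unit step. Log-convexity encloses F (y + \<theta>) / F y
  between \<open>\<rho> y * \<rho> (y + \<theta>) powr (\<theta> - 1)\<close> and
  \<open>\<rho> y powr \<theta>\<close>. Since \<open>\<rho>\<close> is asymptotic to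
  \<open>L\<close>, which hardly varies over bounded steps, both bounds grow like
  \<open>L y powr \<theta>\<close>, as \<open>G\<close> does. So \<open>H\<close> tends to 1; it
  also has period 1, hence equals 1.\<close>

lemma bohr_mollerup_ratio:
  fixes F G L :: "real \<Rightarrow> real"
  assumes pos: "\<And>x. x > 1 \<Longrightarrow> F x > 0" "\<And>x. x > 1 \<Longrightarrow> G x > 0" "\<And>x. x > 1 \<Longrightarrow> L x > 0"
    and rec: "\<And>x. x > 1 \<Longrightarrow> F (x + 1) / F x = G (x + 1) / G x"
    and conv: "\<And>x y t. x > 1 \<Longrightarrow> y > 1 \<Longrightarrow> 0 \<le> t \<Longrightarrow> t \<le> 1 \<Longrightarrow>
        F ((1 - t) * x + t * y) \<le> F x powr (1 - t) * F y powr t"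
    and asym: "\<And>a. a \<ge> 0 \<Longrightarrow> ((\<lambda>x. G (x + a) / (G x * L x powr a)) \<longlongrightarrow> 1) at_top"
    and L: "\<And>a. a \<ge> 0 \<Longrightarrow> ((\<lambda>x. L (x + a) / L x) \<longlongrightarrow> 1) at_top"
    and x: "x > 1" and \<theta>: "0 \<le> \<theta>" "\<theta> \<le> 1"
  shows "F (x + \<theta>) / G (x + \<theta>) = F x / G x"
proof -
  define \<rho> where "\<rho> y = F (y + 1) / F y" for y
  define A where "A a y = G (y + a) / (G y * L y powr a)" for a y
  define H where "H y = (F (y + \<theta>) / F y) / (G (y + \<theta>) / G y)" for y
  have A1: "\<rho> y = A 1 y * L y" if "y > 1" for y
    using rec[OF that] pos(2,3)[OF that] by (simp add: \<rho>_def A_def)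
  have \<rho>_pos: "\<rho> y > 0" if "y > 1" for y using pos(1)[of y] pos(1)[of "y + 1"] that by (simp add: \<rho>_def)
  have A_pos: "A a y > 0" if "y > 1" "a \<ge> 0" for a y
    using pos(2)[of y] pos(2)[of "y + a"] pos(3)[of y] that by (simp add: A_def)
  have HA: "H y = (F (y + \<theta>) / F y) / (A \<theta> y * L y powr \<theta>)" if "y > 1" for y
    using pos(2)[OF that] pos(3)[OF that] by (simp add: H_def A_def)
  have "(H \<longlongrightarrow> 1) at_top"
  proof (rule tendsto_sandwich)
    show "\<forall>\<^sub>F y in at_top. H y \<le> A 1 y powr \<theta> / A \<theta> y"
      using eventually_gt_at_top[of 1]
    proof eventually_elim
      case (elim y)
      have "F (y + \<theta>) = F ((1 - \<theta>) * y + \<theta> * (y + 1))" by (rule arg_cong) (simp add: algebra_simps)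
      also have "\<dots> \<le> F y powr (1 - \<theta>) * F (y + 1) powr \<theta>" using elim \<theta> by (intro conv) auto
      also have "F (y + 1) = \<rho> y * F y" using pos(1)[OF elim] by (simp add: \<rho>_def)
      also have "F y powr (1 - \<theta>) * (\<rho> y * F y) powr \<theta> = \<rho> y powr \<theta> * F y"
        using pos(1)[OF elim] \<rho>_pos[OF elim] by (simp add: powr_mult mult_ac flip: powr_add)
      finally have "F (y + \<theta>) / F y \<le> \<rho> y powr \<theta>" using pos(1)[OF elim] by (simp add: field_simps)
      also have "\<rho> y powr \<theta> = A 1 y powr \<theta> * L y powr \<theta>"
        unfolding A1[OF elim] using A_pos[of y 1] pos(3)[OF elim] elim by (simp add: powr_mult)
      finally have "F (y + \<theta>) / F y / (A \<theta> y * L y powr \<theta>) \<le> A 1 y powr \<theta> * L y powr \<theta> / (A \<theta> y * L y powr \<theta>)"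
        using A_pos[OF elim \<theta>(1)] by (intro divide_right_mono) auto
      thus ?case unfolding HA[OF elim] using pos(3)[OF elim] by simp
    qed
    show "\<forall>\<^sub>F y in at_top. A 1 y * (A 1 (y + \<theta>) * (L (y + \<theta>) / L y)) powr (\<theta> - 1) / A \<theta> y \<le> H y"
      using eventually_gt_at_top[of 1]
    proof eventually_elim
      case (elim y)
      have y\<theta>: "y + \<theta> > 1" using elim \<theta> by simp
      note p = pos(1)[OF elim] pos(1)[OF y\<theta>] \<rho>_pos[OF elim] \<rho>_pos[OF y\<theta>] pos(3)[OF elim] pos(3)[OF y\<theta>]
        A_pos[OF elim \<theta>(1)] A_pos[OF elim, of 1] A_pos[OF y\<theta>, of 1]
      \<comment> \<open>The lower bound uses that \<open>y + 1\<close> lies between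
        \<open>y + \<theta>\<close> and \<open>y + \<theta> + 1\<close>.\<close>
      have "F (y + 1) = F ((1 - (1 - \<theta>)) * (y + \<theta>) + (1 - \<theta>) * (y + \<theta> + 1))"
        by (rule arg_cong) (simp add: algebra_simps)
      also have "\<dots> \<le> F (y + \<theta>) powr (1 - (1 - \<theta>)) * F (y + \<theta> + 1) powr (1 - \<theta>)"
        using elim \<theta> by (intro conv) auto
      also have "F (y + \<theta> + 1) = \<rho> (y + \<theta>) * F (y + \<theta>)" using p by (simp add: \<rho>_def)
      also have "F (y + \<theta>) powr (1 - (1 - \<theta>)) * (\<rho> (y + \<theta>) * F (y + \<theta>)) powr (1 - \<theta>)
          = \<rho> (y + \<theta>) powr (1 - \<theta>) * F (y + \<theta>)"
        using p by (simp add: powr_mult mult_ac flip: powr_add)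
      also have "F (y + 1) = \<rho> y * F y" using p by (simp add: \<rho>_def)
      finally have "\<rho> y * F y \<le> \<rho> (y + \<theta>) powr (1 - \<theta>) * F (y + \<theta>)" .
      hence "\<rho> y * \<rho> (y + \<theta>) powr (\<theta> - 1) \<le> F (y + \<theta>) / F y"
      proof -
        assume a: "\<rho> y * F y \<le> \<rho> (y + \<theta>) powr (1 - \<theta>) * F (y + \<theta>)"
        have "\<rho> (y + \<theta>) powr (\<theta> - 1) * (\<rho> y * F y) \<le> \<rho> (y + \<theta>) powr (\<theta> - 1) * (\<rho> (y + \<theta>) powr (1 - \<theta>) * F (y + \<theta>))"
          using a by (intro mult_left_mono) auto
        also have "\<dots> = F (y + \<theta>)" using p by (simp add: mult.assoc[symmetric] flip: powr_add)
        finally show ?thesis using p by (simp add: field_simps)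
      qed
      moreover have "\<rho> y * \<rho> (y + \<theta>) powr (\<theta> - 1)
          = A 1 y * (A 1 (y + \<theta>) * (L (y + \<theta>) / L y)) powr (\<theta> - 1) * L y powr \<theta>"
      proof -
        have "\<rho> (y + \<theta>) = (A 1 (y + \<theta>) * (L (y + \<theta>) / L y)) * L y" unfolding A1[OF y\<theta>] using p by simp
        hence "\<rho> (y + \<theta>) powr (\<theta> - 1) = (A 1 (y + \<theta>) * (L (y + \<theta>) / L y)) powr (\<theta> - 1) * L y powr (\<theta> - 1)"
          using p by (simp only: powr_mult mult_nonneg_nonneg divide_nonneg_nonneg less_imp_le)
        moreover have "L y * L y powr (\<theta> - 1) = L y powr \<theta>" using p by (simp add: powr_mult_base)
        ultimately show ?thesis unfolding A1[OF elim] by (simp add: mult_ac)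
      qed
      ultimately have "A 1 y * (A 1 (y + \<theta>) * (L (y + \<theta>) / L y)) powr (\<theta> - 1) * L y powr \<theta> / (A \<theta> y * L y powr \<theta>)
          \<le> F (y + \<theta>) / F y / (A \<theta> y * L y powr \<theta>)"
        using p by (intro divide_right_mono) auto
      thus ?case unfolding HA[OF elim] using p by simp
    qed
    have A_lim: "((\<lambda>y. A a y) \<longlongrightarrow> 1) at_top" if "a \<ge> 0" for a using asym[OF that] by (simp add: A_def)
    have A_shift: "((\<lambda>y. A 1 (y + \<theta>)) \<longlongrightarrow> 1) at_top"
    proof (rule filterlim_compose[OF A_lim])
      show "filterlim (\<lambda>y. y + \<theta>) at_top at_top" by real_asymp
    qed simp
    have "((\<lambda>y. A 1 y powr \<theta> / A \<theta> y) \<longlongrightarrow> 1 powr \<theta> / 1) at_top"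
      using \<theta> by (intro tendsto_intros A_lim) auto
    thus "((\<lambda>y. A 1 y powr \<theta> / A \<theta> y) \<longlongrightarrow> 1) at_top" by simp
    have "((\<lambda>y. A 1 y * (A 1 (y + \<theta>) * (L (y + \<theta>) / L y)) powr (\<theta> - 1) / A \<theta> y)
        \<longlongrightarrow> 1 * (1 * 1) powr (\<theta> - 1) / 1) at_top"
      using \<theta> by (intro tendsto_divide tendsto_mult tendsto_powr A_lim A_shift L tendsto_const) auto
    thus "((\<lambda>y. A 1 y * (A 1 (y + \<theta>) * (L (y + \<theta>) / L y)) powr (\<theta> - 1) / A \<theta> y) \<longlongrightarrow> 1) at_top"
      by simp
  qed
  moreover have "filterlim (\<lambda>k. x + real k) at_top sequentially" by real_asymp
  ultimately have "(\<lambda>k. H (x + real k)) \<longlonglongrightarrow> 1" by (rule filterlim_compose)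
  moreover have "H (x + real k) = H x" for k
  proof (induction k)
    case (Suc k)
    let ?y = "x + real k"
    have y: "?y > 1" "?y + \<theta> > 1" using x \<theta> by auto
    have f: "F (u + 1) = F u * (G (u + 1) / G u)" if "u > 1" for u
      using rec[OF that] pos(1)[OF that] by (simp add: field_simps)
    have s: "?y + 1 + \<theta> = ?y + \<theta> + 1" by simp
    have "H (?y + 1) = H ?y"
      unfolding H_def s f[OF y(1)] f[OF y(2)]
      using pos(1,2)[OF y(1)] pos(1,2)[OF y(2)] pos(2)[of "?y + 1"] pos(2)[of "?y + \<theta> + 1"] y
      by (simp add: field_simps)
    moreover have "x + real (Suc k) = ?y + 1" by simp
    ultimately show ?case using Suc.IH by (simp only:)
  qed simp
  ultimately have "H x = 1" by (simp add: LIMSEQ_const_iff)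
  moreover have "x + \<theta> > 1" using x \<theta> by simp
  ultimately show ?thesis
    using pos(1,2)[OF x] pos(1,2)[of "x + \<theta>"] by (simp add: H_def field_simps)
qed

text \<open>Polymorphic, so that the real recursion and the complex claim share one expression. At
  \<open>m = n\<close> the second product is empty, and \<open>n - m\<close> is the rank parameter
  of the subgroup.\<close>

definition mehta_rhs :: "refl_type \<Rightarrow> nat \<Rightarrow> nat \<Rightarrow> 'a::Gamma \<Rightarrow> 'a" where
  "mehta_rhs T n m \<gamma> =
     (\<Prod>i=1..m. Gamma (1 + of_nat (refl_degree T n i) * \<gamma>) / Gamma (1 + \<gamma>))
     * (\<Prod>j=1..n - m. of_nat j * (1 + \<gamma>) / (of_nat j + of_nat (m + j) * \<gamma>)
          * (Gamma (1 + of_nat (refl_degree T (n - m) j) + of_nat (refl_degree T n (m + j)) * \<gamma>)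
             / Gamma (2 + \<gamma>)))"

lemma Gamma_add_nat_real:
  fixes z :: real
  assumes "z > 0"
  shows "Gamma (z + 1) = z * Gamma z" "Gamma (z + 2) = (z + 1) * (z * Gamma z)"
proof -
  have *: "Gamma (z + 1) = z * Gamma z" if "z > 0" for z :: real
    using that by (intro Gamma_plus1) (auto elim!: nonpos_Ints_cases)
  show "Gamma (z + 1) = z * Gamma z" by (rule *[OF assms])
  show "Gamma (z + 2) = (z + 1) * (z * Gamma z)"
    using *[of z] *[of "z + 1"] assms by (simp add: add.assoc)
qed

section \<open>The recursion of the product of Gamma functions\<close>

context parabolic_step
begin

definition gamma_factor :: "refl_type \<Rightarrow> nat \<Rightarrow> nat \<Rightarrow> real" where
  "gamma_factor T l j = real j / (real j + real (l + j) * g)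
     * (Gamma (1 + real (refl_degree T (n - l) j) + real (refl_degree T n (l + j)) * g) / Gamma (1 + g))"

lemma mehta_rhs_real:
  "mehta_rhs T n l g = (\<Prod>i=1..l. Gamma (1 + real (refl_degree T n i) * g) / Gamma (1 + g))
     * (\<Prod>j=1..n - l. gamma_factor T l j)"
proof -
  have "1 + g > 0" using g0 by simp
  from Gamma_add_nat_real(1)[OF this] have G2: "Gamma (2 + g) = (1 + g) * Gamma (1 + g)"
    by (simp add: add_ac)
  have "real j * (1 + g) / (real j + real (l + j) * g)
          * (Gamma (1 + real (refl_degree T (n - l) j) + real (refl_degree T n (l + j)) * g) / Gamma (2 + g))
       = gamma_factor T l j" for j
    using \<open>1 + g > 0\<close> unfolding G2 gamma_factor_def by simp
  thus ?thesis by (simp only: mehta_rhs_def)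
qed

definition odd_coeff :: "nat \<Rightarrow> real" where
  "odd_coeff k = 1 + 2 * real k + 2 * (1 + real k + real m) * g"

text \<open>The share of the lowering constant that belongs to the index \<open>k\<close>. The value
  1 replaces \<open>lower_coeff 0\<close>, which is 0. In type D the last degree, reached at
  \<open>k = r\<close>, leaves the pattern of even numbers, and the factor
  \<open>2 * odd_coeff k\<close> is absent.\<close>

definition step_factor :: "refl_type \<Rightarrow> nat \<Rightarrow> real" where
  "step_factor T k = (if T = TypeA \<or> T = TypeD \<and> k = r then (if k = 0 then 1 else lower_coeff k)
      else 2 * (if k = 0 then 1 else lower_coeff k) * odd_coeff k)"

text \<open>From \<open>m\<close> to \<open>Suc m\<close> the index 1 of the second product moves to
  the end of the first one. The subgroup degree there is 1 or 2, so the functional equation of Gamma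
  is applied once or twice; degree 1 includes type D with a single coordinate.\<close>

lemma gamma_factor_0:
  "gamma_factor T m 1 = step_factor T 0 * (Gamma (1 + real (refl_degree T n x) * g) / Gamma (1 + g))"
proof -
  have nm: "n - m = Suc r" using m by simp
  have r0: "r = 0 \<longleftrightarrow> x = n" using m by auto
  have idx: "m + 1 = x" by simp
  have z: "1 + real (refl_degree T n x) * g > 0" using g0 by (simp add: add_pos_nonneg)
  define u where "u = real x * g"
  have c: "1 + u \<noteq> 0" using g0 unfolding u_def by (simp add: add_pos_nonneg less_imp_neq[symmetric])
  show ?thesis
  proof (cases "T = TypeA \<or> T = TypeD \<and> r = 0")
    case True
    hence d: "refl_degree T (n - m) 1 = 1" "refl_degree T n x = x" using nm r0 by auto
    have "1 + real 1 + u = (1 + u) + 1" by simp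
    hence G: "Gamma (1 + real 1 + u) = (1 + u) * Gamma (1 + u)"
      using Gamma_add_nat_real(1)[OF z] unfolding d u_def by (simp only:)
    have sf: "step_factor T 0 = 1" using True by (auto simp: step_factor_def)
    show ?thesis unfolding gamma_factor_def idx d sf u_def[symmetric] G using c by simp
  next
    case False
    hence d: "refl_degree T (n - m) 1 = 2" "refl_degree T n x = 2 * x" using nm r0
      by (cases T; auto)+
    have o: "1 + real (2 * x) * g = odd_coeff 0" unfolding odd_coeff_def by simp
    have "1 + real 2 + real (2 * x) * g = (1 + real (2 * x) * g) + 2" by simp
    hence G: "Gamma (1 + real 2 + real (2 * x) * g) = 2 * (1 + u) * (odd_coeff 0 * Gamma (odd_coeff 0))"
      using Gamma_add_nat_real(2)[OF z] unfolding d o u_def[symmetric]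
      by (simp add: o[symmetric] u_def algebra_simps)
    have sf: "step_factor T 0 = 2 * odd_coeff 0" using False by (auto simp: step_factor_def)
    have "real 1 / b * (2 * b * (w * X) / H) = 2 * w * (X / H)" if "b \<noteq> 0" for b w X H :: real
      using that by simp
    from this[of "1 + u"] show ?thesis unfolding gamma_factor_def idx d sf G o u_def[symmetric] using c by simp
  qed
qed

text \<open>Index \<open>Suc k\<close> for \<open>m\<close> corresponds to \<open>k\<close> for
  \<open>Suc m\<close>: the degree of the whole group is the same, that of the subgroup falls by 1
  or 2. The quotients (k + 1) / k telescope to \<open>n - m\<close>, the number of equal terms in
  the recursion of the integral.\<close>

lemma gamma_factor_Suc:
  assumes "1 \<le> k" "k \<le> r"
  shows "gamma_factor T m (Suc k) = (real (Suc k) / real k) * step_factor T k * gamma_factor T x k"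
proof -
  have nm: "n - m = Suc r" using m by simp
  have idx: "m + Suc k = x + k" by simp
  let ?z = "1 + real (refl_degree T r k) + real (refl_degree T n (x + k)) * g"
  have z: "?z > 0" using g0 by (simp add: add_pos_nonneg)
  define u where "u = real (x + k) * g"
  have c1: "real (Suc k) + u \<noteq> 0" using g0 unfolding u_def by (simp add: add_pos_nonneg less_imp_neq[symmetric])
  have c2: "real k + u \<noteq> 0" using g0 assms(1) unfolding u_def by (intro less_imp_neq[symmetric] add_pos_nonneg) auto
  have c3: "real k \<noteq> 0" using assms by simp
  have lc: "lower_coeff k = real k + u" using assms by (simp add: lower_coeff_def u_def algebra_simps)
  show ?thesis
  proof (cases "T = TypeA \<or> T = TypeD \<and> k = r")
    case True
    hence d: "refl_degree T (Suc r) (Suc k) = Suc k" "refl_degree T r k = k" "refl_degree T n (x + k) = x + k"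
      using m by auto
    have "1 + real (Suc k) + u = (1 + real k + u) + 1" by simp
    hence G: "Gamma (1 + real (Suc k) + u) = (real (Suc k) + u) * Gamma (1 + real k + u)"
      using Gamma_add_nat_real(1)[OF z] unfolding d u_def[symmetric] by (simp only: of_nat_Suc add_ac)
    have sf: "step_factor T k = real k + u" using True assms lc by (auto simp: step_factor_def)
    have "A / (A + u) * ((A + u) * X / H) = (A / K) * (K + u) * (K / (K + u) * (X / H))"
      if "A + u \<noteq> 0" "K + u \<noteq> 0" "K \<noteq> 0" for A K X H :: real using that by simp
    from this[OF c1 c2 c3] show ?thesis
      unfolding gamma_factor_def nm idx d sf u_def[symmetric] G by this
  next
    case False
    hence d: "refl_degree T (Suc r) (Suc k) = 2 * k + 2" "refl_degree T r k = 2 * k"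
        "refl_degree T n (x + k) = 2 * (x + k)"
      using m assms by (cases T; auto)+
    have o: "1 + real (2 * k) + real (2 * (x + k)) * g = odd_coeff k"
      unfolding odd_coeff_def by (simp add: algebra_simps)
    have "1 + real (2 * k + 2) + real (2 * (x + k)) * g = (1 + real (2 * k) + real (2 * (x + k)) * g) + 2" by simp
    hence "Gamma (1 + real (2 * k + 2) + real (2 * (x + k)) * g) = (odd_coeff k + 1) * (odd_coeff k * Gamma (odd_coeff k))"
      using Gamma_add_nat_real(2)[OF z] unfolding d o by (simp only:)
    moreover have "odd_coeff k + 1 = 2 * (real (Suc k) + u)"
      unfolding odd_coeff_def u_def by (simp add: algebra_simps)
    ultimately have G: "Gamma (1 + real (2 * k + 2) + real (2 * (x + k)) * g)
        = 2 * (real (Suc k) + u) * (odd_coeff k * Gamma (odd_coeff k))" by (simp only:)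
    have sf: "step_factor T k = 2 * (real k + u) * odd_coeff k"
      using False assms lc by (auto simp: step_factor_def)
    have "A / a * (2 * a * (w * X) / H) = (A / K) * (2 * b * w) * (K / b * (X / H))"
      if "a \<noteq> 0" "b \<noteq> 0" "K \<noteq> 0" for A K X H w a b :: real using that by simp
    from this[OF c1 c2 c3] show ?thesis
      unfolding gamma_factor_def nm idx d sf G o u_def[symmetric] by this
  qed
qed

lemma mehta_rhs_step:
  "mehta_rhs T n m g = real (n - m) * (step_factor T 0 * (\<Prod>k=1..r. step_factor T k)) * mehta_rhs T n x g"
proof -
  have nm: "n - m = Suc r" using m by simp
  have tel: "(\<Prod>k=1..N. real (Suc k) / real k) = real (Suc N)" for N
    by (induction N) auto
  let ?H = "\<lambda>i. Gamma (1 + real (refl_degree T n i) * g) / Gamma (1 + g)"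
  have "(\<Prod>j=1..n - m. gamma_factor T m j) = gamma_factor T m 1 * (\<Prod>j=1..r. gamma_factor T m (Suc j))"
    unfolding nm One_nat_def by (subst prod.atLeast_Suc_atMost) (simp_all add: prod.shift_bounds_cl_Suc_ivl del: prod.cl_ivl_Suc)
  also have "(\<Prod>j=1..r. gamma_factor T m (Suc j))
     = (\<Prod>j=1..r. (real (Suc j) / real j) * step_factor T j * gamma_factor T x j)"
    by (intro prod.cong refl gamma_factor_Suc) auto
  also have "\<dots> = real (n - m) * (\<Prod>k=1..r. step_factor T k) * (\<Prod>j=1..r. gamma_factor T x j)"
    unfolding prod.distrib tel nm ..
  finally have "mehta_rhs T n m g = (\<Prod>i=1..m. ?H i) * (step_factor T 0 * ?H x
      * (real (n - m) * (\<Prod>k=1..r. step_factor T k) * (\<Prod>j=1..r. gamma_factor T x j)))"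
    unfolding mehta_rhs_real gamma_factor_0 by simp
  also have "\<dots> = real (n - m) * (step_factor T 0 * (\<Prod>k=1..r. step_factor T k))
      * (((\<Prod>i=1..m. ?H i) * ?H x) * (\<Prod>j=1..r. gamma_factor T x j))"
    by (simp only: mult_ac)
  also have "(\<Prod>i=1..m. ?H i) * ?H x = (\<Prod>i=1..x. ?H i)" by simp
  also have "(\<Prod>i=1..x. ?H i) * (\<Prod>j=1..r. gamma_factor T x j) = mehta_rhs T n x g"
    unfolding mehta_rhs_real ..
  finally show ?thesis .
qed

end

text \<open>In type B the two factors \<open>sqrt 2\<close>, from the expansion and from the
  lowering, multiply to the 2 at index 0. In type D the odd coefficients run from 0 to
  \<open>r - 1\<close> and the lower ones from 1 to \<open>r\<close>, so the factors have to be
  paired anew with a shift by one.\<close>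

lemma (in weighted_step) step_const:
  "leading_const * lowering_const = step_factor T 0 * (\<Prod>k=1..r. step_factor T k)"
proof -
  consider "T = TypeA" | "T = TypeD" | "T = TypeB" by (cases T) auto
  thus ?thesis
  proof cases
    case 1
    have "(\<Prod>k=1..r. step_factor T k) = (\<Prod>k=1..r. lower_coeff k)"
      using 1 by (intro prod.cong) (auto simp: step_factor_def)
    thus ?thesis unfolding leading_const_def lowering_const_def using 1 by (simp add: step_factor_def)
  next
    case 3
    have "(\<Prod>k=1..r. step_factor T k) = (\<Prod>i=1..r. 2 * lower_coeff i * (1 + 2 * real i + 2 * (1 + real i + real m) * g))"
      using 3 by (intro prod.cong) (auto simp: step_factor_def odd_coeff_def)
    moreover have "step_factor T 0 = 2 * (1 + 2 * (1 + real m) * g)"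
      using 3 by (simp add: step_factor_def odd_coeff_def)
    moreover have "leading_const * lowering_const
      = sqrt 2 * (sqrt 2 * ((\<Prod>i=1..r. 2 * lower_coeff i * (1 + 2 * real i + 2 * (1 + real i + real m) * g))
          * (1 + 2 * (1 + real m) * g)))"
      unfolding leading_const_def lowering_const_def using 3 by simp
    moreover have "sqrt 2 * (sqrt 2 * (P * u)) = 2 * u * P" for P u
      by (simp add: mult_ac)
    ultimately show ?thesis by (simp only:)
  next
    case 2
    have lo: "leading_const * lowering_const = (\<Prod>i=1..r. 2 * lower_coeff i * odd_coeff (i - 1))"
    proof -
      have "(\<Prod>i=1..r. 2 * lower_coeff i * (2 * real i - 1 + 2 * (real i + real m) * g))
         = (\<Prod>i=1..r. 2 * lower_coeff i * odd_coeff (i - 1))"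
        by (intro prod.cong refl arg_cong2[where f = "(*)"]) (auto simp: odd_coeff_def of_nat_diff algebra_simps)
      thus ?thesis unfolding leading_const_def lowering_const_def using 2 by simp
    qed
    show ?thesis
    proof (cases "r = 0")
      case True
      thus ?thesis unfolding lo using 2 by (simp add: step_factor_def)
    next
      case False
      then obtain s where s: "r = Suc s" by (cases r) auto
      have "(\<Prod>i=1..r. 2 * lower_coeff i * odd_coeff (i - 1))
        = (\<Prod>i=1..r. 2 * lower_coeff i) * (\<Prod>k=0..s. odd_coeff k)"
      proof -
        have "(\<Prod>i=1..r. odd_coeff (i - 1)) = (\<Prod>k=0..s. odd_coeff k)"
          unfolding s One_nat_def by (subst prod.shift_bounds_cl_Suc_ivl) simp
        thus ?thesis by (simp only: prod.distrib)
      qed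
      also have "\<dots> = 2 * odd_coeff 0 * (\<Prod>i=1..s. 2 * lower_coeff i * odd_coeff i) * lower_coeff r"
        unfolding s by (simp add: prod.atLeast_Suc_atMost[of 0 s] prod.distrib del: prod.cl_ivl_Suc)
          (simp add: mult_ac)
      also have "(\<Prod>i=1..s. 2 * lower_coeff i * odd_coeff i) = (\<Prod>k=1..s. step_factor T k)"
        using 2 s by (intro prod.cong) (auto simp: step_factor_def)
      also have "2 * odd_coeff 0 = step_factor T 0" using 2 s by (simp add: step_factor_def)
      also have "lower_coeff r = step_factor T r" using 2 s by (simp add: step_factor_def)
      finally show ?thesis unfolding lo s by (simp add: mult.assoc)
    qed
  qed
qed

section \<open>Real parameters: recursion, functional equation and log-convexity\<close>

definition mehta_integral :: "refl_type \<Rightarrow> nat \<Rightarrow> nat \<Rightarrow> real \<Rightarrow> real" where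
  "mehta_integral T n m g = (LINT p|gaussian_measure n. (forms_prod T m n p)\<^sup>2 * \<bar>forms_prod T 0 n p\<bar> powr (2 * g))"

lemma forms_prod_full: "forms_prod T n n p = 1"
  by (cases T) (simp_all only: forms_prod_A forms_prod_B forms_prod_D, auto simp: vandermonde_def)

lemma mehta_integral_step:
  assumes "m < n" "g > 1"
  shows "mehta_integral T n m g * mehta_rhs T n (Suc m) g = mehta_rhs T n m g * mehta_integral T n (Suc m) g"
proof -
  interpret weighted_step g n m T using assms by unfold_locales auto
  have "E (\<lambda>p. (forms_prod T l n p)\<^sup>2) = mehta_integral T n l g" for l
    by (simp add: E_def weight_def mehta_integral_def del: forms_prod.simps)
  hence "mehta_integral T n m g = leading_const * real (n - m) * lowering_const * mehta_integral T n (Suc m) g"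
    using E_forms_prod_square_step by simp
  also have "\<dots> = real (n - m) * (leading_const * lowering_const) * mehta_integral T n (Suc m) g"
    by (simp only: mult_ac)
  finally show ?thesis unfolding mehta_rhs_step[of T] step_const by (simp only: mult_ac)
qed

lemma mehta_rhs_pos:
  fixes g :: real
  assumes "g > 0"
  shows "mehta_rhs T n m g > 0"
  unfolding mehta_rhs_def using assms
  by (intro mult_pos_pos prod_pos divide_pos_pos ballI Gamma_real_pos add_pos_nonneg add_nonneg_pos) auto

lemma mehta_integral_eq:
  assumes "m \<le> n" "g > 1"
  shows "mehta_integral T n m g = mehta_rhs T n m g * (mehta_integral T n n g / mehta_rhs T n n g)"
  using assms(1)
proof (induction rule: inc_induct)
  case base
  show ?case using mehta_rhs_pos[of g T n n] assms by simp
next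
  case (step m)
  have p: "mehta_rhs T n (Suc m) g > 0" using assms by (intro mehta_rhs_pos) auto
  have "mehta_integral T n m g * mehta_rhs T n (Suc m) g
      = (mehta_rhs T n m g * (mehta_integral T n n g / mehta_rhs T n n g)) * mehta_rhs T n (Suc m) g"
    unfolding mehta_integral_step[OF step(2) assms(2)] step.IH by (simp only: mult_ac)
  thus ?case by (rule mult_right_cancel[THEN iffD1, rotated]) (use p in simp)
qed

text \<open>For \<open>m = 0\<close> group and subgroup have the same degrees: the fraction in front
  of Gamma becomes 1, and the two degrees combine to one degree times \<open>g + 1\<close>.\<close>

lemma mehta_rhs_0:
  fixes g :: real
  assumes "g > 0"
  shows "mehta_rhs T n 0 g = mehta_rhs T n n (g + 1)"
proof -
  have "(\<Prod>j=1..n. real j * (1 + g) / (real j + real j * g)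
          * (Gamma (1 + real (refl_degree T n j) + real (refl_degree T n j) * g) / Gamma (2 + g)))
      = (\<Prod>j=1..n. Gamma (1 + real (refl_degree T n j) * (g + 1)) / Gamma (1 + (g + 1)))"
  proof (intro prod.cong refl)
    fix j assume j: "j \<in> {1..n}"
    have "real j * (1 + g) \<noteq> 0" using j assms by auto
    hence "real j * (1 + g) / (real j + real j * g) = 1" by (simp add: distrib_left)
    moreover have "1 + real (refl_degree T n j) + real (refl_degree T n j) * g = 1 + real (refl_degree T n j) * (g + 1)"
      by (simp add: algebra_simps)
    moreover have "2 + g = 1 + (g + 1)" by simp
    ultimately show "real j * (1 + g) / (real j + real j * g)
          * (Gamma (1 + real (refl_degree T n j) + real (refl_degree T n j) * g) / Gamma (2 + g))
        = Gamma (1 + real (refl_degree T n j) * (g + 1)) / Gamma (1 + (g + 1))" by (simp only: mult_1_left)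
  qed
  thus ?thesis by (simp add: mehta_rhs_def)
qed

lemma mehta_integral_0: "mehta_integral T n 0 g = mehta_integral T n n (g + 1)"
proof -
  have "u\<^sup>2 * \<bar>u\<bar> powr (2 * g) = \<bar>u\<bar> powr (2 * (g + 1))" for u :: real
    by (cases "u = 0") (auto simp: powr_add distrib_left)
  thus ?thesis by (simp only: mehta_integral_def forms_prod_full) simp
qed

lemma integrable_abs_forms_powr:
  "a \<ge> 0 \<Longrightarrow> integrable (gaussian_measure n) (\<lambda>p. \<bar>forms_prod T 0 n p\<bar> powr a)"
  using integrable_poly_powr[OF poly_less.const[of n 0 1] poly_less_forms_prod] by simp

lemma mehta_integral_n: "mehta_integral T n n g = (LINT p|gaussian_measure n. \<bar>forms_prod T 0 n p\<bar> powr (2 * g))"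
  by (simp add: mehta_integral_def forms_prod_full del: forms_prod.simps)

lemma mehta_integral_pos:
  assumes "g \<ge> 0"
  shows "mehta_integral T n n g > 0"
proof -
  let ?f = "\<lambda>p. \<bar>forms_prod T 0 n p\<bar> powr (2 * g)"
  have "mehta_integral T n n g \<noteq> 0"
  proof
    assume "mehta_integral T n n g = 0"
    hence "AE p in gaussian_measure n. ?f p = 0"
      using integral_nonneg_eq_0_iff_AE[OF integrable_abs_forms_powr[of "2 * g" n T]] assms
      by (simp add: mehta_integral_n del: forms_prod.simps)
    hence "AE p in gaussian_measure n. False"
      using AE_generic_points[of n] by eventually_elim (use forms_prod_nonzero in auto)
    thus False by (rule gaussian.AE_contr) simp
  qed
  moreover have "mehta_integral T n n g \<ge> 0" by (simp add: mehta_integral_n del: forms_prod.simps)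
  ultimately show ?thesis by linarith
qed

lemma weighted_am_gm:
  fixes a b t :: real
  assumes "a \<ge> 0" "b \<ge> 0" "0 \<le> t" "t \<le> 1"
  shows "a powr (1 - t) * b powr t \<le> (1 - t) * a + t * b"
proof (cases "a = 0 \<or> b = 0 \<or> t = 0 \<or> t = 1")
  case True
  thus ?thesis using assms by auto
next
  case False
  hence "a > 0" "b > 0" "0 < t" "t < 1" using assms by auto
  thus ?thesis using Youngs_inequality_0[of "1 - t" t a b] by simp
qed

text \<open>The inequality of Hoelder, obtained by integrating the weighted inequality of arithmetic
  and geometric means for integrands normalised to integral 1.\<close>

lemma mehta_integral_log_convex:
  assumes x: "x > 0" and y: "y > 0" and t: "0 \<le> t" "t \<le> 1"
  shows "mehta_integral T n n ((1 - t) * x + t * y)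
     \<le> mehta_integral T n n x powr (1 - t) * mehta_integral T n n y powr t"
proof -
  let ?P = "forms_prod T 0 n"
  define a where "a = mehta_integral T n n x"
  define b where "b = mehta_integral T n n y"
  have pos: "a > 0" "b > 0" using x y by (auto simp: a_def b_def intro!: mehta_integral_pos)
  have z: "(1 - t) * x + t * y \<ge> 0" using assms by auto
  have "mehta_integral T n n ((1 - t) * x + t * y) / (a powr (1 - t) * b powr t)
     = (LINT p|gaussian_measure n. \<bar>?P p\<bar> powr (2 * ((1 - t) * x + t * y)) / (a powr (1 - t) * b powr t))"
    unfolding mehta_integral_n by simp
  also have "\<dots> \<le> (LINT p|gaussian_measure n. (1 - t) * (\<bar>?P p\<bar> powr (2 * x) / a) + t * (\<bar>?P p\<bar> powr (2 * y) / b))"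
  proof (rule integral_mono)
    show "integrable (gaussian_measure n) (\<lambda>p. \<bar>?P p\<bar> powr (2 * ((1 - t) * x + t * y)) / (a powr (1 - t) * b powr t))"
      using z by (intro integrable_divide integrable_abs_forms_powr) auto
    show "integrable (gaussian_measure n) (\<lambda>p. (1 - t) * (\<bar>?P p\<bar> powr (2 * x) / a) + t * (\<bar>?P p\<bar> powr (2 * y) / b))"
      using x y by (intro Bochner_Integration.integrable_add integrable_mult_right integrable_divide integrable_abs_forms_powr) auto
    fix p
    have "\<bar>?P p\<bar> powr (2 * ((1 - t) * x + t * y)) / (a powr (1 - t) * b powr t)
       = (\<bar>?P p\<bar> powr (2 * x) / a) powr (1 - t) * (\<bar>?P p\<bar> powr (2 * y) / b) powr t"
      using pos by (simp add: powr_divide powr_powr algebra_simps flip: powr_add)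
    also have "\<dots> \<le> (1 - t) * (\<bar>?P p\<bar> powr (2 * x) / a) + t * (\<bar>?P p\<bar> powr (2 * y) / b)"
      using t pos by (intro weighted_am_gm) auto
    finally show "\<bar>?P p\<bar> powr (2 * ((1 - t) * x + t * y)) / (a powr (1 - t) * b powr t) \<le> \<dots>" .
  qed
  also have "\<dots> = (1 - t) * ((LINT p|gaussian_measure n. \<bar>?P p\<bar> powr (2 * x)) / a)
      + t * ((LINT p|gaussian_measure n. \<bar>?P p\<bar> powr (2 * y)) / b)"
    using integrable_abs_forms_powr[of "2 * x" n T] integrable_abs_forms_powr[of "2 * y" n T] x y
    by (simp del: forms_prod.simps)
  also have "\<dots> = 1" using pos by (simp add: a_def b_def mehta_integral_n del: forms_prod.simps)
  finally show ?thesis using pos unfolding a_def[symmetric] b_def[symmetric] by (simp add: field_simps)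
qed

lemma mehta_rhs_n: "mehta_rhs T n n \<gamma> = (\<Prod>i=1..n. Gamma (1 + of_nat (refl_degree T n i) * \<gamma>) / Gamma (1 + \<gamma>))"
  by (simp add: mehta_rhs_def)

lemma refl_degree_pos: "1 \<le> i \<Longrightarrow> i \<le> n \<Longrightarrow> refl_degree T n i > 0"
  by (cases T) auto

lemma mehta_integral_constant:
  assumes x: "x > 1" and \<theta>: "0 \<le> \<theta>" "\<theta> \<le> 1"
  shows "mehta_integral T n n (x + \<theta>) / mehta_rhs T n n (x + \<theta>) = mehta_integral T n n x / mehta_rhs T n n x"
proof -
  define d where "d i = real (refl_degree T n i)" for i
  have d: "d i > 0" if "i \<in> {1..n}" for i using refl_degree_pos[of i n T] that by (simp add: d_def)
  \<comment> \<open>Gamma (1 + d x + d a) grows like Gamma (1 + d x) times (1 + d x) to the power d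
    a. The denominators are the case d = 1, whence the division by 1 + x.\<close>
  define L where "L x = (\<Prod>i=1..n. (1 + d i * x) powr d i / (1 + x))" for x :: real
  have Gr: "((\<lambda>x. Gamma (1 + c * (x + a)) / (Gamma (1 + c * x) * (1 + c * x) powr (c * a))) \<longlongrightarrow> 1) at_top"
    if "c > 0" "a \<ge> 0" for a c :: real
  proof -
    have "filterlim (\<lambda>x. 1 + c * x) at_top at_top" using that by real_asymp
    from filterlim_compose[OF Gamma_ratio_tendsto[of "c * a"] this] show ?thesis
      using that by (simp add: algebra_simps)
  qed
  show ?thesis
  proof (rule bohr_mollerup_ratio[where L = L])
    show "mehta_integral T n n x > 0" if "x > 1" for x using that by (intro mehta_integral_pos) auto
    show "mehta_rhs T n n x > 0" if "x > 1" for x :: real using that by (intro mehta_rhs_pos) auto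
    show "L x > 0" if "x > 1" for x
      unfolding L_def using that d by (intro prod_pos ballI divide_pos_pos) (auto simp: add_pos_pos intro!: add_pos_pos less_imp_neq[symmetric])
    show "mehta_integral T n n (x + 1) / mehta_integral T n n x = mehta_rhs T n n (x + 1) / mehta_rhs T n n x"
      if "x > 1" for x
      using mehta_integral_eq[of 0 n x T] mehta_integral_0[of T n x] mehta_rhs_0[of x T n]
        mehta_integral_pos[of x T n] mehta_rhs_pos[of x T n n] that by (simp add: field_simps)
    show "mehta_integral T n n ((1 - t) * x + t * y) \<le> mehta_integral T n n x powr (1 - t) * mehta_integral T n n y powr t"
      if "x > 1" "y > 1" "0 \<le> t" "t \<le> 1" for x y t
      using that by (intro mehta_integral_log_convex) auto
    show "((\<lambda>x. mehta_rhs T n n (x + a) / (mehta_rhs T n n x * L x powr a)) \<longlongrightarrow> 1) at_top" if a: "a \<ge> 0" for a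
    proof -
      let ?r = "\<lambda>c x. Gamma (1 + c * (x + a)) / (Gamma (1 + c * x) * (1 + c * x) powr (c * a))"
      have "((\<lambda>x. \<Prod>i=1..n. ?r (d i) x / ?r 1 x) \<longlongrightarrow> (\<Prod>i=1..n. 1 / 1)) at_top"
        using a d by (intro tendsto_prod tendsto_divide Gr) auto
      moreover have "\<forall>\<^sub>F x in at_top. (\<Prod>i=1..n. ?r (d i) x / ?r 1 x)
         = mehta_rhs T n n (x + a) / (mehta_rhs T n n x * L x powr a)"
        using eventually_gt_at_top[of 1]
      proof eventually_elim
        case (elim x)
        have p: "(1 + d i * x) powr d i / (1 + x) \<ge> 0" for i using elim by simp
        have "L x powr a = (\<Prod>i=1..n. ((1 + d i * x) powr d i / (1 + x)) powr a)"
          unfolding L_def using p by (intro prod_powr_distrib)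
        also have "\<dots> = (\<Prod>i=1..n. (1 + d i * x) powr (d i * a) / (1 + x) powr a)"
          using elim by (intro prod.cong refl) (simp add: powr_divide powr_powr)
        finally have "mehta_rhs T n n (x + a) / (mehta_rhs T n n x * L x powr a)
          = (\<Prod>i=1..n. (Gamma (1 + d i * (x + a)) / Gamma (1 + (x + a)))
             / ((Gamma (1 + d i * x) / Gamma (1 + x)) * ((1 + d i * x) powr (d i * a) / (1 + x) powr a)))"
          unfolding mehta_rhs_n d_def[symmetric] by (simp only: prod.distrib prod_dividef)
        also have "\<dots> = (\<Prod>i=1..n. ?r (d i) x / ?r 1 x)"
          by (simp add: mult_ac)
        finally show ?case ..
      qed
      ultimately show ?thesis by (simp add: tendsto_cong)
    qed
    show "((\<lambda>x. L (x + a) / L x) \<longlongrightarrow> 1) at_top" if a: "a \<ge> 0" for a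
    proof -
      have "((\<lambda>x. \<Prod>i=1..n. ((1 + d i * (x + a)) / (1 + d i * x)) powr d i / ((1 + (x + a)) / (1 + x)))
          \<longlongrightarrow> (\<Prod>i=1..n. 1 powr d i / 1)) at_top"
      proof (intro tendsto_prod tendsto_divide tendsto_powr tendsto_const)
        show "((\<lambda>x. (1 + d i * (x + a)) / (1 + d i * x)) \<longlongrightarrow> 1) at_top" if "i \<in> {1..n}" for i
          using d[OF that] by real_asymp
        show "((\<lambda>x. (1 + (x + a)) / (1 + x)) \<longlongrightarrow> 1) at_top" by real_asymp
      qed auto
      moreover have "\<forall>\<^sub>F x in at_top. (\<Prod>i=1..n. ((1 + d i * (x + a)) / (1 + d i * x)) powr d i / ((1 + (x + a)) / (1 + x)))
         = L (x + a) / L x"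
        using eventually_gt_at_top[of 1]
      proof eventually_elim
        case (elim x)
        show ?case unfolding L_def prod_dividef[symmetric]
          using elim a d by (intro prod.cong refl) (auto simp: powr_divide less_imp_le add_pos_pos)
      qed
      ultimately show ?thesis by (simp add: tendsto_cong)
    qed
  qed (use assms in auto)
qed

section \<open>Analytic continuation\<close>

lemma complex_of_real_powr_eq:
  "u \<ge> 0 \<Longrightarrow> complex_of_real u powr s = (if u = 0 then 0 else exp (s * of_real (ln u)))"
  by (auto simp: powr_def Ln_of_real)

lemma norm_complex_of_real_powr: "u \<ge> 0 \<Longrightarrow> norm (complex_of_real u powr s) = u powr Re s"
  by (subst norm_powr_real_powr) auto

lemma measurable_complex_of_real_powr:
  fixes u :: "'a \<Rightarrow> real"
  assumes [measurable]: "u \<in> borel_measurable M" and u: "\<And>p. u p \<ge> 0"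
  shows "(\<lambda>p. complex_of_real (u p) powr s) \<in> borel_measurable M"
  unfolding complex_of_real_powr_eq[OF u] by measurable

text \<open>A majorant free of \<open>h\<close>, for dominated convergence. With \<delta> half of
  \<open>Re s\<close>, one factor exp (\<delta> |ln u|) bounds the exponential of the increment and
  another one the logarithm that appears on differentiation. Together they have exponent
  \<open>Re s\<close>, which \<open>u powr Re s\<close> still compensates near
  \<open>u = 0\<close>.\<close>

lemma powr_difference_quotient_bound:
  fixes u :: real and s h :: complex
  assumes u: "u \<ge> 0" and s: "Re s > 0" and h: "h \<noteq> 0" "norm h \<le> Re s / 2"
  shows "norm ((complex_of_real u powr (s + h) - complex_of_real u powr s) / h)
    \<le> 2 / Re s * (1 + u powr (2 * Re s))"
proof (cases "u = 0")
  case True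
  thus ?thesis using s by simp
next
  case False
  hence u: "u > 0" using u by simp
  define L where "L = ln u"
  define \<delta> where "\<delta> = Re s / 2"
  have \<delta>: "\<delta> > 0" using s by (simp add: \<delta>_def)
  have "complex_of_real u powr (s + h) - complex_of_real u powr s
      = complex_of_real u powr s * (exp (h * of_real L) - 1)"
    using u by (simp add: complex_of_real_powr_eq L_def algebra_simps exp_add)
  hence "norm ((complex_of_real u powr (s + h) - complex_of_real u powr s) / h)
      = u powr Re s * (norm (exp (h * of_real L) - 1) / norm h)"
    using u by (simp add: norm_mult norm_divide norm_complex_of_real_powr)
  also have "\<dots> \<le> u powr Re s * (exp (2 * \<delta> * \<bar>L\<bar>) / \<delta>)"
  proof (rule mult_left_mono)
    have "\<bar>Re (h * of_real L)\<bar> \<le> \<delta> * \<bar>L\<bar>"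
      unfolding \<delta>_def using order_trans[OF abs_Re_le_cmod h(2)] by (simp add: abs_mult mult_right_mono del: times_divide_eq_left)
    hence "exp \<bar>Re (h * of_real L)\<bar> * norm (h * of_real L) \<le> exp (\<delta> * \<bar>L\<bar>) * norm (h * of_real L)"
      by (intro mult_right_mono) auto
    moreover have "norm (exp (h * of_real L) - 1) \<le> exp \<bar>Re (h * of_real L)\<bar> * norm (h * of_real L)"
      using Taylor_exp[of "h * of_real L" 0] by simp
    ultimately have "norm (exp (h * of_real L) - 1) / norm h \<le> exp (\<delta> * \<bar>L\<bar>) * \<bar>L\<bar>"
      using h(1) by (simp add: norm_mult field_simps)
    also have "\<dots> \<le> exp (\<delta> * \<bar>L\<bar>) * (exp (\<delta> * \<bar>L\<bar>) / \<delta>)"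
    proof (rule mult_left_mono)
      have "\<delta> * \<bar>L\<bar> \<le> exp (\<delta> * \<bar>L\<bar>)" using exp_ge_add_one_self[of "\<delta> * \<bar>L\<bar>"] by linarith
      thus "\<bar>L\<bar> \<le> exp (\<delta> * \<bar>L\<bar>) / \<delta>" using \<delta> by (simp add: field_simps)
    qed simp
    also have "\<dots> = exp (2 * \<delta> * \<bar>L\<bar>) / \<delta>" by (simp flip: exp_add)
    finally show "norm (exp (h * of_real L) - 1) / norm h \<le> exp (2 * \<delta> * \<bar>L\<bar>) / \<delta>" .
  qed simp
  also have "\<dots> \<le> 1 / \<delta> * (1 + u powr (2 * Re s))"
  proof -
    have "u powr Re s * exp (2 * \<delta> * \<bar>L\<bar>) = exp (Re s * (L + \<bar>L\<bar>))"
      using u by (simp add: powr_def L_def \<delta>_def distrib_left flip: exp_add)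
    also have "\<dots> \<le> 1 + u powr (2 * Re s)"
      using u by (cases "L \<ge> 0") (auto simp: powr_def L_def mult_ac)
    finally show ?thesis using \<delta> by (simp add: field_simps)
  qed
  finally show ?thesis by (simp add: \<delta>_def)
qed

text \<open>The integral is treated as a Mellin-type transform in the exponent of \<open>u\<close>,
  which becomes 2 \<gamma> in the application. The real moments supply all majorants.\<close>

locale complex_moment =
  fixes M :: "'a measure" and f u :: "'a \<Rightarrow> real"
  assumes f: "f \<in> borel_measurable M" "\<And>p. f p \<ge> 0"
    and u: "u \<in> borel_measurable M" "\<And>p. u p \<ge> 0"
    and integrable_f: "integrable M f"
    and integrable_moment: "\<And>a. a \<ge> 0 \<Longrightarrow> integrable M (\<lambda>p. f p * u p powr a)"
begin

definition moment :: "complex \<Rightarrow> complex" where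
  "moment s = (LINT p|M. of_real (f p) * of_real (u p) powr s)"

lemma measurable_integrand: "(\<lambda>p. of_real (f p) * complex_of_real (u p) powr s) \<in> borel_measurable M"
proof -
  note [measurable] = f(1) measurable_complex_of_real_powr[OF u]
  show ?thesis by measurable
qed

lemma integrable_integrand:
  assumes "Re s \<ge> 0"
  shows "integrable M (\<lambda>p. of_real (f p) * complex_of_real (u p) powr s)"
  using integrable_moment[OF assms] measurable_integrand
  by (rule Bochner_Integration.integrable_bound)
     (use f(2) u(2) in \<open>auto simp: norm_mult norm_complex_of_real_powr\<close>)

lemma moment_of_real: "moment (of_real a) = of_real (LINT p|M. f p * u p powr a)"
proof -
  have "of_real (f p) * complex_of_real (u p) powr of_real a = of_real (f p * u p powr a)" for p
    using u(2) by (simp add: powr_of_real)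
  thus ?thesis by (simp only: moment_def integral_complex_of_real)
qed

text \<open>Differentiation under the integral sign, along sequences. Their initial terms are
  dropped to bring the increments into the range of the majorant; where \<open>u\<close> is 0 all
  powers are 0 by convention, so the quotients are 0 as well.\<close>

lemma moment_has_field_derivative:
  assumes s: "Re s > 0"
  shows "(moment has_field_derivative (LINT p|M. of_real (f p) * (of_real (u p) powr s * of_real (ln (u p))))) (at s)"
  unfolding DERIV_def tendsto_at_iff_sequentially o_def
proof (intro allI impI)
  fix h :: "nat \<Rightarrow> complex"
  assume h0: "\<forall>i. h i \<in> UNIV - {0}" and h: "h \<longlonglongrightarrow> 0"
  obtain N where N: "\<And>i. i \<ge> N \<Longrightarrow> norm (h i) < Re s / 2"
    using LIMSEQ_D[OF h, of "Re s / 2"] s by auto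
  define k where "k i = h (i + N)" for i
  have k0: "k i \<noteq> 0" and kb: "norm (k i) \<le> Re s / 2" for i
    using h0 N[of "i + N"] by (auto simp: k_def)
  have k: "k \<longlonglongrightarrow> 0" unfolding k_def using h by (rule LIMSEQ_ignore_initial_segment)
  let ?q = "\<lambda>i p. of_real (f p) * ((complex_of_real (u p) powr (s + k i) - of_real (u p) powr s) / k i)"
  let ?b = "\<lambda>p. f p * (2 / Re s * (1 + u p powr (2 * Re s)))"
  have "(\<lambda>i. LINT p|M. ?q i p) \<longlonglongrightarrow> (LINT p|M. of_real (f p) * (of_real (u p) powr s * of_real (ln (u p))))"
  proof (rule integral_dominated_convergence)
    note [measurable] = f(1) u(1) measurable_complex_of_real_powr[OF u]
    show "(\<lambda>p. of_real (f p) * (complex_of_real (u p) powr s * of_real (ln (u p)))) \<in> borel_measurable M"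
      "?q i \<in> borel_measurable M" for i by measurable
    have "integrable M (\<lambda>p. 2 / Re s * (f p + f p * u p powr (2 * Re s)))"
      using s by (intro integrable_mult_right Bochner_Integration.integrable_add integrable_f integrable_moment) auto
    thus "integrable M ?b" by (simp add: algebra_simps)
    show "AE p in M. norm (?q i p) \<le> ?b p" for i
      unfolding norm_mult using f(2)
      by (intro AE_I2 mult_mono powr_difference_quotient_bound[OF u(2) s k0 kb]) auto
    show "AE p in M. (\<lambda>i. ?q i p) \<longlonglongrightarrow> of_real (f p) * (complex_of_real (u p) powr s * of_real (ln (u p)))"
    proof (intro AE_I2 tendsto_mult tendsto_const)
      fix p
      show "(\<lambda>i. (complex_of_real (u p) powr (s + k i) - of_real (u p) powr s) / k i)
          \<longlonglongrightarrow> of_real (u p) powr s * of_real (ln (u p))"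
      proof (cases "u p = 0")
        case False
        have "((\<lambda>s. complex_of_real (u p) powr s) has_field_derivative
            of_real (ln (u p)) * of_real (u p) powr s) (at s)"
          using has_field_derivative_powr_right[of "complex_of_real (u p)" s] False u(2)[of p]
          by (simp add: Ln_of_real mult.commute)
        hence "((\<lambda>h. (complex_of_real (u p) powr (s + h) - of_real (u p) powr s) / h)
           \<longlongrightarrow> of_real (ln (u p)) * of_real (u p) powr s) (at 0)" by (simp add: DERIV_def)
        hence "(\<lambda>i. (complex_of_real (u p) powr (s + k i) - of_real (u p) powr s) / k i)
          \<longlonglongrightarrow> of_real (ln (u p)) * of_real (u p) powr s"
          using k0 k unfolding tendsto_at_iff_sequentially o_def by auto
        thus ?thesis by (simp add: mult.commute)
      qed simp
    qed
  qed
  moreover have "(LINT p|M. ?q i p) = (moment (s + k i) - moment s) / k i" for i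
  proof -
    have "Re (s + k i) \<ge> 0" using kb[of i] abs_Re_le_cmod[of "k i"] s by simp
    note I = integrable_integrand[OF this] integrable_integrand[OF less_imp_le[OF s]]
    have "(LINT p|M. ?q i p) = (LINT p|M. (of_real (f p) * of_real (u p) powr (s + k i)
        - of_real (f p) * of_real (u p) powr s) / k i)"
      by (rule Bochner_Integration.integral_cong) (simp_all add: right_diff_distrib)
    also have "\<dots> = (moment (s + k i) - moment s) / k i"
      using I by (simp add: moment_def)
    finally show ?thesis .
  qed
  ultimately have "(\<lambda>i. (moment (s + h (i + N)) - moment s) / h (i + N))
      \<longlonglongrightarrow> (LINT p|M. of_real (f p) * (of_real (u p) powr s * of_real (ln (u p))))"
    by (simp only: k_def)
  thus "(\<lambda>i. (moment (s + h i) - moment s) / h i)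
      \<longlonglongrightarrow> (LINT p|M. of_real (f p) * (of_real (u p) powr s * of_real (ln (u p))))"
    by (rule LIMSEQ_offset)
qed

lemma moment_holomorphic: "moment holomorphic_on {s. Re s > 0}"
  unfolding holomorphic_on_def using moment_has_field_derivative
  by (auto simp: field_differentiable_def intro: has_field_derivative_at_within)

text \<open>Continuity up to the line \<open>Re s = 0\<close>, along one sequence from the right.
  All exponents stay between \<open>Re s\<close> and \<open>Re s + 1\<close>, so 1 +
  \<open>u powr (Re s + 1)\<close> dominates both for small and for large \<open>u\<close>.\<close>

lemma moment_tendsto_right:
  assumes s: "Re s \<ge> 0" and u0: "AE p in M. u p \<noteq> 0"
  shows "(\<lambda>i. moment (s + of_real (1 / real (Suc i)))) \<longlonglongrightarrow> moment s"
  unfolding moment_def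
proof (rule integral_dominated_convergence)
  note [measurable] = measurable_integrand
  let ?b = "\<lambda>p. f p + f p * u p powr (Re s + 1)"
  show "integrable M ?b"
    using s by (intro Bochner_Integration.integrable_add integrable_f integrable_moment) auto
  show "AE p in M. norm (of_real (f p) * complex_of_real (u p) powr (s + of_real (1 / real (Suc i)))) \<le> ?b p" for i
  proof (rule AE_I2)
    fix p
    define a where "a = Re s + 1 / real (Suc i)"
    have a: "0 \<le> a" "a \<le> Re s + 1" using s by (auto simp: a_def)
    have "u p powr a \<le> 1 + u p powr (Re s + 1)"
    proof (cases "u p \<le> 1")
      case True
      hence "u p powr a \<le> 1" using a u(2)[of p] by (intro powr_le1) auto
      thus ?thesis by (simp add: add_increasing2)
    next
      case False
      thus ?thesis using a powr_mono[of a "Re s + 1" "u p"] by (simp del: powr_le_cancel_iff)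
    qed
    from mult_left_mono[OF this f(2)[of p]]
    show "norm (of_real (f p) * complex_of_real (u p) powr (s + of_real (1 / real (Suc i)))) \<le> ?b p"
      using f(2)[of p] by (simp add: norm_mult norm_complex_of_real_powr u(2) a_def distrib_left)
  qed
  show "AE p in M. (\<lambda>i. of_real (f p) * complex_of_real (u p) powr (s + of_real (1 / real (Suc i))))
      \<longlonglongrightarrow> of_real (f p) * of_real (u p) powr s"
    using u0
  proof eventually_elim
    case (elim p)
    have "(\<lambda>i. s + of_real (1 / real (Suc i))) \<longlonglongrightarrow> s + of_real 0"
      by (intro tendsto_intros LIMSEQ_Suc[OF lim_1_over_n])
    hence "(\<lambda>i. s + of_real (1 / real (Suc i))) \<longlonglongrightarrow> s" by simp
    from tendsto_mult[OF this tendsto_const[of "complex_of_real (ln (u p))"]]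
    have "(\<lambda>i. exp ((s + of_real (1 / real (Suc i))) * complex_of_real (ln (u p))))
        \<longlonglongrightarrow> exp (s * of_real (ln (u p)))" by (rule tendsto_exp)
    thus ?case using elim u(2)[of p]
      by (intro tendsto_mult tendsto_const) (simp add: complex_of_real_powr_eq)
  qed
qed (rule measurable_integrand)+

end

lemma mehta_rhs_of_real: "mehta_rhs T n m (complex_of_real g) = of_real (mehta_rhs T n m g)"
proof -
  have G: "Gamma (1 + of_nat k * complex_of_real g) = of_real (Gamma (1 + real k * g))"
    "Gamma (1 + of_nat l + of_nat k * complex_of_real g) = of_real (Gamma (1 + real l + real k * g))"
    "Gamma (1 + complex_of_real g) = of_real (Gamma (1 + g))"
    "Gamma (2 + complex_of_real g) = of_real (Gamma (2 + g))" for k l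
    by (simp_all flip: Gamma_complex_of_real)
  show ?thesis unfolding mehta_rhs_def G by simp
qed

lemma mehta_rhs_field_differentiable:
  assumes \<gamma>: "Re \<gamma> \<ge> 0"
  shows "mehta_rhs T n m field_differentiable at \<gamma>"
proof -
  have pos: "z \<notin> \<int>\<^sub>\<le>\<^sub>0" if "Re z > 0" for z :: complex
    using that by (auto elim!: nonpos_Ints_cases)
  have G: "(\<lambda>\<gamma>. Gamma (of_nat a + of_nat b * \<gamma>)) field_differentiable at \<gamma>" if "a > 0" for a b
  proof -
    have "of_nat a + of_nat b * \<gamma> \<notin> \<int>\<^sub>\<le>\<^sub>0" using that \<gamma> by (intro pos) (simp add: add_pos_nonneg)
    thus ?thesis
      by (intro field_differentiable_compose[of "\<lambda>\<gamma>. of_nat a + of_nat b * \<gamma>" _ Gamma, unfolded o_def]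
          field_differentiable_Gamma derivative_intros)
  qed
  have nz: "Gamma (1 + \<gamma>) \<noteq> 0" "Gamma (2 + \<gamma>) \<noteq> 0"
    using \<gamma> by (auto simp: Gamma_eq_zero_iff dest: pos[rotated] intro!: pos)
  have den: "of_nat j + of_nat (m + j) * \<gamma> \<noteq> 0" if "j \<in> {1..n - m}" for j
  proof
    assume "of_nat j + of_nat (m + j) * \<gamma> = 0"
    hence "Re (of_nat j + of_nat (m + j) * \<gamma>) = 0" by (simp only: zero_complex.sel)
    moreover have "Re (of_nat j + of_nat (m + j) * \<gamma>) > 0" using \<gamma> that by (simp add: add_pos_nonneg)
    ultimately show False by simp
  qed
  have prod: "(\<lambda>z. \<Prod>i\<in>I. h i z) field_differentiable at \<gamma>"
    if "\<And>i. i \<in> I \<Longrightarrow> h i field_differentiable at \<gamma>" "finite I" for h :: "nat \<Rightarrow> complex \<Rightarrow> complex" and I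
    using that(2,1) by (induction I rule: finite_induct) (auto intro: derivative_intros)
  have G1: "(\<lambda>\<gamma>. Gamma (1 + of_nat b * \<gamma>)) field_differentiable at \<gamma>"
    "(\<lambda>\<gamma>. Gamma (1 + of_nat a + of_nat b * \<gamma>)) field_differentiable at \<gamma>"
    "(\<lambda>\<gamma>. Gamma (1 + \<gamma>)) field_differentiable at \<gamma>"
    "(\<lambda>\<gamma>. Gamma (2 + \<gamma>)) field_differentiable at \<gamma>" for a b
    using G[of 1 b] G[of "Suc a" b] G[of 1 1] G[of 2 1] by simp_all
  have "(\<lambda>\<gamma>. mehta_rhs T n m \<gamma>) field_differentiable at \<gamma>"
    unfolding mehta_rhs_def
    by (intro derivative_intros prod G1 nz den finite_atLeastAtMost)
  thus ?thesis by simp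
qed

lemma complex_moment_forms_prod:
  "complex_moment (gaussian_measure n) (\<lambda>p. (forms_prod T m n p)\<^sup>2) (\<lambda>p. \<bar>forms_prod T 0 n p\<bar>)"
proof
  note [measurable] = measurable_forms_prod
  show "(\<lambda>p. (forms_prod T m n p)\<^sup>2) \<in> borel_measurable (gaussian_measure n)"
    "(\<lambda>p. \<bar>forms_prod T 0 n p\<bar>) \<in> borel_measurable (gaussian_measure n)" by measurable
  note sq = poly_less_power[OF poly_less_forms_prod[of n T m], of 2]
  show "integrable (gaussian_measure n) (\<lambda>p. (forms_prod T m n p)\<^sup>2)"
    by (rule integrable_poly_less[OF sq])
  show "integrable (gaussian_measure n) (\<lambda>p. (forms_prod T m n p)\<^sup>2 * \<bar>forms_prod T 0 n p\<bar> powr a)"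
    if "a \<ge> 0" for a
    using integrable_poly_powr[OF sq poly_less_forms_prod] that by simp
qed (auto simp del: forms_prod.simps)

section \<open>Identification of the complex integral\<close>

definition complex_mehta_integral :: "refl_type \<Rightarrow> nat \<Rightarrow> nat \<Rightarrow> complex \<Rightarrow> complex" where
  "complex_mehta_integral T n m \<gamma> = (LINT p|gaussian_measure n.
     complex_of_real ((forms_prod T m n p)\<^sup>2) * complex_of_real \<bar>forms_prod T 0 n p\<bar> powr (2 * \<gamma>))"

text \<open>The segment comes from \<open>mehta_integral_constant\<close>, applied at the base point
  2 with shifts \<theta> in [0, 1]. It has limit points inside the half-plane, as the identity
  theorem demands.\<close>

lemma complex_mehta_integral_real:
  assumes g: "2 \<le> g" "g \<le> 3" and "m \<le> n"
  shows "complex_mehta_integral T n m (of_real g)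
    = of_real (mehta_integral T n n 2 / mehta_rhs T n n 2) * mehta_rhs T n m (of_real g)"
proof -
  interpret complex_moment "gaussian_measure n" "\<lambda>p. (forms_prod T m n p)\<^sup>2" "\<lambda>p. \<bar>forms_prod T 0 n p\<bar>"
    by (rule complex_moment_forms_prod)
  have "complex_mehta_integral T n m (of_real g) = of_real (mehta_integral T n m g)"
    using moment_of_real[of "2 * g"]
    by (simp add: complex_mehta_integral_def moment_def mehta_integral_def del: forms_prod.simps)
  also have "mehta_integral T n m g = mehta_rhs T n m g * (mehta_integral T n n 2 / mehta_rhs T n n 2)"
  proof -
    have "mehta_integral T n n g / mehta_rhs T n n g = mehta_integral T n n 2 / mehta_rhs T n n 2"
      using mehta_integral_constant[of 2 "g - 2" T n] g by simp
    thus ?thesis using mehta_integral_eq[of m n g T] assms by (simp only:)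
  qed
  finally show ?thesis by (simp add: mehta_rhs_of_real mult.commute)
qed

lemma complex_mehta_integral_eq_aux:
  assumes "m \<le> n" "Re \<gamma> > 0"
  shows "complex_mehta_integral T n m \<gamma>
    = of_real (mehta_integral T n n 2 / mehta_rhs T n n 2) * mehta_rhs T n m \<gamma>"
proof -
  interpret complex_moment "gaussian_measure n" "\<lambda>p. (forms_prod T m n p)\<^sup>2" "\<lambda>p. \<bar>forms_prod T 0 n p\<bar>"
    by (rule complex_moment_forms_prod)
  define C where "C = complex_of_real (mehta_integral T n n 2 / mehta_rhs T n n 2)"
  let ?S = "{z. Re z > 0}"
  have "(moment \<circ> (\<lambda>\<gamma>. 2 * \<gamma>)) holomorphic_on ?S"
    by (rule holomorphic_on_compose_gen[OF _ moment_holomorphic]) (auto intro!: holomorphic_intros)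
  hence J: "complex_mehta_integral T n m holomorphic_on ?S"
    by (simp add: o_def complex_mehta_integral_def[abs_def] moment_def del: forms_prod.simps)
  have R: "mehta_rhs T n m holomorphic_on ?S"
    unfolding holomorphic_on_def
    by (auto intro!: field_differentiable_at_within[OF mehta_rhs_field_differentiable])
  have "complex_mehta_integral T n m \<gamma> - C * mehta_rhs T n m \<gamma> = 0"
  proof (rule analytic_continuation[where f = "\<lambda>\<gamma>. complex_mehta_integral T n m \<gamma> - C * mehta_rhs T n m \<gamma>"
        and S = ?S and U = "of_real ` {2..3}" and \<xi> = 2])
    show "(\<lambda>\<gamma>. complex_mehta_integral T n m \<gamma> - C * mehta_rhs T n m \<gamma>) holomorphic_on ?S"
      by (intro holomorphic_intros J R)
    show "open ?S" by (rule open_halfspace_Re_gt)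
    show "connected ?S" by (intro convex_connected convex_halfspace_Re_gt)
    show "(2::complex) islimpt of_real ` {2..3}"
    proof -
      have "\<forall>\<^sub>F y in at 2. complex_of_real y \<noteq> of_real 2"
        unfolding of_real_eq_iff by (rule eventually_neq_at_within)
      moreover have "isCont complex_of_real 2" by (rule continuous_of_real[OF continuous_ident])
      ultimately have "complex_of_real 2 islimpt of_real ` {2..3}"
        by (intro islimpt_isCont_image) auto
      thus ?thesis by simp
    qed
    show "complex_mehta_integral T n m \<gamma> - C * mehta_rhs T n m \<gamma> = 0" if "\<gamma> \<in> of_real ` {2..3}" for \<gamma>
      using that complex_mehta_integral_real[OF _ _ assms(1)] by (auto simp: C_def)
  qed (use assms in auto)
  thus ?thesis by (simp add: C_def)
qed

lemma complex_mehta_integral_eq_multiple: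
  assumes "m \<le> n" "Re \<gamma> \<ge> 0"
  shows "complex_mehta_integral T n m \<gamma>
    = of_real (mehta_integral T n n 2 / mehta_rhs T n n 2) * mehta_rhs T n m \<gamma>"
proof -
  interpret complex_moment "gaussian_measure n" "\<lambda>p. (forms_prod T m n p)\<^sup>2" "\<lambda>p. \<bar>forms_prod T 0 n p\<bar>"
    by (rule complex_moment_forms_prod)
  define C where "C = complex_of_real (mehta_integral T n n 2 / mehta_rhs T n n 2)"
  \<comment> \<open>Halved because the moment is taken at twice the parameter, where the shift is
    then the one of \<open>moment_tendsto_right\<close>.\<close>
  define \<delta> where "\<delta> i = complex_of_real (1 / real (Suc i)) / 2" for i
  have J: "complex_mehta_integral T n m z = moment (2 * z)" for z
    by (simp add: complex_mehta_integral_def moment_def del: forms_prod.simps)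
  have "AE p in gaussian_measure n. \<bar>forms_prod T 0 n p\<bar> \<noteq> 0"
    using AE_generic_points[of n] by eventually_elim (use forms_prod_nonzero in auto)
  hence lim: "(\<lambda>i. moment (2 * \<gamma> + of_real (1 / real (Suc i)))) \<longlonglongrightarrow> moment (2 * \<gamma>)"
    using assms by (intro moment_tendsto_right) auto
  have "\<delta> \<longlonglongrightarrow> of_real 0 / 2"
    unfolding \<delta>_def by (intro tendsto_intros LIMSEQ_Suc[OF lim_1_over_n]) auto
  hence "(\<lambda>i. \<gamma> + \<delta> i) \<longlonglongrightarrow> \<gamma>" using tendsto_add[OF tendsto_const] by fastforce
  moreover have "isCont (mehta_rhs T n m) \<gamma>"
    using mehta_rhs_field_differentiable assms by (intro field_differentiable_imp_continuous_at) auto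
  ultimately have "(\<lambda>i. mehta_rhs T n m (\<gamma> + \<delta> i)) \<longlonglongrightarrow> mehta_rhs T n m \<gamma>"
    by (rule isCont_tendsto_compose[rotated])
  hence "(\<lambda>i. C * mehta_rhs T n m (\<gamma> + \<delta> i)) \<longlonglongrightarrow> C * mehta_rhs T n m \<gamma>"
    by (intro tendsto_mult tendsto_const)
  moreover have "C * mehta_rhs T n m (\<gamma> + \<delta> i) = moment (2 * \<gamma> + of_real (1 / real (Suc i)))" for i
  proof -
    have "Re (\<gamma> + \<delta> i) > 0" using assms by (simp add: \<delta>_def add_nonneg_pos)
    note eq = complex_mehta_integral_eq_aux[OF assms(1) this, of T]
    have "2 * (z / 2) = z" for z :: complex by simp
    hence "2 * (\<gamma> + \<delta> i) = 2 * \<gamma> + of_real (1 / real (Suc i))"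
      by (simp only: \<delta>_def distrib_left)
    thus ?thesis using eq unfolding J C_def[symmetric] by (simp only:)
  qed
  ultimately have "(\<lambda>i. moment (2 * \<gamma> + of_real (1 / real (Suc i)))) \<longlonglongrightarrow> C * mehta_rhs T n m \<gamma>"
    by (simp only:)
  with lim show ?thesis unfolding J C_def[symmetric] by (rule LIMSEQ_unique)
qed

text \<open>The constant does not involve \<open>m\<close> or \<gamma>, so it can be read off at
  \<open>m = n\<close> and \<gamma> = 0. There the integrand is 1 off the mirrors, while
  \<open>0 powr 0 = 0\<close> only affects a null set, and the Gaussian measure has total mass
  1.\<close>

lemma mehta_constant_eq_1: "complex_of_real (mehta_integral T n n 2 / mehta_rhs T n n 2) = 1"
proof -
  have "mehta_rhs T n n (0::complex) = 1" by (simp add: mehta_rhs_n)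
  moreover have "complex_mehta_integral T n n 0 = 1"
  proof -
    have "complex_mehta_integral T n n 0 = (LINT p|gaussian_measure n. 1)"
      unfolding complex_mehta_integral_def
    proof (rule integral_cong_AE)
      show "(\<lambda>p. complex_of_real ((forms_prod T n n p)\<^sup>2) * complex_of_real \<bar>forms_prod T 0 n p\<bar> powr (2 * 0))
          \<in> borel_measurable (gaussian_measure n)"
        by (rule complex_moment.measurable_integrand[OF complex_moment_forms_prod])
      show "AE p in gaussian_measure n.
          complex_of_real ((forms_prod T n n p)\<^sup>2) * complex_of_real \<bar>forms_prod T 0 n p\<bar> powr (2 * 0) = 1"
        using AE_generic_points[of n]
        by eventually_elim (use forms_prod_nonzero in \<open>auto simp: forms_prod_full simp del: forms_prod.simps\<close>)
    qed simp
    thus ?thesis by (simp add: gaussian.prob_space)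
  qed
  ultimately show ?thesis using complex_mehta_integral_eq_multiple[of n n 0 T] by simp
qed

theorem proposition7p12:
  fixes T :: refl_type and n n0 n1 :: nat and \<gamma> :: complex
  assumes "n = n0 + n1" and "n1 \<ge> 2" and "Re \<gamma> \<ge> 0"
  defines "P \<equiv> forms_prod T 0 n" and "P1 \<equiv> forms_prod T n0 n"
    and "d \<equiv> refl_degree T n" and "d1 \<equiv> refl_degree T n1"
  shows "integrable (gaussian_measure n)
           (\<lambda>x. complex_of_real ((P1 x)\<^sup>2) * complex_of_real \<bar>P x\<bar> powr (2 * \<gamma>))
       \<and> (LINT x|gaussian_measure n.
            complex_of_real ((P1 x)\<^sup>2) * complex_of_real \<bar>P x\<bar> powr (2 * \<gamma>))
         = (\<Prod>i=1..n0. Gamma (1 + of_nat (d i) * \<gamma>) / Gamma (1 + \<gamma>))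
           * (\<Prod>j=1..n1. of_nat j * (1 + \<gamma>) / (of_nat j + of_nat (n0 + j) * \<gamma>)
                * (Gamma (1 + of_nat (d1 j) + of_nat (d (n0 + j)) * \<gamma>) / Gamma (2 + \<gamma>)))"
proof
  show "integrable (gaussian_measure n)
      (\<lambda>x. complex_of_real ((P1 x)\<^sup>2) * complex_of_real \<bar>P x\<bar> powr (2 * \<gamma>))"
    unfolding P_def P1_def using assms(3)
    by (intro complex_moment.integrable_integrand[OF complex_moment_forms_prod]) simp
  have "n0 \<le> n" "n - n0 = n1" using assms(1) by auto
  thus "(LINT x|gaussian_measure n.
            complex_of_real ((P1 x)\<^sup>2) * complex_of_real \<bar>P x\<bar> powr (2 * \<gamma>))
         = (\<Prod>i=1..n0. Gamma (1 + of_nat (d i) * \<gamma>) / Gamma (1 + \<gamma>))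
           * (\<Prod>j=1..n1. of_nat j * (1 + \<gamma>) / (of_nat j + of_nat (n0 + j) * \<gamma>)
                * (Gamma (1 + of_nat (d1 j) + of_nat (d (n0 + j)) * \<gamma>) / Gamma (2 + \<gamma>)))"
    using complex_mehta_integral_eq_multiple[of n0 n \<gamma> T, unfolded mehta_constant_eq_1] assms(3)
    unfolding complex_mehta_integral_def mehta_rhs_def P_def P1_def d_def d1_def
    by (simp only: mult_1_left)
qed

end
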